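(* Let $\alpha_1=\alpha_1(d)=\sup_{\beta>1}\inf\big\{\alpha>0:\ \limsup_{n\to\infty}\mathbb{P}[B(0,n)\overset{\mathcal{L}_{\alpha}}{\longleftrightarrow}\partial B(0,\lceil\beta n\rceil)]=1\big\}$. a) For every $d\ge 3$, $\alpha_1(d)>0$. b) For $d\ge 3$ and $0<\alpha<\alpha_1(d)$ there exist constants $C(d,\alpha)<\infty$ and $c(d,\alpha)>0$, with $\lim_{\alpha\to 0}c(d,\alpha)=d-2$, such that for all integers $N\ge 1$, $$\mathbb{P}[0\overset{\mathcal{L}_{\alpha}}{\longleftrightarrow}\partial B(0,N)]\le C(d,\alpha)\cdot N^{-c(d,\alpha)}.$$ In fact, for all sufficiently small $\alpha$ one can take $c(d,\alpha)=d-2-C(d)\big(\log\frac1\alpha\big)^{-1}$, where $C(d)<\infty$ is a large enough constant depending only on $d$.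
   Context: Let $Q=(Q^x_y)_{x,y}$ be the transition matrix of simple random walk on $\mathbb{Z}^d$. A based loop is an element $\dot\ell=(x_1,\dots,x_n)\in(\mathbb{Z}^d)^n$, $n\ge 2$, with $x_1\ne x_2,\dots,x_{n-1}\neq x_n,x_n\ne x_1$; loops are equivalence classes of based loops under circular permutation. Put $\dot\mu(\dot\ell)=\frac1n Q^{x_1}_{x_2}\cdots Q^{x_{n-1}}_{x_n}Q^{x_n}_{x_1}$ and let $\mu$ be the push-forward of $\dot\mu$ to the space of loops. For $\alpha>0$, $\mathcal{L}_\alpha$ is the Poisson point process of loops with intensity $\alpha\mu$. An edge of $\mathbb{Z}^d$ is open if it is traversed by at least one loop of $\mathcal{L}_\alpha$ (a loop $(x_1,\dots,x_n)$ traverses $\{x_i,x_{i+1}\}$ and $\{x_n,x_1\}$). For vertex sets $A,B$ (or single vertices), $A\overset{\mathcal{L}_\alpha}{\longleftrightarrow}B$ means that some $x\in A$ and $y\in B$ are connected by a path of open edges (a vertex is connected to itself). $B(x,n)=\{y:\|y-x\|_\infty\le n\}$, and $\partial F=\{x\in F:\ x\text{ has a neighbour outside }F\}$. Convention: $\inf\emptyset=+\infty$. *)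

theory Defs
  imports "HOL-Probability.Probability"
begin

text \<open>The library's \<open>poisson_pmf r\<close> is only specified for \<open>r > 0\<close>; the Poisson law of
  parameter 0 is the point mass at 0.\<close>

definition poisson_law :: "real \<Rightarrow> nat pmf" where
  "poisson_law r = (if r > 0 then poisson_pmf r else return_pmf 0)"

text \<open>A point configuration on a countable space is given by the multiplicities \<open>\<omega> x\<close> of its
  points.\<close>

definition num_points :: "'a set \<Rightarrow> ('a \<Rightarrow> nat) \<Rightarrow> ennreal" where
  "num_points A \<omega> = (\<integral>\<^sup>+x. of_nat (\<omega> x) \<partial>count_space A)"

text \<open>The usual convention \<open>num_points A = \<infinity>\<close> almost surely when \<open>A\<close> has infinite intensity is
  not listed: for \<open>\<sigma>\<close>-finite \<open>\<Lambda>\<close> it follows from the other clauses.\<close>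

definition is_poisson_process :: "'a measure \<Rightarrow> ('a \<Rightarrow> nat) measure \<Rightarrow> bool" where
  "is_poisson_process \<Lambda> P \<longleftrightarrow> prob_space P \<and>
     (\<forall>A\<in>sets \<Lambda>. num_points A \<in> borel_measurable P) \<and>
     (\<forall>A\<in>sets \<Lambda>. emeasure \<Lambda> A < \<infinity> \<longrightarrow>
        (\<forall>k. measure P {\<omega>\<in>space P. num_points A \<omega> = of_nat k} = pmf (poisson_law (measure \<Lambda> A)) k)) \<and>
     (\<forall>A::nat \<Rightarrow> 'a set. range A \<subseteq> sets \<Lambda> \<longrightarrow> disjoint_family A \<longrightarrow>
        prob_space.indep_vars P (\<lambda>_. borel) (\<lambda>i. num_points (A i)) UNIV)"

text \<open>The (law of the) Poisson point process with intensity measure \<open>\<Lambda>\<close> on a countable discrete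
  space: independent Poisson multiplicities.  \<open>is_poisson_process_poisson_process\<close> below shows
  that it has the defining properties.\<close>

definition poisson_process :: "'a measure \<Rightarrow> ('a \<Rightarrow> nat) measure" where
  "poisson_process \<Lambda> = (\<Pi>\<^sub>M x\<in>space \<Lambda>. measure_pmf (poisson_law (measure \<Lambda> {x})))"

lemma pmf_poisson_law:
  "r \<ge> 0 \<Longrightarrow> pmf (poisson_law r) k = r ^ k / fact k * exp (- r)"
  by (cases "r = 0"; cases k) (auto simp: poisson_law_def pmf_return indicator_def)

lemma poisson_law_convolution:
  assumes "r \<ge> 0" "s \<ge> 0"
  shows "(\<Sum>j\<le>k. pmf (poisson_law r) j * pmf (poisson_law s) (k - j)) = pmf (poisson_law (r + s)) k"
proof -
  have "(\<Sum>j\<le>k. pmf (poisson_law r) j * pmf (poisson_law s) (k - j))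
      = (\<Sum>j\<le>k. of_nat (k choose j) * r ^ j * s ^ (k - j) * (exp (- (r + s)) / fact k))"
    using assms
    by (intro sum.cong refl)
       (simp add: pmf_poisson_law binomial_fact field_simps flip: exp_add)
  also have "\<dots> = (r + s) ^ k * (exp (- (r + s)) / fact k)"
    by (simp only: binomial_ring sum_distrib_right)
  finally show ?thesis using assms by (simp add: pmf_poisson_law)
qed

lemma num_points_finite:
  "finite A \<Longrightarrow> num_points A \<omega> = of_nat (\<Sum>x\<in>A. \<omega> x)"
  by (simp add: num_points_def nn_integral_count_space_finite)

lemma num_points_restrict: "num_points A (restrict \<omega> A) = num_points A \<omega>"
  unfolding num_points_def by (intro nn_integral_cong) auto

lemma num_points_SUP:
  assumes "incseq B" "(\<Union>n. B n) = A"
  shows "num_points A \<omega> = (SUP n. num_points (B n) \<omega>)"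
proof -
  have sub: "B n \<subseteq> A" for n using assms by auto
  have int: "num_points (B n) \<omega> = (\<integral>\<^sup>+x. of_nat (\<omega> x) * indicator (B n) x \<partial>count_space A)" for n
    unfolding num_points_def using sub[of n]
    by (subst (1 2) nn_integral_count_space_indicator)
       (auto intro!: nn_integral_cong split: split_indicator)
  have SUP: "(SUP n. (of_nat (\<omega> x) :: ennreal) * indicator (B n) x) = of_nat (\<omega> x)"
    if "x \<in> A" for x
  proof (rule antisym)
    show "(SUP n. (of_nat (\<omega> x) :: ennreal) * indicator (B n) x) \<le> of_nat (\<omega> x)"
      by (intro SUP_least) (auto split: split_indicator)
    from that assms obtain n where "x \<in> B n" by auto
    then show "of_nat (\<omega> x) \<le> (SUP n. (of_nat (\<omega> x) :: ennreal) * indicator (B n) x)"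
      by (intro SUP_upper2[of n]) auto
  qed
  have "incseq (\<lambda>n x. (of_nat (\<omega> x) :: ennreal) * indicator (B n) x)"
    using assms(1)
    by (auto simp: incseq_def le_fun_def split: split_indicator)
  then have "(SUP n. num_points (B n) \<omega>)
      = (\<integral>\<^sup>+x. (SUP n. of_nat (\<omega> x) * indicator (B n) x) \<partial>count_space A)"
    unfolding int by (subst nn_integral_monotone_convergence_SUP) auto
  also have "\<dots> = num_points A \<omega>"
    unfolding num_points_def by (intro nn_integral_cong) (use SUP in auto)
  finally show ?thesis ..
qed

lemma incseq_bounded_nat_SUP:
  fixes f :: "nat \<Rightarrow> nat"
  assumes "(SUP n. (of_nat (f n) :: ennreal)) \<le> of_nat k"
  shows "\<exists>j\<le>k. (SUP n. (of_nat (f n) :: ennreal)) = of_nat j"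
proof -
  have le: "f n \<le> k" for n
    using assms by (auto simp: SUP_le_iff)
  then have fin: "finite (range f)" by (intro finite_subset[of "range f" "{..k}"]) auto
  define j where "j = Max (range f)"
  have "j \<in> range f" unfolding j_def using fin by (intro Max_in) auto
  then obtain m where m: "j = f m" by auto
  have "f n \<le> j" for n unfolding j_def using fin by auto
  then have "(SUP n. (of_nat (f n) :: ennreal)) = of_nat j"
    by (intro antisym SUP_least SUP_upper2[of m]) (auto simp: m)
  with le m show ?thesis by auto
qed

locale countable_intensity =
  fixes \<Lambda> :: "'a measure"
  assumes countable_space: "countable (space \<Lambda>)"
    and sets_eq_Pow: "sets \<Lambda> = Pow (space \<Lambda>)"
    and finite_points: "\<And>x. x \<in> space \<Lambda> \<Longrightarrow> emeasure \<Lambda> {x} < \<infinity>"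
begin

abbreviation P where "P \<equiv> poisson_process \<Lambda>"

lemma prob_space_P: "prob_space P"
  unfolding poisson_process_def by (intro prob_space_PiM measure_pmf.prob_space_axioms)

sublocale P: prob_space P by (rule prob_space_P)

lemma space_P: "space P = space \<Lambda> \<rightarrow>\<^sub>E UNIV"
  by (simp add: poisson_process_def space_PiM)

lemma component_measurable [measurable]:
  "x \<in> space \<Lambda> \<Longrightarrow> (\<lambda>\<omega>. \<omega> x) \<in> measurable P (count_space UNIV)"
  unfolding poisson_process_def
  by (subst measurable_cong_sets[OF refl, of _ "measure_pmf (poisson_law (measure \<Lambda> {x}))"])
     (auto intro: measurable_component_singleton)

lemma distr_component:
  assumes "x \<in> space \<Lambda>"
  shows "distr P (count_space UNIV) (\<lambda>\<omega>. \<omega> x) = measure_pmf (poisson_law (measure \<Lambda> {x}))"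
proof -
  have "distr P (count_space UNIV) (\<lambda>\<omega>. \<omega> x)
      = distr P (measure_pmf (poisson_law (measure \<Lambda> {x}))) (\<lambda>\<omega>. \<omega> x)"
    by (intro distr_cong) auto
  also have "\<dots> = measure_pmf (poisson_law (measure \<Lambda> {x}))"
    unfolding poisson_process_def using assms
    by (intro distr_PiM_component) (auto intro: measure_pmf.prob_space_axioms)
  finally show ?thesis .
qed

lemma indep_components: "P.indep_vars (\<lambda>_. count_space UNIV) (\<lambda>x \<omega>. \<omega> x) (space \<Lambda>)"
proof (cases "space \<Lambda> = {}")
  case True
  then show ?thesis by (auto simp: P.indep_vars_def P.indep_sets_def)
next
  case False
  have "distr P (\<Pi>\<^sub>M x\<in>space \<Lambda>. count_space UNIV) (\<lambda>\<omega>. \<lambda>x\<in>space \<Lambda>. \<omega> x) = distr P P (\<lambda>\<omega>. \<omega>)"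
    by (intro distr_cong)
       (auto simp: space_P PiE_restrict poisson_process_def[of \<Lambda>, THEN arg_cong[of _ _ sets]] intro!: sets_PiM_cong)
  also have "\<dots> = (\<Pi>\<^sub>M x\<in>space \<Lambda>. distr P (count_space UNIV) (\<lambda>\<omega>. \<omega> x))"
    unfolding distr_id by (subst (1) poisson_process_def) (intro PiM_cong refl, simp add: distr_component)
  finally show ?thesis
    using False by (subst P.indep_vars_iff_distr_eq_PiM') auto
qed

lemma prob_component:
  assumes "x \<in> space \<Lambda>"
  shows "measure P {\<omega>\<in>space P. \<omega> x = k} = pmf (poisson_law (measure \<Lambda> {x})) k"
proof -
  have "measure (distr P (count_space UNIV) (\<lambda>\<omega>. \<omega> x)) {k} = measure P ((\<lambda>\<omega>. \<omega> x) -` {k} \<inter> space P)"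
    using assms by (intro measure_distr) auto
  then show ?thesis
    using assms by (simp add: distr_component measure_pmf_single vimage_def Int_def conj_commute)
qed

lemma num_points_measurable_PiM:
  assumes "A \<subseteq> space \<Lambda>"
  shows "num_points A \<in> borel_measurable (\<Pi>\<^sub>M x\<in>A. count_space UNIV)"
proof -
  have cA: "countable A" using assms countable_space by (rule countable_subset)
  define B where "B n = A \<inter> from_nat_into A ` {..n}" for n
  have "num_points A \<omega> = (SUP n. num_points (B n) \<omega>)" for \<omega>
  proof (rule num_points_SUP)
    show "incseq B" unfolding B_def by (fastforce simp: incseq_def)
    show "(\<Union>n. B n) = A"
    proof safe
      fix x assume "x \<in> A"
      then have "x \<in> B (to_nat_on A x)" using cA by (force simp: B_def image_iff)
      then show "x \<in> (\<Union>n. B n)" by blast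
    qed (auto simp: B_def)
  qed
  moreover have "(\<lambda>\<omega>. num_points (B n) \<omega>) \<in> borel_measurable (\<Pi>\<^sub>M x\<in>A. count_space UNIV)" for n
  proof -
    have "finite (B n)" by (auto simp: B_def)
    then have "(\<lambda>\<omega>. num_points (B n) \<omega>) = (\<lambda>\<omega>. \<Sum>x\<in>B n. of_nat (\<omega> x))"
      by (simp add: num_points_finite fun_eq_iff)
    moreover have "\<dots> \<in> borel_measurable (\<Pi>\<^sub>M x\<in>A. count_space UNIV)"
    proof (intro borel_measurable_sum)
      fix x assume "x \<in> B n"
      then have "x \<in> A" by (auto simp: B_def)
      then have "(\<lambda>\<omega>. \<omega> x) \<in> measurable (\<Pi>\<^sub>M x\<in>A. count_space (UNIV :: nat set)) (count_space UNIV)"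
        by (rule measurable_component_singleton)
      then show "(\<lambda>\<omega>. (of_nat (\<omega> x) :: ennreal)) \<in> borel_measurable (\<Pi>\<^sub>M x\<in>A. count_space UNIV)"
        by (rule measurable_compose) simp
    qed
    ultimately show ?thesis by simp
  qed
  ultimately show ?thesis
    by (simp cong: measurable_cong)
qed

lemma num_points_measurable:
  assumes "A \<subseteq> space \<Lambda>"
  shows "num_points A \<in> borel_measurable P"
proof -
  have "(\<lambda>\<omega>. restrict \<omega> A) \<in> measurable P (\<Pi>\<^sub>M x\<in>A. count_space UNIV)"
    using assms by (intro measurable_restrict) auto
  from measurable_compose[OF this num_points_measurable_PiM[OF assms]]
  show ?thesis by (simp add: num_points_restrict)
qed

lemma indep_num_points:
  assumes "\<And>i. i \<in> I \<Longrightarrow> A i \<subseteq> space \<Lambda>" "disjoint_family_on A I"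
  shows "P.indep_vars (\<lambda>_. borel) (\<lambda>i. num_points (A i)) I"
proof -
  have "P.indep_vars (\<lambda>i. \<Pi>\<^sub>M x\<in>A i. count_space UNIV) (\<lambda>i \<omega>. restrict (\<lambda>x. \<omega> x) (A i)) I"
    by (rule P.indep_vars_restrict[OF indep_components]) (use assms in auto)
  then have "P.indep_vars (\<lambda>_. borel) (\<lambda>i \<omega>. num_points (A i) (restrict (\<lambda>x. \<omega> x) (A i))) I"
    by (rule P.indep_vars_compose2) (use assms num_points_measurable_PiM in auto)
  then show ?thesis by (simp add: num_points_restrict)
qed

lemma finite_emeasure:
  assumes "A \<subseteq> space \<Lambda>" "finite A"
  shows "emeasure \<Lambda> A < \<infinity>"
proof -
  have "emeasure \<Lambda> A = (\<Sum>x\<in>A. emeasure \<Lambda> {x})"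
    using assms sets_eq_Pow by (intro emeasure_eq_sum_singleton) auto
  also have "\<dots> < \<infinity>"
    using assms finite_points by (auto simp: less_top)
  finally show ?thesis .
qed

lemma prob_num_points_finite:
  assumes "finite A" "A \<subseteq> space \<Lambda>"
  shows "measure P {\<omega>\<in>space P. num_points A \<omega> = of_nat k} = pmf (poisson_law (measure \<Lambda> A)) k"
  using assms
proof (induction A arbitrary: k rule: finite_induct)
  case empty
  then show ?case
    by (auto simp: num_points_def nn_integral_count_space_finite pmf_poisson_law P.prob_space power_0_left)
next
  case (insert x A)
  let ?A = "case_bool {x} A"
  let ?E = "\<lambda>j. {\<omega>\<in>space P. num_points {x} \<omega> = of_nat j} \<inter> {\<omega>\<in>space P. num_points A \<omega> = of_nat (k - j)}"
  note np = num_points_finite[OF \<open>finite A\<close>]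
  have nx: "num_points {x} \<omega> = of_nat (\<omega> x)" for \<omega> by (simp add: num_points_finite)
  have sub: "{x} \<subseteq> space \<Lambda>" "A \<subseteq> space \<Lambda>" using insert by auto
  have indep: "P.indep_vars (\<lambda>_. borel) (\<lambda>i. num_points (?A i)) UNIV"
    using insert by (intro indep_num_points) (auto simp: disjoint_family_on_def split: bool.splits)
  have [measurable]: "num_points {x} \<in> borel_measurable P" "num_points A \<in> borel_measurable P"
    using sub by (auto intro: num_points_measurable)
  have E: "?E j \<in> sets P" for j by measurable
  have "{\<omega>\<in>space P. num_points (insert x A) \<omega> = of_nat k} = (\<Union>j\<le>k. ?E j)"
    using insert by (auto simp: num_points_finite simp del: of_nat_add of_nat_sum)
  then have "measure P {\<omega>\<in>space P. num_points (insert x A) \<omega> = of_nat k} = measure P (\<Union>j\<le>k. ?E j)"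
    by simp
  also have "\<dots> = (\<Sum>j\<le>k. measure P (?E j))"
    using E by (intro P.finite_measure_finite_Union) (auto simp: disjoint_family_on_def nx)
  also have "\<dots> = (\<Sum>j\<le>k. measure P {\<omega>\<in>space P. num_points {x} \<omega> = of_nat j}
                       * measure P {\<omega>\<in>space P. num_points A \<omega> = of_nat (k - j)})"
  proof (intro sum.cong refl)
    fix j
    let ?S = "case_bool {of_nat j} {of_nat (k - j)} :: bool \<Rightarrow> ennreal set"
    have "measure P (\<Inter>i\<in>UNIV. num_points (?A i) -` ?S i \<inter> space P)
        = (\<Prod>i\<in>UNIV. measure P (num_points (?A i) -` ?S i \<inter> space P))"
      by (rule P.indep_varsD[OF indep]) (auto split: bool.splits)
    then show "measure P (?E j) = measure P {\<omega>\<in>space P. num_points {x} \<omega> = of_nat j}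
                       * measure P {\<omega>\<in>space P. num_points A \<omega> = of_nat (k - j)}"
      by (simp add: UNIV_bool vimage_def Int_def conj_ac)
  qed
  also have "\<dots> = (\<Sum>j\<le>k. pmf (poisson_law (measure \<Lambda> {x})) j * pmf (poisson_law (measure \<Lambda> A)) (k - j))"
    using insert sub by (simp add: nx prob_component)
  also have "\<dots> = pmf (poisson_law (measure \<Lambda> {x} + measure \<Lambda> A)) k"
    by (rule poisson_law_convolution) auto
  also have "measure \<Lambda> {x} + measure \<Lambda> A = measure \<Lambda> (insert x A)"
    using insert finite_emeasure[of A] finite_points[of x] sets_eq_Pow
    by (subst measure_Union[symmetric]) (auto simp: less_top)
  finally show ?case .
qed

lemma prob_num_points_le_finite:
  assumes "finite A" "A \<subseteq> space \<Lambda>"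
  shows "measure P {\<omega>\<in>space P. num_points A \<omega> \<le> of_nat k} = (\<Sum>j\<le>k. pmf (poisson_law (measure \<Lambda> A)) j)"
proof -
  have [measurable]: "num_points A \<in> borel_measurable P"
    using assms by (auto intro: num_points_measurable)
  have "{\<omega>\<in>space P. num_points A \<omega> \<le> of_nat k} = (\<Union>j\<le>k. {\<omega>\<in>space P. num_points A \<omega> = of_nat j})"
    by (auto simp: num_points_finite[OF assms(1)] simp del: of_nat_sum)
  then have "measure P {\<omega>\<in>space P. num_points A \<omega> \<le> of_nat k}
      = measure P (\<Union>j\<le>k. {\<omega>\<in>space P. num_points A \<omega> = of_nat j})" by simp
  also have "\<dots> = (\<Sum>j\<le>k. measure P {\<omega>\<in>space P. num_points A \<omega> = of_nat j})"
    by (intro P.finite_measure_finite_Union) (auto simp: disjoint_family_on_def)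
  finally show ?thesis by (simp add: prob_num_points_finite[OF assms])
qed

lemma prob_num_points:
  assumes A: "A \<subseteq> space \<Lambda>" and fin: "emeasure \<Lambda> A < \<infinity>"
  shows "measure P {\<omega>\<in>space P. num_points A \<omega> = of_nat k} = pmf (poisson_law (measure \<Lambda> A)) k"
proof -
  have cA: "countable A" using A countable_space by (rule countable_subset)
  define B where "B n = A \<inter> from_nat_into A ` {..n}" for n
  have inc: "incseq B" unfolding B_def by (fastforce simp: incseq_def)
  have Un: "(\<Union>n. B n) = A"
  proof safe
    fix x assume "x \<in> A"
    then have "x \<in> B (to_nat_on A x)" using cA by (force simp: B_def image_iff)
    then show "x \<in> (\<Union>n. B n)" by blast
  qed (auto simp: B_def)
  have finB: "finite (B n)" and subB: "B n \<subseteq> space \<Lambda>" for n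
    using A by (auto simp: B_def)
  note S = num_points_SUP[OF inc Un]
  have [measurable]: "num_points A \<in> borel_measurable P" "num_points (B n) \<in> borel_measurable P" for n
    using A subB by (auto intro: num_points_measurable)
  have limM: "(\<lambda>n. measure \<Lambda> (B n)) \<longlonglongrightarrow> measure \<Lambda> A"
    using Lim_measure_incseq[of B \<Lambda>] inc Un fin subB sets_eq_Pow by (auto simp: less_top)
  have le: "measure P {\<omega>\<in>space P. num_points A \<omega> \<le> of_nat k} = (\<Sum>j\<le>k. pmf (poisson_law (measure \<Lambda> A)) j)" for k
  proof (rule LIMSEQ_unique)
    let ?E = "\<lambda>n. {\<omega>\<in>space P. num_points (B n) \<omega> \<le> of_nat k}"
    have mono: "num_points (B m) \<omega> \<le> num_points (B n) \<omega>" if "m \<le> n" for m n \<omega>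
    proof -
      have "B m \<subseteq> B n" using inc that by (auto simp: incseq_def)
      then have "(\<Sum>x\<in>B m. \<omega> x) \<le> (\<Sum>x\<in>B n. \<omega> x)" using finB by (intro sum_mono2) auto
      then show ?thesis by (simp add: num_points_finite finB del: of_nat_sum)
    qed
    have "decseq ?E" unfolding decseq_def using mono by (auto intro: order.trans)
    moreover have "range ?E \<subseteq> sets P" by auto
    ultimately have "(\<lambda>n. measure P (?E n)) \<longlonglongrightarrow> measure P (\<Inter>n. ?E n)"
      by (intro P.finite_Lim_measure_decseq)
    also have "(\<Inter>n. ?E n) = {\<omega>\<in>space P. num_points A \<omega> \<le> of_nat k}"
      by (auto simp: S SUP_le_iff)
    finally show "(\<lambda>n. measure P (?E n)) \<longlonglongrightarrow> measure P {\<omega>\<in>space P. num_points A \<omega> \<le> of_nat k}" .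
    have "(\<lambda>n. \<Sum>j\<le>k. pmf (poisson_law (measure \<Lambda> (B n))) j)
        \<longlonglongrightarrow> (\<Sum>j\<le>k. pmf (poisson_law (measure \<Lambda> A)) j)"
      by (simp add: pmf_poisson_law) (intro tendsto_intros limM, simp)
    then show "(\<lambda>n. measure P (?E n)) \<longlonglongrightarrow> (\<Sum>j\<le>k. pmf (poisson_law (measure \<Lambda> A)) j)"
      by (simp add: prob_num_points_le_finite[OF finB subB])
  qed
  have nat: "\<exists>j\<le>k. num_points A \<omega> = of_nat j" if "num_points A \<omega> \<le> of_nat k" for k \<omega>
    using incseq_bounded_nat_SUP[of "\<lambda>n. \<Sum>x\<in>B n. \<omega> x" k] that
    by (simp add: S num_points_finite[OF finB] del: of_nat_sum)
  show ?thesis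
  proof (cases k)
    case 0
    then show ?thesis using le[of 0] by simp
  next
    case (Suc m)
    have "{\<omega>\<in>space P. num_points A \<omega> = of_nat k}
        = {\<omega>\<in>space P. num_points A \<omega> \<le> of_nat k} - {\<omega>\<in>space P. num_points A \<omega> \<le> of_nat m}"
    proof safe
      fix \<omega> assume "num_points A \<omega> \<le> of_nat k" "\<not> num_points A \<omega> \<le> of_nat m"
      with nat[of \<omega> k] obtain j where "j \<le> k" "num_points A \<omega> = of_nat j" by auto
      with \<open>\<not> num_points A \<omega> \<le> of_nat m\<close> Suc show "num_points A \<omega> = of_nat k"
        by (cases "j = k") auto
    qed (use Suc in \<open>simp_all del: of_nat_Suc\<close>)
    then have "measure P {\<omega>\<in>space P. num_points A \<omega> = of_nat k}
        = measure P ({\<omega>\<in>space P. num_points A \<omega> \<le> of_nat k} - {\<omega>\<in>space P. num_points A \<omega> \<le> of_nat m})"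
      by simp
    also have "\<dots> = measure P {\<omega>\<in>space P. num_points A \<omega> \<le> of_nat k} - measure P {\<omega>\<in>space P. num_points A \<omega> \<le> of_nat m}"
      using Suc by (intro P.finite_measure_Diff) (auto intro: order.trans[of _ "of_nat m"])
    finally show ?thesis by (simp only: le) (simp add: Suc)
  qed
qed

theorem is_poisson_process_poisson_process: "is_poisson_process \<Lambda> (poisson_process \<Lambda>)"
  unfolding is_poisson_process_def
proof (intro conjI ballI allI impI)
  fix A :: "nat \<Rightarrow> 'a set" assume "range A \<subseteq> sets \<Lambda>" "disjoint_family A"
  then show "P.indep_vars (\<lambda>_. borel) (\<lambda>i. num_points (A i)) UNIV"
    by (intro indep_num_points) (auto simp: sets_eq_Pow)
qed (auto simp: sets_eq_Pow prob_space_P num_points_measurable prob_num_points)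

end

definition adjacent :: "int ^ 'd \<Rightarrow> int ^ 'd \<Rightarrow> bool" where
  "adjacent x y \<longleftrightarrow> (\<Sum>i\<in>UNIV. \<bar>x $ i - y $ i\<bar>) = 1"

definition srw :: "int ^ 'd \<Rightarrow> int ^ 'd \<Rightarrow> real" where
  "srw x y = (if adjacent x y then 1 / (2 * real CARD('d)) else 0)"

definition based_loops :: "(int ^ 'd) list set" where
  "based_loops = {l. 2 \<le> length l \<and> (\<forall>i<length l. l ! i \<noteq> l ! (Suc i mod length l))}"

definition based_loop_weight :: "(int ^ 'd) list \<Rightarrow> real" where
  "based_loop_weight l =
     1 / real (length l) * (\<Prod>i<length l. srw (l ! i) (l ! (Suc i mod length l)))"

definition based_loop_measure :: "(int ^ 'd) list measure" where
  "based_loop_measure = point_measure based_loops (\<lambda>l. ennreal (based_loop_weight l))"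

text \<open>Equality up to circular permutation; loops are its equivalence classes, and the loop
  measure is the push-forward under the projection to classes.\<close>

definition loop_rel :: "((int ^ 'd) list \<times> (int ^ 'd) list) set" where
  "loop_rel = {(l, l'). l \<in> based_loops \<and> l' \<in> based_loops \<and> (\<exists>k. l' = rotate k l)}"

definition loops :: "(int ^ 'd) list set set" where
  "loops = based_loops // loop_rel"

definition loop_measure :: "(int ^ 'd) list set measure" where
  "loop_measure = distr based_loop_measure (count_space loops) (\<lambda>l. loop_rel `` {l})"

definition loop_soup :: "real \<Rightarrow> ((int ^ 'd) list set \<Rightarrow> nat) measure" where
  "loop_soup \<alpha> = poisson_process (scale_measure (ennreal \<alpha>) loop_measure)"

lemma rotate_in_based_loops:
  assumes "l \<in> based_loops"
  shows "rotate k l \<in> based_loops"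
proof -
  have "l \<noteq> []" using assms by (auto simp: based_loops_def)
  then have "rotate k l ! (Suc i mod length l) = l ! (Suc ((k + i) mod length l) mod length l)" 
    if "i < length l" for i
    using that by (simp add: nth_rotate mod_simps)
  then show ?thesis
    using assms \<open>l \<noteq> []\<close> by (fastforce simp: based_loops_def nth_rotate)
qed

lemma equiv_loop_rel: "equiv based_loops loop_rel"
proof (rule equivI)
  show "refl_on based_loops loop_rel"
    by (auto simp: refl_on_def loop_rel_def intro: exI[of _ 0])
  show "sym loop_rel"
  proof (rule symI)
    fix l l' :: "(int ^ 'd) list" assume "(l, l') \<in> loop_rel"
    then obtain k where k: "l' = rotate k l" and l: "l \<in> based_loops" "l' \<in> based_loops" "l \<noteq> []"
      by (force simp: loop_rel_def based_loops_def)
    have "rotate (length l - k mod length l) (rotate k l) = rotate (length l - k mod length l + k mod length l) l"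
      by (metis rotate_rotate rotate_conv_mod)
    also have "\<dots> = l" using l by (simp add: less_imp_le)
    finally show "(l', l) \<in> loop_rel" using l k unfolding loop_rel_def by (auto intro: sym)
  qed
  show "trans loop_rel"
    by (auto simp: trans_def loop_rel_def rotate_rotate)
qed (auto simp: loop_rel_def)

lemma countable_intensity_loops:
  "countable_intensity (scale_measure (ennreal \<alpha>) (loop_measure :: (int ^ 'd) list set measure))"
proof
  show "countable (space (scale_measure (ennreal \<alpha>) (loop_measure :: (int ^ 'd) list set measure)))"
    by (simp add: space_scale_measure loop_measure_def loops_def quotient_def)
  fix l :: "(int ^ 'd) list set"
  assume "l \<in> space (scale_measure (ennreal \<alpha>) loop_measure)"
  then have l: "l \<in> loops" by (simp add: space_scale_measure loop_measure_def)
  let ?V = "(\<lambda>x. loop_rel `` {x}) -` {l} \<inter> based_loops"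
  obtain l0 where l0: "l = loop_rel `` {l0}" "l0 \<in> based_loops" using l by (auto simp: loops_def quotient_def)
  have "?V \<subseteq> (\<lambda>k. rotate k l0) ` {..<length l0}"
  proof
    fix x assume x: "x \<in> ?V"
    then have "x \<in> l" using equiv_class_self[OF equiv_loop_rel, of x] by auto
    then obtain k where "x = rotate k l0" by (auto simp: l0 loop_rel_def)
    then have "x = rotate (k mod length l0) l0" by (simp add: rotate_conv_mod[symmetric])
    moreover have "0 < length l0" using l0 by (auto simp: based_loops_def)
    ultimately show "x \<in> (\<lambda>k. rotate k l0) ` {..<length l0}" by auto
  qed
  then have fin: "finite ?V" by (rule finite_subset) auto
  have meas: "(\<lambda>l. loop_rel `` {l}) \<in> measurable based_loop_measure (count_space loops)"
    by (auto simp: based_loop_measure_def loops_def space_point_measure quotientI)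
  have "emeasure loop_measure {l} = emeasure based_loop_measure ?V"
    unfolding loop_measure_def using meas l
    by (subst emeasure_distr) (auto simp: based_loop_measure_def space_point_measure)
  also have "\<dots> = (\<Sum>x\<in>?V. ennreal (based_loop_weight x))"
    unfolding based_loop_measure_def using fin by (intro emeasure_point_measure_finite2) auto
  also have "\<dots> < \<infinity>" using fin by (auto simp: less_top)
  finally show "emeasure (scale_measure (ennreal \<alpha>) loop_measure) {l} < \<infinity>"
    by (simp add: ennreal_mult_less_top)
qed (simp add: space_scale_measure loop_measure_def)

lemma is_poisson_process_loop_soup:
  "is_poisson_process (scale_measure (ennreal \<alpha>) loop_measure) (loop_soup \<alpha>)"
  unfolding loop_soup_def
  by (rule countable_intensity.is_poisson_process_poisson_process[OF countable_intensity_loops])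

definition traverses :: "(int ^ 'd) list set \<Rightarrow> int ^ 'd \<Rightarrow> int ^ 'd \<Rightarrow> bool" where
  "traverses L x y \<longleftrightarrow>
     (\<exists>l\<in>L. \<exists>i<length l. {l ! i, l ! (Suc i mod length l)} = {x, y})"

text \<open>Based loops only have distinct consecutive points, so a loop may also traverse pairs that are
  not edges of the lattice; such loops have measure 0.\<close>

definition open_edge :: "((int ^ 'd) list set \<Rightarrow> nat) \<Rightarrow> int ^ 'd \<Rightarrow> int ^ 'd \<Rightarrow> bool" where
  "open_edge \<omega> x y \<longleftrightarrow> adjacent x y \<and> (\<exists>L\<in>loops. \<omega> L \<ge> 1 \<and> traverses L x y)"

definition connects :: "((int ^ 'd) list set \<Rightarrow> nat) \<Rightarrow> (int ^ 'd) set \<Rightarrow> (int ^ 'd) set \<Rightarrow> bool" where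
  "connects \<omega> A B \<longleftrightarrow> (\<exists>x\<in>A. \<exists>y\<in>B. (open_edge \<omega>)\<^sup>*\<^sup>* x y)"

definition connection_prob :: "real \<Rightarrow> (int ^ 'd) set \<Rightarrow> (int ^ 'd) set \<Rightarrow> real" where
  "connection_prob \<alpha> A B = measure (loop_soup \<alpha>) {\<omega> \<in> space (loop_soup \<alpha>). connects \<omega> A B}"

lemma connection_event_measurable:
  fixes A B :: "(int ^ 'd) set"
  shows "{\<omega> \<in> space (loop_soup \<alpha>). connects \<omega> A B} \<in> sets (loop_soup \<alpha>)"
proof -
  interpret countable_intensity "scale_measure (ennreal \<alpha>) (loop_measure :: (int ^ 'd) list set measure)"
    by (rule countable_intensity_loops)
  have sp: "space (scale_measure (ennreal \<alpha>) (loop_measure :: (int ^ 'd) list set measure)) = loops"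
    by (simp add: space_scale_measure loop_measure_def)
  have [measurable]: "(\<lambda>\<omega>. \<omega> L) \<in> measurable (loop_soup \<alpha>) (count_space UNIV)" if "L \<in> loops" for L :: "(int ^ 'd) list set"
    using component_measurable that by (simp add: sp loop_soup_def)
  have "countable (loops :: (int ^ 'd) list set set)" using countable_space by (simp add: sp)
  then have [measurable]: "Measurable.pred (loop_soup \<alpha>) (\<lambda>\<omega>. open_edge \<omega> x y)" for x y :: "int ^ 'd"
    unfolding open_edge_def by measurable
  have [measurable]: "Measurable.pred (loop_soup \<alpha>) (\<lambda>\<omega>. (open_edge \<omega> ^^ n) x y)" for n and x y :: "int ^ 'd"
  proof (induction n arbitrary: y)
    case (Suc n)
    note [measurable] = Suc.IH
    show ?case by (simp add: relcompp_apply)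
  qed simp
  have "Measurable.pred (loop_soup \<alpha>) (\<lambda>\<omega>. \<exists>x\<in>A. \<exists>y\<in>B. \<exists>n. (open_edge \<omega> ^^ n) x y)"
    by measurable
  then show ?thesis
    unfolding connects_def rtranclp_is_Sup_relpowp by (simp add: pred_def)
qed

definition lattice_box :: "int ^ 'd \<Rightarrow> nat \<Rightarrow> (int ^ 'd) set" where
  "lattice_box x n = {y. \<forall>i. \<bar>y $ i - x $ i\<bar> \<le> int n}"

definition inner_boundary :: "(int ^ 'd) set \<Rightarrow> (int ^ 'd) set" where
  "inner_boundary F = {x\<in>F. \<exists>y. adjacent x y \<and> y \<notin> F}"

text \<open>Computed in the extended reals, where the infimum of the empty set is \<open>\<infinity>\<close>; \<open>\<alpha>\<^sub>1\<close>
  may a priori be infinite.\<close>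

definition alpha1 :: "'d::finite itself \<Rightarrow> ereal" where
  "alpha1 _ = (SUP \<beta>\<in>{1<..}. Inf {ereal \<alpha> | \<alpha>. \<alpha> > 0 \<and>
     limsup (\<lambda>n. ereal (connection_prob \<alpha> (lattice_box (0 :: int ^ 'd) n)
       (inner_boundary (lattice_box 0 (nat \<lceil>\<beta> * real n\<rceil>))))) = 1})"

end

(* A random walk argument bounds the loop measure: a loop that hits a box of radius n and leaves the
   box of radius m >= 2n has total mass O((n/m)^(d-2)).  Indeed one of three arcs of such a loop can be
   discarded at the cost of its heat kernel bound O(t^(-d/2)), and the remaining arc, started anywhere,
   hits the box and then travels a distance m; the sum over starting points of the hitting
   probabilities (the volume of a sausage) is O(n^(d-2) (t + n^2)), the excursion costs
   exp(-c m^2/t), and one sums over t.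

   For (a), crossing an annulus at scale N forces two distant crossings at scale n = N div 12, which
   are independent unless a loop crosses one of finitely many annuli.  So the crossing probabilities
   satisfy p_N <= M^2 p_n^2 + C alpha, and p_N = O(alpha) uniformly in N for small alpha.

   For (b), take the disjoint annuli at radii R^k.  The loops are split, according to the innermost and
   outermost annulus they visit, into independent classes (i, j).  An arm from 0 covers all scales by
   the intervals [i, j] for which either i < j and the class contains a loop (probability
   O(alpha R^(-(d-2)(j-i)))), or i = j and the loops of the class cross the annulus.  An exponential
   Chebyshev bound for the total length of these intervals gives geometric decay in the number of
   scales; for small alpha one takes R^(d-2) of order 1/alpha, which makes the decay rate per scale
   R^(-(d-2)) up to a constant. *)

theory Submission
  imports Defs
begin

section \<open>The heat kernel of simple random walk\<close>

text \<open>Two obstacles shape the argument. A loop has no starting point and must close up, so the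
  Markov property does not apply to it directly. Giving up a third of it removes the closing
  constraint, and summing over starting points makes the free path that remains reversible in time.
  Below \<open>alpha1\<close>, moreover, annulus crossings are only known to stay away from
  probability 1, for one ratio \<beta> and without a rate, while long loops correlate the scales.
  The weight 1/s per scale in the exponential bound mediates between the two effects: s = 1/2
  suffices below \<open>alpha1\<close> once R is so large that long loops are rare, whereas s = 2
  R^(-(d-2)) yields exponents close to d-2. The second choice requires crossings to cost O(\<alpha>)
  instead of merely being unlikely, hence the linear bound sought by the renormalisation.
  Translation invariance of the soup is not established; bounds are uniform over the centre of the
  box instead.\<close>

definition nbr :: "int ^ 'd \<Rightarrow> 'd \<times> bool \<Rightarrow> int ^ 'd" where
  "nbr x e = (if snd e then x + axis (fst e) 1 else x - axis (fst e) 1)"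

text \<open>The transition operator of simple random walk; \<open>step\<close> below is the
  corresponding law of one step.\<close>

definition avg :: "(int ^ 'd \<Rightarrow> real) \<Rightarrow> int ^ 'd \<Rightarrow> real" where
  "avg f x = (\<Sum>e\<in>UNIV. f (nbr x e)) / (2 * real CARD('d))"

lemma sum_UNIV_prod_bool:
  "(\<Sum>e\<in>(UNIV :: ('d::finite \<times> bool) set). f e) = (\<Sum>i\<in>UNIV. f (i, True) + f (i, False))"
  for f :: "_ \<Rightarrow> 'b::comm_monoid_add"
proof -
  have "(\<Sum>e\<in>UNIV. f e) = (\<Sum>(i, b)\<in>UNIV \<times> {True, False}. f (i, b))"
    by (intro sum.cong) auto
  then show ?thesis by (simp only: sum.cartesian_product[symmetric]) simp
qed

lemma avg_alt:
  "avg f x = (\<Sum>i\<in>UNIV. f (x + axis i 1) + f (x - axis i 1)) / (2 * real CARD('d))"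
  for x :: "int ^ 'd"
  by (simp add: avg_def sum_UNIV_prod_bool nbr_def)

lemma avg_mono: "(\<And>y. f y \<le> g y) \<Longrightarrow> avg f x \<le> avg g x"
  by (auto simp: avg_def intro!: divide_right_mono sum_mono)

lemma avg_nonneg: "(\<And>y. 0 \<le> f y) \<Longrightarrow> 0 \<le> avg f x"
  by (auto simp: avg_def intro!: divide_nonneg_nonneg sum_nonneg)

lemma avg_add: "avg (\<lambda>y. f y + g y) x = avg f x + avg g x"
  by (simp add: avg_def sum.distrib add_divide_distrib)

lemma avg_cmult: "avg (\<lambda>y. c * f y) x = c * avg f x"
  by (simp add: avg_def sum_distrib_left)

lemma avg_const [simp]: "avg (\<lambda>y. c) x = c"
  by (simp add: avg_alt)

section \<open>The heat kernel as a mixture of products of one-dimensional kernels\<close>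

fun heat :: "nat \<Rightarrow> int ^ 'd \<Rightarrow> int ^ 'd \<Rightarrow> real" where
  "heat 0 x y = of_bool (x = y)"
| "heat (Suc t) x y = avg (\<lambda>z. heat t z y) x"

text \<open>The kernel of simple random walk on the integers after \<open>k\<close> steps, as a
  function of the displacement.\<close>

fun line_heat :: "nat \<Rightarrow> int \<Rightarrow> real" where
  "line_heat 0 z = of_bool (z = 0)"
| "line_heat (Suc k) z = (line_heat k (z - 1) + line_heat k (z + 1)) / 2"

text \<open>The expectation of a function of the numbers of steps in each coordinate direction, after
  \<open>t\<close> steps in independent uniform directions.\<close>

fun mavg :: "nat \<Rightarrow> (('d::finite \<Rightarrow> nat) \<Rightarrow> real) \<Rightarrow> real" where
  "mavg 0 h = h (\<lambda>_. 0)"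
| "mavg (Suc t) h = (\<Sum>j\<in>UNIV. mavg t (\<lambda>k. h (k(j := Suc (k j))))) / real CARD('d)"

lemma mavg_mono: "(\<And>k. f k \<le> g k) \<Longrightarrow> mavg t f \<le> mavg t g"
  by (induction t arbitrary: f g) (auto intro!: divide_right_mono sum_mono)

lemma mavg_add: "mavg t (\<lambda>k. f k + g k) = mavg t f + mavg t g"
  by (induction t arbitrary: f g) (auto simp: sum.distrib add_divide_distrib)

lemma mavg_cmult: "mavg t (\<lambda>k. c * f k) = c * mavg t f"
  by (induction t arbitrary: f) (auto simp: sum_distrib_left)

lemma mavg_const [simp]: "mavg t (\<lambda>_ :: 'd::finite \<Rightarrow> nat. c) = c"
  by (induction t) auto

text \<open>Draw the coordinate directions of all steps first: given how many steps go in each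
  direction, the coordinates are independent walks on the integers.\<close>

lemma heat_eq_mavg:
  "heat t x y = mavg t (\<lambda>k. \<Prod>i\<in>UNIV. line_heat (k i) (y $ i - x $ i))"
proof (induction t arbitrary: x)
  case 0
  show ?case by (auto simp: vec_eq_iff prod_zero_iff) metis
next
  case (Suc t)
  let ?F = "\<lambda>x k. \<Prod>i\<in>UNIV. line_heat (k i) (y $ i - x $ i)"
  have split: "?F x k = line_heat (k i) (y $ i - x $ i) * (\<Prod>l\<in>-{i}. line_heat (k l) (y $ l - x $ l))" for x k i
    by (subst prod.remove[of UNIV i]) (auto simp: Compl_eq_Diff_UNIV)
  have rest: "(\<Prod>l\<in>-{i}. line_heat (k l) (y $ l - (x + axis i a) $ l)) = (\<Prod>l\<in>-{i}. line_heat (k l) (y $ l - x $ l))" for k a i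
    by (intro prod.cong) (auto simp: axis_def)
  have rest': "(\<Prod>l\<in>-{i}. line_heat (k l) (y $ l - (x - axis i 1) $ l)) = (\<Prod>l\<in>-{i}. line_heat (k l) (y $ l - x $ l))" for k i
    by (intro prod.cong) (auto simp: axis_def)
  have rest'': "(\<Prod>l\<in>-{i}. line_heat ((k(i := c)) l) (y $ l - x $ l)) = (\<Prod>l\<in>-{i}. line_heat (k l) (y $ l - x $ l))" for k i c
    by (intro prod.cong) auto
  \<comment> \<open>The two neighbours in direction \<open>i\<close> differ from \<open>x\<close> in
    one factor only, and the recursion of \<open>line_heat\<close> merges them into one more step of
    that coordinate.\<close>
  have key: "?F (x + axis i 1) k + ?F (x - axis i 1) k = 2 * ?F x (k(i := Suc (k i)))" for i k
    unfolding split[of _ _ i] rest rest' rest''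
    by (simp add: algebra_simps)
  have "heat (Suc t) x y = (\<Sum>i\<in>UNIV. mavg t (?F (x + axis i 1)) + mavg t (?F (x - axis i 1))) / (2 * real CARD('a))"
    by (simp only: heat.simps avg_alt Suc.IH)
  also have "\<dots> = (\<Sum>i\<in>UNIV. 2 * mavg t (\<lambda>k. ?F x (k(i := Suc (k i))))) / (2 * real CARD('a))"
    by (simp only: key mavg_add[symmetric] mavg_cmult[symmetric])
  finally show ?case by (simp add: sum_distrib_left[symmetric])
qed

lemma line_heat_eq_0: "(\<And>j::nat. z \<noteq> 2 * int j - int k) \<Longrightarrow> line_heat k z = 0"
proof (induction k arbitrary: z)
  case 0
  then show ?case using 0[of 0] by auto
next
  case (Suc k)
  have "z - 1 \<noteq> 2 * int j - int k" for j using Suc.prems[of "Suc j"] by auto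
  moreover have "z + 1 \<noteq> 2 * int j - int k" for j using Suc.prems[of j] by auto
  ultimately show ?case using Suc.IH by simp
qed

lemma line_heat_eq_binomial: "line_heat k (2 * int j - int k) = real (k choose j) / 2 ^ k"
proof (induction k arbitrary: j)
  case 0
  show ?case by (cases j) auto
next
  case (Suc k)
  have 1: "2 * int j - int (Suc k) + 1 = 2 * int j - int k" by simp
  show ?case
  proof (cases j)
    case 0
    then have "line_heat k (2 * int j - int (Suc k) - 1) = 0"
      by (intro line_heat_eq_0) auto
    then show ?thesis unfolding line_heat.simps 1 Suc.IH using 0 by simp
  next
    case (Suc i)
    then have 2: "2 * int j - int (Suc k) - 1 = 2 * int i - int k" by simp
    show ?thesis unfolding line_heat.simps 1 2 Suc.IH using Suc by (simp add: field_simps)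
  qed
qed

text \<open>By the ratio of consecutive central coefficients the induction step becomes (2m+1)^2
  (3m+4) <= 4 (m+1)^2 (3m+1), whose two sides differ by exactly m.\<close>

lemma central_binomial_upper: "(real (2 * m choose m))\<^sup>2 * (3 * real m + 1) \<le> 16 ^ m"
proof (induction m)
  case (Suc m)
  have "Suc m * (2 * Suc m choose Suc m) = 2 * (2 * m + 1) * (2 * m choose m)"
  proof -
    define X A B C where "X = (Suc (Suc (2 * m)) choose Suc m)" and "A = (Suc (2 * m) choose m)"
      and "B = (Suc (2 * m) choose Suc m)" and "C = (2 * m choose m)"
    have 1: "Suc m * X = Suc (Suc (2 * m)) * A"
      unfolding X_def A_def by (rule Suc_times_binomial)
    have 2: "A = B" unfolding A_def B_def
      by (subst binomial_symmetric) auto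
    have 3: "Suc m * B = Suc (2 * m) * C"
      unfolding B_def C_def by (rule Suc_times_binomial)
    have "Suc m * (Suc m * X) = (2 * Suc m) * (Suc m * B)"
      unfolding 1 2 by (simp only: mult_ac) simp
    also have "\<dots> = Suc m * (2 * (2 * m + 1) * C)" unfolding 3 by (simp add: algebra_simps)
    finally have "Suc m * X = 2 * (2 * m + 1) * C" by (simp only: mult_cancel1) simp
    then show ?thesis by (simp only: X_def C_def) simp
  qed
  then have *: "(real m + 1) * real (2 * Suc m choose Suc m) = 2 * (2 * real m + 1) * real (2 * m choose m)"
  proof -
    from \<open>Suc m * (2 * Suc m choose Suc m) = _\<close>
    have "real (Suc m * (2 * Suc m choose Suc m)) = real (2 * (2 * m + 1) * (2 * m choose m))" by (simp only:)
    then show ?thesis unfolding of_nat_mult of_nat_add of_nat_Suc of_nat_1 of_nat_numeral by (simp only: add.commute)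
  qed
  let ?c = "real (2 * m choose m)" and ?c' = "real (2 * Suc m choose Suc m)"
  have "(real m + 1)\<^sup>2 * (?c'\<^sup>2 * (3 * real (Suc m) + 1)) = ((real m + 1) * ?c')\<^sup>2 * (3 * real m + 4)"
    by (simp add: power_mult_distrib)
  also have "\<dots> = ?c\<^sup>2 * (4 * ((2 * real m + 1)\<^sup>2 * (3 * real m + 4)))"
    unfolding * by (simp add: power2_eq_square algebra_simps)
  also have "\<dots> \<le> ?c\<^sup>2 * (4 * (4 * (real m + 1)\<^sup>2 * (3 * real m + 1)))"
    by (intro mult_left_mono) (auto simp: power2_eq_square algebra_simps)
  also have "\<dots> = (real m + 1)\<^sup>2 * 16 * (?c\<^sup>2 * (3 * real m + 1))" by simp
  also have "\<dots> \<le> (real m + 1)\<^sup>2 * 16 * 16 ^ m"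
    using Suc by (intro mult_left_mono) auto
  finally have "(real m + 1)\<^sup>2 * (?c'\<^sup>2 * (3 * real (Suc m) + 1)) \<le> (real m + 1)\<^sup>2 * 16 ^ Suc m" by simp
  then show ?case by (subst (asm) mult_le_cancel_left_pos) auto
qed simp

lemma binomial_le_sqrt: "real (k choose j) / 2 ^ k \<le> 1 / sqrt (real k + 1)"
proof -
  have even: "real (2 * m choose m) \<le> 4 ^ m / sqrt (2 * real m + 1)" for m
  proof -
    have "(real (2 * m choose m))\<^sup>2 * (2 * real m + 1) \<le> (real (2 * m choose m))\<^sup>2 * (3 * real m + 1)"
      by (intro mult_left_mono) auto
    also have "\<dots> \<le> (4 ^ m)\<^sup>2" using central_binomial_upper[of m] by (simp add: power_mult_distrib power2_eq_square flip: power_mult_distrib)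
    finally have "sqrt ((real (2 * m choose m))\<^sup>2 * (2 * real m + 1)) \<le> 4 ^ m"
      by (intro real_le_lsqrt) auto
    then have "real (2 * m choose m) * sqrt (2 * real m + 1) \<le> 4 ^ m" by (simp add: real_sqrt_mult)
    then show ?thesis by (subst pos_le_divide_eq) (auto intro: add_nonneg_pos)
  qed
  have "real (k choose j) \<le> real (k choose (k div 2))" by (simp add: binomial_maximum)
  also have "\<dots> \<le> 2 ^ k / sqrt (real k + 1)"
  proof (cases "even k")
    case True
    then obtain m where "k = 2 * m" by auto
    then show ?thesis using even[of m] by (simp add: power_mult)
  next
    case False
    then obtain m where k: "k = Suc (2 * m)" by (auto elim: oddE)
    \<comment> \<open>An odd row is reduced to the next even one: its two middle entries are equal
      and add up to the next central coefficient.\<close>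
    have "(Suc (2 * m) choose m) = (Suc (2 * m) choose Suc m)"
      by (subst binomial_symmetric) auto
    then have "2 * real (k choose m) = real (2 * Suc m choose Suc m)"
      by (simp add: k)
    also have "\<dots> \<le> 4 ^ Suc m / sqrt (2 * real (Suc m) + 1)" by (rule even)
    also have "\<dots> \<le> 4 ^ Suc m / sqrt (real k + 1)"
      by (intro divide_left_mono) (auto simp: k)
    finally show ?thesis by (simp add: k power_mult)
  qed
  finally show ?thesis by (simp add: field_simps)
qed

lemma line_heat_le: "line_heat k z \<le> 1 / sqrt (real k + 1)"
proof (cases "\<exists>j::nat. z = 2 * int j - int k")
  case True
  then show ?thesis using line_heat_eq_binomial binomial_le_sqrt by metis
qed (use line_heat_eq_0 in force)

lemma line_heat_nonneg: "0 \<le> line_heat k z"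
  by (induction k arbitrary: z) auto

text \<open>Size biasing of a multinomial coordinate: the weight \<open>k i\<close> singles out one
  of the t+1 steps, which goes in direction i with probability 1/d, and removing it leaves t
  independent uniform steps.\<close>

lemma mavg_size_bias:
  "real CARD('d) * mavg (Suc t) (\<lambda>k. real (k i) * g k) = real (Suc t) * mavg t (\<lambda>k. g (k(i := Suc (k i))))"
  for i :: "'d::finite"
proof (induction t arbitrary: g)
  case 0
  have "(\<Sum>j\<in>UNIV. real (((\<lambda>_. 0)(j := Suc 0)) i) * g ((\<lambda>_. 0)(j := Suc 0))) = (\<Sum>j\<in>{i}. real (((\<lambda>_. 0)(j := Suc 0)) i) * g ((\<lambda>_. 0)(j := Suc 0)))"
    by (intro sum.mono_neutral_right) auto
  then show ?case by (simp del: fun_upd_apply) simp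
next
  case (Suc t)
  let ?s = "\<lambda>j k. k(j := Suc (k j))"
  let ?D = "real CARD('d)"
  have D: "?D > 0" by simp
  have comm: "?s i (?s j k) = ?s j (?s i k)" for i j and k :: "'d \<Rightarrow> nat"
    by (auto simp: fun_eq_iff)
  have "?D * mavg (Suc (Suc t)) (\<lambda>k. real (k i) * g k)
      = (\<Sum>j\<in>UNIV. mavg (Suc t) (\<lambda>k. real (?s j k i) * g (?s j k)))"
    by simp
  also have "\<dots> = (\<Sum>j\<in>UNIV. mavg (Suc t) (\<lambda>k. real (k i) * g (?s j k)) + (if j = i then mavg (Suc t) (\<lambda>k. g (?s i k)) else 0))"
  proof (intro sum.cong refl)
    fix j
    have "mavg (Suc t) (\<lambda>k. real (?s j k i) * g (?s j k))
       = mavg (Suc t) (\<lambda>k. real (k i) * g (?s j k) + (if j = i then g (?s i k) else 0))"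
      by (intro arg_cong[of _ _ "mavg (Suc t)"]) (auto simp: fun_eq_iff algebra_simps)
    then show "mavg (Suc t) (\<lambda>k. real (?s j k i) * g (?s j k)) = mavg (Suc t) (\<lambda>k. real (k i) * g (?s j k)) + (if j = i then mavg (Suc t) (\<lambda>k. g (?s i k)) else 0)"
      by (simp only: mavg_add) (simp del: mavg.simps)
  qed
  also have "\<dots> = (\<Sum>j\<in>UNIV. real (Suc t) / ?D * mavg t (\<lambda>k. g (?s j (?s i k)))) + mavg (Suc t) (\<lambda>k. g (?s i k))"
  proof -
    have "mavg (Suc t) (\<lambda>k. real (k i) * g (?s j k)) = real (Suc t) / ?D * mavg t (\<lambda>k. g (?s j (?s i k)))" for j
      using Suc.IH[of "\<lambda>k. g (?s j k)"] D by (simp add: field_simps del: mavg.simps fun_upd_apply)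
    then show ?thesis by (simp add: sum.distrib del: mavg.simps)
  qed
  also have "(\<Sum>j\<in>UNIV. real (Suc t) / ?D * mavg t (\<lambda>k. g (?s j (?s i k)))) = real (Suc t) * mavg (Suc t) (\<lambda>k. g (?s i k))"
    unfolding comm[of _ i] by (simp add: sum_distrib_left sum_divide_distrib)
  finally show ?case by (simp only: of_nat_Suc) (simp add: algebra_simps del: mavg.simps fun_upd_apply)
qed

text \<open>Size biasing replaces 1/(k_i + 1) at time t by k_i/k_i <= 1 at time t+1, so each
  coordinate yields a factor d/(t+1) and disappears from the product.\<close>

lemma mavg_prod_inverse:
  fixes S :: "'d::finite set"
  shows "mavg t (\<lambda>k. \<Prod>i\<in>S. 1 / (real (k i) + 1)) \<le> (real CARD('d) / (real t + 1)) ^ card S"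
proof -
  have "finite S" by simp
  then show ?thesis
  proof (induction S arbitrary: t rule: finite_induct)
    case (insert i S)
    let ?D = "real CARD('d)"
    let ?f = "\<lambda>k. \<Prod>i\<in>S. 1 / (real (k i) + 1)"
    \<comment> \<open>At \<open>k i = 0\<close> the convention 1/0 = 0 is consistent with the factor
      \<open>real (k i)\<close> that will stand in front of \<open>g k\<close>.\<close>
    define g where "g k = ?f k * (1 / real (k i))" for k
    have f: "?f (k(i := c)) = ?f k" for k c using insert by (intro prod.cong) auto
    have "mavg t (\<lambda>k. \<Prod>i\<in>insert i S. 1 / (real (k i) + 1)) = mavg t (\<lambda>k. g (k(i := Suc (k i))))"
      unfolding g_def f using insert by (simp add: mult.commute add.commute)
    also have "\<dots> = ?D / (real t + 1) * mavg (Suc t) (\<lambda>k. real (k i) * g k)"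
      using mavg_size_bias[where t=t and i=i and g=g] by (simp add: field_simps del: mavg.simps)
    also have "\<dots> \<le> ?D / (real t + 1) * mavg (Suc t) ?f"
      by (intro mult_left_mono mavg_mono) (auto simp: g_def intro!: prod_nonneg)
    also have "\<dots> \<le> ?D / (real t + 1) * (?D / (real (Suc t) + 1)) ^ card S"
      using insert.IH[of "Suc t"] by (intro mult_left_mono) auto
    also have "\<dots> \<le> ?D / (real t + 1) * (?D / (real t + 1)) ^ card S"
      by (intro mult_left_mono power_mono divide_left_mono) auto
    finally show ?case using insert by simp
  qed simp
qed

lemma heat_nonneg: "0 \<le> heat t x y"
  by (induction t arbitrary: x) (auto intro: avg_nonneg)

text \<open>The line kernels are bounded by 1/sqrt(k_i + 1), while inverse moments are available for
  the squares 1/(k_i + 1); a Cauchy-Schwarz argument bridges the gap.\<close>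

lemma heat_le: "heat t x y \<le> sqrt (real CARD('d) / (real t + 1)) ^ CARD('d)"
  for x :: "int ^ 'd"
proof -
  let ?s = "sqrt (real CARD('d) / (real t + 1)) ^ CARD('d)"
  let ?f = "\<lambda>k :: 'd \<Rightarrow> nat. \<Prod>i\<in>UNIV. 1 / sqrt (real (k i) + 1)"
  have s: "?s > 0" by simp
  have s2: "(real CARD('d) / (real t + 1)) ^ CARD('d) = ?s * ?s"
    by (simp flip: power_mult_distrib)
  have f2: "?f k * ?f k = (\<Prod>i\<in>UNIV. 1 / (real (k i) + 1))" for k
    by (simp flip: prod.distrib)
  have "heat t x y \<le> mavg t ?f"
    unfolding heat_eq_mavg by (intro mavg_mono prod_mono) (auto simp: line_heat_nonneg line_heat_le)
  \<comment> \<open>This is f <= f^2/(2s) + s/2 with s the desired bound: Cauchy-Schwarz with the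
    optimal weight already inserted.\<close>
  also have "\<dots> \<le> mavg t (\<lambda>k :: 'd \<Rightarrow> nat. (1 / (2 * ?s)) * (\<Prod>i\<in>UNIV. 1 / (real (k i) + 1)) + ?s / 2)"
  proof (intro mavg_mono)
    fix k :: "'d \<Rightarrow> nat"
    have "0 \<le> (?f k - ?s)\<^sup>2" by simp
    then have "2 * ?s * ?f k \<le> ?f k * ?f k + ?s * ?s" by (simp add: power2_eq_square algebra_simps)
    then show "?f k \<le> (1 / (2 * ?s)) * (\<Prod>i\<in>UNIV. 1 / (real (k i) + 1)) + ?s / 2"
      unfolding f2[symmetric] using s by (simp add: field_simps)
  qed
  also have "\<dots> = (1 / (2 * ?s)) * mavg t (\<lambda>k :: 'd \<Rightarrow> nat. \<Prod>i\<in>UNIV. 1 / (real (k i) + 1)) + ?s / 2"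
    by (simp only: mavg_add mavg_cmult mavg_const)
  also have "\<dots> \<le> (1 / (2 * ?s)) * (?s * ?s) + ?s / 2"
    using mavg_prod_inverse[of t "UNIV :: 'd set"] s unfolding s2
    by (intro add_mono mult_left_mono) auto
  also have "\<dots> = ?s" using s by (simp add: field_simps)
  finally show ?thesis .
qed

section \<open>Hitting probabilities and occupation times\<close>

text \<open>\<open>hitp A s x\<close> is the probability that the walk from x visits A within s
  steps, and \<open>occ A s x\<close> is its expected number of visits to A at the times 0 to
  s.\<close>

fun hitp :: "(int ^ 'd) set \<Rightarrow> nat \<Rightarrow> int ^ 'd \<Rightarrow> real" where
  "hitp A 0 x = of_bool (x \<in> A)"
| "hitp A (Suc s) x = (if x \<in> A then 1 else avg (hitp A s) x)"

fun occ :: "(int ^ 'd) set \<Rightarrow> nat \<Rightarrow> int ^ 'd \<Rightarrow> real" where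
  "occ A 0 x = of_bool (x \<in> A)"
| "occ A (Suc s) x = of_bool (x \<in> A) + avg (occ A s) x"

lemma hitp_nonneg: "0 \<le> hitp A s x"
  by (induction s arbitrary: x) (auto intro: avg_nonneg)

lemma hitp_le_1: "hitp A s x \<le> 1"
proof (induction s arbitrary: x)
  case (Suc s)
  then have "avg (hitp A s) x \<le> avg (\<lambda>_. 1) x" by (intro avg_mono)
  then show ?case by simp
qed simp

lemma hitp_mem: "x \<in> A \<Longrightarrow> hitp A s x = 1"
  by (cases s) auto

lemma hitp_mono_Suc: "hitp A s x \<le> hitp A (Suc s) x"
proof (induction s arbitrary: x)
  case 0
  show ?case by (auto intro: avg_nonneg)
next
  case (Suc s)
  then have "avg (hitp A s) x \<le> avg (hitp A (Suc s)) x" by (intro avg_mono)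
  then show ?case by (simp del: hitp.simps add: hitp.simps(2)[of A s] hitp.simps(2)[of A "Suc s"])
qed

lemma hitp_mono_time: "s \<le> t \<Longrightarrow> hitp A s x \<le> hitp A t x"
  by (rule lift_Suc_mono_le[of "\<lambda>s. hitp A s x"]) (auto simp: hitp_mono_Suc simp del: hitp.simps)

text \<open>Optional stopping of the supermartingale c^(-t) u(X_t) at the hitting time of A,
  unrolled as an induction on the number of steps.\<close>

lemma hitp_le_supermartingale:
  assumes "\<And>y. 0 \<le> u y" "\<And>y. y \<in> A \<Longrightarrow> 1 \<le> u y" "\<And>y. avg u y \<le> c * u y" "1 \<le> c"
  shows "hitp A s x \<le> c ^ s * u x"
proof (induction s arbitrary: x)
  case 0
  show ?case using assms(1,2)[of x] by auto
next
  case (Suc s)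
  have "avg (hitp A s) x \<le> avg (\<lambda>y. c ^ s * u y) x" by (intro avg_mono Suc)
  also have "\<dots> = c ^ s * avg u x" by (rule avg_cmult)
  also have "\<dots> \<le> c ^ s * (c * u x)" using assms by (intro mult_left_mono) auto
  finally have 1: "avg (hitp A s) x \<le> c ^ Suc s * u x" by (simp add: mult_ac)
  have "1 \<le> c ^ Suc s * u x" if "x \<in> A"
    using mult_mono[of 1 "c ^ Suc s" 1 "u x"] assms that one_le_power[of c "Suc s"] by auto
  with 1 show ?case by auto
qed

section \<open>Gaussian bound for travelling a given distance\<close>

lemma cosh_le_exp_square: "cosh l \<le> exp (l\<^sup>2 / 2)" for l :: real
proof -
  have pos: "cosh l \<le> exp (l\<^sup>2 / 2)" if "l \<ge> 0" for l :: real
  proof -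
    \<comment> \<open>Hoeffding's lemma for a fair Bernoulli variable, stretched to a step of 2l and
      centred, is the bound for a symmetric sign.\<close>
    have "- l + ln (1 + (exp (2 * l) - 1) / 2) \<le> l\<^sup>2 / 2"
      using Hoeffdings_lemma_aux[of "2 * l" "1 / 2"] that by (simp add: power_mult_distrib)
    then have "exp (- l + ln (1 + (exp (2 * l) - 1) / 2)) \<le> exp (l\<^sup>2 / 2)" by simp
    moreover have "1 + (exp (2 * l) - 1) / 2 > (0 :: real)"
      using exp_gt_zero[of "2 * l"] by (simp add: field_simps del: exp_gt_zero)
    ultimately have "exp (- l) * (1 + (exp (2 * l) - 1) / 2) \<le> exp (l\<^sup>2 / 2)"
      by (simp only: exp_add exp_ln)
    moreover have "exp (- l) * (1 + (exp (2 * l) - 1) / 2) = cosh l"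
      by (simp add: cosh_def field_simps flip: exp_add)
    ultimately show ?thesis by simp
  qed
  show ?thesis
  proof (cases "l \<ge> 0")
    case False
    then show ?thesis using pos[of "- l"] by simp
  qed (rule pos)
qed

text \<open>A step in direction j multiplies the j-th hyperbolic cosine by cosh l on average and
  leaves the others alone. Averaging over j gives the exact factor 1 + (cosh l - 1)/d, which is at
  most cosh l.\<close>

lemma avg_sum_cosh_le:
  fixes a y :: "int ^ 'd"
  shows "avg (\<lambda>y. \<Sum>i\<in>UNIV. cosh (l * real_of_int (y $ i - a $ i))) y
     \<le> exp (l\<^sup>2 / 2) * (\<Sum>i\<in>UNIV. cosh (l * real_of_int (y $ i - a $ i)))"
proof -
  let ?c = "\<lambda>y i. cosh (l * real_of_int (y $ i - a $ i))"
  let ?u = "\<lambda>y. \<Sum>i\<in>UNIV. ?c y i"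
  let ?D = "real CARD('d)"
  have step: "?u (y + axis j 1) + ?u (y - axis j 1) = 2 * ?u y + 2 * (cosh l - 1) * ?c y j" for j
  proof -
    have split: "?u z = ?c z j + (\<Sum>i\<in>-{j}. ?c z i)" for z
      by (subst sum.remove[of UNIV j]) (auto simp: Compl_eq_Diff_UNIV)
    have "(\<Sum>i\<in>-{j}. ?c (y + axis j 1) i) = (\<Sum>i\<in>-{j}. ?c y i)"
      "(\<Sum>i\<in>-{j}. ?c (y - axis j 1) i) = (\<Sum>i\<in>-{j}. ?c y i)"
      by (auto intro!: sum.cong simp: axis_def)
    moreover have "?c (y + axis j 1) j + ?c (y - axis j 1) j = 2 * cosh l * ?c y j"
    proof -
      have 1: "l * real_of_int ((y + axis j 1) $ j - a $ j) = l * real_of_int (y $ j - a $ j) + l"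
        "l * real_of_int ((y - axis j 1) $ j - a $ j) = l * real_of_int (y $ j - a $ j) - l"
        by (auto simp: algebra_simps)
      show ?thesis unfolding 1 cosh_add cosh_diff by simp
    qed
    ultimately show ?thesis unfolding split[of "y + axis j 1"] split[of "y - axis j 1"] split[of y]
      by (simp add: algebra_simps)
  qed
  have "avg ?u y = (\<Sum>j\<in>UNIV. 2 * ?u y + 2 * (cosh l - 1) * ?c y j) / (2 * ?D)"
    unfolding avg_alt step ..
  also have "\<dots> = ?u y + (cosh l - 1) / ?D * ?u y"
  proof -
    define U where "U = ?u y"
    have "(\<Sum>j\<in>UNIV. 2 * ?u y + 2 * (cosh l - 1) * ?c y j) = ?D * (2 * U) + 2 * (cosh l - 1) * U"
      unfolding sum.distrib sum_distrib_left[symmetric] U_def[symmetric] sum_constant by simp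
    moreover have "(?D * (2 * U) + 2 * (cosh l - 1) * U) / (2 * ?D) = U + (cosh l - 1) / ?D * U"
      by (simp add: field_simps)
    ultimately show ?thesis unfolding U_def by (simp only:)
  qed
  also have "\<dots> = (1 + (cosh l - 1) / ?D) * ?u y" by (simp add: algebra_simps)
  also have "\<dots> \<le> exp (l\<^sup>2 / 2) * ?u y"
  proof (intro mult_right_mono sum_nonneg)
    have "(cosh l - 1) / ?D \<le> (cosh l - 1) / 1"
      using cosh_real_ge_1[of l] by (intro divide_left_mono) (auto simp: Suc_le_eq)
    then show "1 + (cosh l - 1) / ?D \<le> exp (l\<^sup>2 / 2)" using cosh_le_exp_square[of l] by simp
  qed auto
  finally show ?thesis .
qed

text \<open>Exponential Chebyshev bound for the sum of hyperbolic cosines of the displacements,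
  normalised to be at least 1 once some coordinate has moved by r.\<close>

lemma hitp_exit:
  fixes a :: "int ^ 'd"
  assumes "\<And>y. y \<in> A \<Longrightarrow> \<exists>i. int r \<le> \<bar>y $ i - a $ i\<bar>"
  shows "hitp A s a \<le> 2 * real CARD('d) * exp (- (real r)\<^sup>2 / (2 * real s))"
proof (cases "s = 0")
  \<comment> \<open>Division by zero gives the exponent 0, so the bound reads 2d and holds
    trivially.\<close>
  case True
  have "1 \<le> real CARD('d)" by (simp add: Suc_le_eq)
  then have "1 \<le> 2 * real CARD('d)" by linarith
  then show ?thesis using True order.trans[OF hitp_le_1[of A 0 a]] by (simp del: hitp.simps)
next
  case False
  then have s: "real s > 0" by simp
  \<comment> \<open>The minimiser of s l^2/2 - l r.\<close>
  define l where "l = real r / real s"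
  let ?c = "\<lambda>y i. cosh (l * real_of_int (y $ i - a $ i))"
  define u where "u y = (1 / cosh (l * real r)) * (\<Sum>i\<in>UNIV. ?c y i)" for y
  have l: "l \<ge> 0" by (simp add: l_def)
  have "hitp A s a \<le> exp (l\<^sup>2 / 2) ^ s * u a"
  proof (rule hitp_le_supermartingale)
    show "0 \<le> u y" for y by (auto simp: u_def intro!: divide_nonneg_nonneg sum_nonneg)
    show "1 \<le> u y" if "y \<in> A" for y
    proof -
      obtain i where i: "int r \<le> \<bar>y $ i - a $ i\<bar>" using assms \<open>y \<in> A\<close> by blast
      have "cosh (l * real r) \<le> cosh (l * real_of_int \<bar>y $ i - a $ i\<bar>)"
      proof -
        have "real r \<le> real_of_int \<bar>y $ i - a $ i\<bar>" using i by linarith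
        then have "l * real r \<le> l * real_of_int \<bar>y $ i - a $ i\<bar>" using l by (rule mult_left_mono)
        then show ?thesis using l by (subst cosh_real_nonneg_le_iff) auto
      qed
      also have "\<dots> = ?c y i" by (metis abs_mult abs_of_nonneg cosh_real_abs l of_int_abs)
      also have "\<dots> \<le> (\<Sum>i\<in>UNIV. ?c y i)" by (intro member_le_sum) auto
      finally show ?thesis by (simp add: u_def field_simps)
    qed
    show "avg u y \<le> exp (l\<^sup>2 / 2) * u y" for y
    proof -
      have "avg u y = (1 / cosh (l * real r)) * avg (\<lambda>y. \<Sum>i\<in>UNIV. ?c y i) y"
        unfolding u_def by (rule avg_cmult)
      also have "\<dots> \<le> (1 / cosh (l * real r)) * (exp (l\<^sup>2 / 2) * (\<Sum>i\<in>UNIV. ?c y i))"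
        by (intro mult_left_mono avg_sum_cosh_le) auto
      finally show ?thesis by (simp add: u_def mult_ac)
    qed
  qed simp
  also have "u a = real CARD('d) / cosh (l * real r)" by (simp add: u_def)
  also have "exp (l\<^sup>2 / 2) ^ s * (real CARD('d) / cosh (l * real r)) \<le> exp (l\<^sup>2 / 2) ^ s * (real CARD('d) / (exp (l * real r) / 2))"
    by (intro mult_left_mono divide_left_mono) (auto simp: cosh_def intro!: mult_pos_pos add_pos_pos)
  also have "\<dots> = 2 * real CARD('d) * (exp (real s * (l\<^sup>2 / 2)) * exp (- (l * real r)))"
    unfolding exp_of_nat_mult by (simp add: exp_minus field_simps)
  also have "exp (real s * (l\<^sup>2 / 2)) * exp (- (l * real r)) = exp (real s * (l\<^sup>2 / 2) - l * real r)"
    by (simp only: diff_conv_add_uminus exp_add)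
  also have "real s * (l\<^sup>2 / 2) - l * real r = - (real r)\<^sup>2 / (2 * real s)"
    using s by (simp add: l_def field_simps power2_eq_square)
  finally show ?thesis .
qed

section \<open>Occupation times and the volume of the sausage\<close>

lemma occ_nonneg: "0 \<le> occ A s x"
  by (induction s arbitrary: x) (auto intro!: avg_nonneg add_nonneg_nonneg)

lemma occ_mono_Suc: "occ A s x \<le> occ A (Suc s) x"
proof (induction s arbitrary: x)
  case 0
  have "0 \<le> avg (occ A 0) x" by (rule avg_nonneg) (rule occ_nonneg)
  then show ?case by (simp only: occ.simps)
next
  case (Suc s)
  then have "avg (occ A s) x \<le> avg (occ A (Suc s)) x" by (intro avg_mono)
  then show ?case by (simp del: occ.simps add: occ.simps(2)[of A s] occ.simps(2)[of A "Suc s"])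
qed

lemma occ_mono_time: "s \<le> t \<Longrightarrow> occ A s x \<le> occ A t x"
  by (rule lift_Suc_mono_le[of "\<lambda>s. occ A s x"]) (auto simp: occ_mono_Suc simp del: occ.simps)

text \<open>Strong Markov property at the hitting time of A: from there the walk makes at least
  \<kappa> expected visits to B within t further steps.\<close>

lemma hitp_le_occ:
  assumes "\<And>a. a \<in> A \<Longrightarrow> \<kappa> \<le> occ B t a" "0 \<le> \<kappa>"
  shows "\<kappa> * hitp A s x \<le> occ B (s + t) x"
proof (induction s arbitrary: x)
  case 0
  show ?case using assms(1)[of x] occ_nonneg[of B t x] by auto
next
  case (Suc s)
  show ?case
  proof (cases "x \<in> A")
    case True
    then show ?thesis using assms(1)[of x] occ_mono_time[of t "Suc s + t" B x] by (simp del: occ.simps)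
  next
    case False
    have "\<kappa> * avg (hitp A s) x = avg (\<lambda>y. \<kappa> * hitp A s y) x" by (simp add: avg_cmult)
    also have "\<dots> \<le> avg (occ B (s + t)) x" by (intro avg_mono Suc)
    finally show ?thesis using False by simp
  qed
qed

text \<open>A walk that does not leave B up to time t spends all t+1 time points there.\<close>

lemma occ_lower: "real t + 1 \<le> occ B t x + (real t + 1) * hitp (- B) t x"
proof (induction t arbitrary: x)
  case (Suc t)
  show ?case
  proof (cases "x \<in> B")
    case True
    have "real t + 1 = avg (\<lambda>_. real t + 1) x" by simp
    also have "\<dots> \<le> avg (\<lambda>y. occ B t y + (real t + 1) * hitp (- B) t y) x"
      by (intro avg_mono Suc)
    also have "\<dots> = avg (occ B t) x + (real t + 1) * avg (hitp (- B) t) x"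
      by (simp add: avg_add avg_cmult)
    also have "\<dots> \<le> avg (occ B t) x + (real (Suc t) + 1) * avg (hitp (- B) t) x"
      using avg_nonneg[of "hitp (- B) t" x] hitp_nonneg by (intro add_mono mult_right_mono) auto
    finally show ?thesis using True by simp
  next
    case False
    then show ?thesis using occ_nonneg[of B "Suc t" x] by (simp del: occ.simps)
  qed
qed auto

lemma bij_nbr: "bij (\<lambda>x. nbr x e)"
  by (rule o_bij[of "\<lambda>x. nbr x (fst e, \<not> snd e)"]) (auto simp: nbr_def fun_eq_iff)

lemma ennreal_avg:
  fixes x :: "int ^ 'd"
  assumes "\<And>y. 0 \<le> f y"
  shows "ennreal (avg f x) = (\<Sum>e\<in>UNIV. ennreal (1 / (2 * real CARD('d))) * ennreal (f (nbr x e)))"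
  using assms by (simp add: avg_def sum_divide_distrib sum_ennreal flip: ennreal_mult)

lemma sum_step_weights: "(\<Sum>e\<in>(UNIV :: ('d::finite \<times> bool) set). ennreal (1 / (2 * real CARD('d)))) = 1"
proof -
  have "card (UNIV :: ('d \<times> bool) set) = 2 * CARD('d)" by simp
  then show ?thesis by (subst sum_ennreal) auto
qed

text \<open>Counting measure is invariant for the walk, because every fixed step permutes the
  lattice.\<close>

lemma nn_integral_avg:
  fixes f :: "int ^ 'd \<Rightarrow> real"
  assumes "\<And>y. 0 \<le> f y"
  shows "(\<integral>\<^sup>+x. ennreal (avg f x) \<partial>count_space UNIV) = (\<integral>\<^sup>+x. ennreal (f x) \<partial>count_space UNIV)"
proof -
  have "(\<integral>\<^sup>+x. ennreal (avg f x) \<partial>count_space UNIV)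
      = (\<Sum>e\<in>UNIV. ennreal (1 / (2 * real CARD('d))) * (\<integral>\<^sup>+x. ennreal (f (nbr x e)) \<partial>count_space UNIV))"
    unfolding ennreal_avg[OF assms] by (subst nn_integral_sum) (auto simp: nn_integral_cmult)
  moreover have "(\<integral>\<^sup>+x. ennreal (f (nbr x e)) \<partial>count_space UNIV) = (\<integral>\<^sup>+x. ennreal (f x) \<partial>count_space UNIV)" for e :: "'d \<times> bool"
    using nn_integral_bij_count_space[OF bij_nbr[of e], of "\<lambda>x. ennreal (f x)"] by simp
  ultimately show ?thesis by (simp only: sum_distrib_right[symmetric] sum_step_weights) simp
qed

lemma nn_integral_occ:
  assumes "finite A"
  shows "(\<integral>\<^sup>+x. ennreal (occ A t x) \<partial>count_space UNIV) = ennreal ((real t + 1) * real (card A))"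
proof (induction t)
  case 0
  have "(\<integral>\<^sup>+x. ennreal (of_bool (x \<in> A)) \<partial>count_space UNIV) = (\<integral>\<^sup>+x. indicator A x \<partial>count_space UNIV)"
    by (intro nn_integral_cong) auto
  then show ?case using assms by (simp add: emeasure_count_space ennreal_of_nat_eq_real_of_nat)
next
  case (Suc t)
  have "(\<integral>\<^sup>+x. ennreal (occ A (Suc t) x) \<partial>count_space UNIV)
      = (\<integral>\<^sup>+x. indicator A x + ennreal (avg (occ A t) x) \<partial>count_space UNIV)"
    by (intro nn_integral_cong) (auto simp: ennreal_plus avg_nonneg occ_nonneg)
  also have "\<dots> = of_nat (card A) + (\<integral>\<^sup>+x. ennreal (occ A t x) \<partial>count_space UNIV)"
    using assms by (subst nn_integral_add) (auto simp: nn_integral_avg occ_nonneg emeasure_count_space)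
  finally show ?case
    by (simp only: Suc) (simp add: ennreal_of_nat_eq_real_of_nat algebra_simps flip: ennreal_plus)
qed

lemma finite_lattice_box: "finite (lattice_box a n)"
  and card_lattice_box_le: "card (lattice_box a n) \<le> (2 * n + 1) ^ CARD('d)"
  for a :: "int ^ 'd"
proof -
  let ?P = "PiE UNIV (\<lambda>i. {a $ i - int n..a $ i + int n})"
  have sub: "lattice_box a n \<subseteq> vec_lambda ` ?P"
  proof
    fix y assume "y \<in> lattice_box a n"
    then have "vec_nth y \<in> ?P" by (auto simp: lattice_box_def abs_le_iff algebra_simps)
    then show "y \<in> vec_lambda ` ?P" by (rule rev_image_eqI) simp
  qed
  have fin: "finite ?P" by (intro finite_PiE) auto
  then show "finite (lattice_box a n)" using sub by (rule finite_surj)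
  have "card (lattice_box a n) \<le> card ?P" using fin sub by (rule surj_card_le)
  also have "\<dots> = (2 * n + 1) ^ CARD('d)"
  proof -
    have "nat (1 + 2 * int n) = 2 * n + 1" by simp
    then show ?thesis by (simp add: card_PiE algebra_simps)
  qed
  finally show "card (lattice_box a n) \<le> (2 * n + 1) ^ CARD('d)" .
qed

text \<open>With L = 2 ln(4d) this is 4 L 5^d: a factor 2L from the time spent after a hit, 2 from
  the time horizon s+t+1, and 5^d from the volume of the box of radius 2n.\<close>

definition sausage_const :: "nat \<Rightarrow> real" where
  "sausage_const d = 8 * ln (4 * real d) * 5 ^ d"

text \<open>After meeting the box of radius n the walk spends time of order n^2 in the concentric
  box of radius 2n. Hence hitting probabilities are dominated by occupation times divided by n^2,
  and occupation times can be summed exactly over starting points.\<close>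

lemma sausage_bound:
  fixes a :: "int ^ 'd"
  assumes d: "CARD('d) \<ge> 2" and n: "n \<ge> 1"
  shows "(\<integral>\<^sup>+x. ennreal (hitp (lattice_box a n) s x) \<partial>count_space UNIV)
     \<le> ennreal (sausage_const CARD('d) * (real s + (real n)\<^sup>2) * real n ^ (CARD('d) - 2))"
proof -
  let ?D = "real CARD('d)"
  \<comment> \<open>Within n^2/L steps the walk travels a distance n with probability at most 2d
    exp(-ln(4d)) = 1/2, so it is expected to spend at least half of that time in the larger
    box.\<close>
  define L where "L = 2 * ln (4 * ?D)"
  have ln4: "1 < ln (4 :: real)" using exp_le ln_less_cancel_iff[of "exp 1" 4] by simp
  have "ln 4 \<le> ln (4 * ?D)" using d by (subst ln_le_cancel_iff) auto
  then have L: "L > 1" using ln4 unfolding L_def by linarith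
  define t where "t = nat \<lfloor>(real n)\<^sup>2 / L\<rfloor>"
  have t: "real t \<le> (real n)\<^sup>2 / L" "(real n)\<^sup>2 / L \<le> real t + 1"
    using L unfolding t_def by (simp_all add: of_nat_nat)
  let ?A = "lattice_box a n" and ?B = "lattice_box a (2 * n)"
  define \<kappa> where "\<kappa> = (real t + 1) / 2"
  have occ: "\<kappa> \<le> occ ?B t x" if x: "x \<in> ?A" for x
  proof -
    have "hitp (- ?B) t x \<le> 1 / 2"
    proof (cases "t = 0")
      case True
      have "x \<in> ?B" using x by (auto simp: lattice_box_def intro: order.trans)
      then show ?thesis using True by simp
    next
      case False
      have "hitp (- ?B) t x \<le> 2 * ?D * exp (- (real n)\<^sup>2 / (2 * real t))"
      proof (rule hitp_exit)
        fix y assume "y \<in> - ?B"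
        then obtain i where i: "int (2 * n) < \<bar>y $ i - a $ i\<bar>" by (auto simp: lattice_box_def not_le)
        moreover have "\<bar>x $ i - a $ i\<bar> \<le> int n" using x by (auto simp: lattice_box_def)
        ultimately have "int n \<le> \<bar>y $ i - x $ i\<bar>" by linarith
        then show "\<exists>i. int n \<le> \<bar>y $ i - x $ i\<bar>" ..
      qed
      also have "\<dots> \<le> 2 * ?D * exp (- ln (4 * ?D))"
      proof -
        have "L * real t \<le> (real n)\<^sup>2" using t L by (simp add: field_simps)
        then have "- (real n)\<^sup>2 / (2 * real t) \<le> - ln (4 * ?D)" using False by (simp add: L_def field_simps)
        then show ?thesis by simp
      qed
      also have "\<dots> = 1 / 2" using d by (simp add: exp_minus)
      finally show ?thesis .
    qed
    then have "(real t + 1) * hitp (- ?B) t x \<le> (real t + 1) * (1 / 2)" by (intro mult_left_mono) auto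
    with occ_lower[of t ?B x] have "real t + 1 \<le> occ ?B t x + (real t + 1) * (1 / 2)" by (rule order.trans[OF _ add_left_mono])
    then show ?thesis by (simp add: \<kappa>_def field_simps)
  qed
  have \<kappa>: "\<kappa> > 0" "(real n)\<^sup>2 / (2 * L) \<le> \<kappa>" using t L by (auto simp: \<kappa>_def field_simps)
  have n1: "real n \<ge> 1" using n by simp
  have "hitp ?A s x \<le> (1 / \<kappa>) * occ ?B (s + t) x" for x
    using hitp_le_occ[of ?A \<kappa> ?B t s x] occ \<kappa> by (simp add: field_simps)
  then have "(\<integral>\<^sup>+x. ennreal (hitp ?A s x) \<partial>count_space UNIV)
      \<le> (\<integral>\<^sup>+x. ennreal (1 / \<kappa>) * ennreal (occ ?B (s + t) x) \<partial>count_space UNIV)"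
    using \<kappa> by (intro nn_integral_mono) (auto simp flip: ennreal_mult' intro!: ennreal_leI)
  also have "\<dots> = ennreal (1 / \<kappa> * ((real (s + t) + 1) * real (card ?B)))"
    using \<kappa> by (subst nn_integral_cmult) (auto simp: nn_integral_occ finite_lattice_box simp flip: ennreal_mult')
  also have "\<dots> \<le> ennreal (sausage_const CARD('d) * (real s + (real n)\<^sup>2) * real n ^ (CARD('d) - 2))"
  proof (intro ennreal_leI)
    have n2: "1 \<le> (real n)\<^sup>2" using n1 by (simp add: one_le_power)
    have "(real n)\<^sup>2 / L \<le> (real n)\<^sup>2 / 1" using L n2 by (intro divide_left_mono) auto
    then have st: "real (s + t) + 1 \<le> 2 * (real s + (real n)\<^sup>2)" using t n2 by simp
    have "real (card ?B) \<le> real ((2 * (2 * n) + 1) ^ CARD('d))"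
      using card_lattice_box_le[of a "2 * n"] by (simp only: of_nat_le_iff)
    also have "\<dots> = (4 * real n + 1) ^ CARD('d)" by (simp add: add.commute)
    also have "\<dots> \<le> (5 * real n) ^ CARD('d)" using n1 by (intro power_mono) auto
    also have "\<dots> = 5 ^ CARD('d) * real n ^ (CARD('d) - 2) * (real n)\<^sup>2"
    proof -
      have "real n ^ CARD('d) = real n ^ (CARD('d) - 2) * (real n)\<^sup>2"
        using d by (metis le_add_diff_inverse2 power_add)
      then show ?thesis by (simp add: power_mult_distrib)
    qed
    finally have cB: "real (card ?B) \<le> 5 ^ CARD('d) * real n ^ (CARD('d) - 2) * (real n)\<^sup>2" .
    have "1 / \<kappa> \<le> 2 * L / (real n)\<^sup>2"
    proof -
      have "0 < (real n)\<^sup>2 / (2 * L)" using L n by (intro divide_pos_pos) auto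
      then have "1 / \<kappa> \<le> 1 / ((real n)\<^sup>2 / (2 * L))" using \<kappa> by (intro le_imp_inverse_le[of "(real n)\<^sup>2 / (2 * L)" \<kappa>, unfolded inverse_eq_divide])
      then show ?thesis by simp
    qed
    then have "1 / \<kappa> * ((real (s + t) + 1) * real (card ?B))
        \<le> 2 * L / (real n)\<^sup>2 * (2 * (real s + (real n)\<^sup>2) * (5 ^ CARD('d) * real n ^ (CARD('d) - 2) * (real n)\<^sup>2))"
      using \<kappa> L st cB by (intro mult_mono) auto
    also have "\<dots> = sausage_const CARD('d) * (real s + (real n)\<^sup>2) * real n ^ (CARD('d) - 2)"
      using n1 by (simp add: sausage_const_def L_def field_simps)
    finally show "1 / \<kappa> * ((real (s + t) + 1) * real (card ?B))
       \<le> sausage_const CARD('d) * (real s + (real n)\<^sup>2) * real n ^ (CARD('d) - 2)" .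
  qed
  finally show ?thesis .
qed

section \<open>Walks and cyclic words\<close>

lemma adjacent_iff_nbr: "adjacent x y \<longleftrightarrow> y \<in> range (nbr x)"
  for x y :: "int ^ 'd"
proof
  assume adj: "adjacent x y"
  then have sum1: "(\<Sum>i\<in>UNIV. \<bar>x $ i - y $ i\<bar>) = 1" by (simp add: adjacent_def)
  have "\<exists>i. x $ i \<noteq> y $ i"
  proof (rule ccontr)
    assume "\<not> ?thesis"
    then show False using sum1 by simp
  qed
  then obtain i where i: "x $ i \<noteq> y $ i" ..
  have "\<bar>x $ i - y $ i\<bar> + (\<Sum>j\<in>UNIV - {i}. \<bar>x $ j - y $ j\<bar>) = 1"
    using sum1 by (subst (asm) sum.remove[of UNIV i]) auto
  moreover have nn: "0 \<le> (\<Sum>j\<in>UNIV - {i}. \<bar>x $ j - y $ j\<bar>)" by (intro sum_nonneg) auto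
  moreover have "1 \<le> \<bar>x $ i - y $ i\<bar>" using i by auto
  ultimately have 1: "\<bar>x $ i - y $ i\<bar> = 1" and "(\<Sum>j\<in>UNIV - {i}. \<bar>x $ j - y $ j\<bar>) = 0" by linarith+
  then have 0: "x $ j = y $ j" if "j \<noteq> i" for j
    using that by (subst (asm) sum_nonneg_eq_0_iff) auto
  from 1 have "y $ i = x $ i + 1 \<or> y $ i = x $ i - 1" by auto
  then have "y = nbr x (i, True) \<or> y = nbr x (i, False)"
    using 0 by (auto simp: nbr_def vec_eq_iff axis_def)
  then show "y \<in> range (nbr x)" by blast
next
  assume "y \<in> range (nbr x)"
  then obtain i b where y: "y = nbr x (i, b)" by auto
  have "(\<Sum>j\<in>UNIV. \<bar>x $ j - y $ j\<bar>) = (\<Sum>j\<in>UNIV. if j = i then 1 else 0)"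
    by (intro sum.cong) (auto simp: y nbr_def axis_def)
  then show "adjacent x y" by (simp add: adjacent_def)
qed

lemma inj_nbr: "inj (nbr x)"
proof (rule injI)
  fix e e' assume eq: "nbr x e = nbr x e'"
  then have *: "nbr x e $ fst e - x $ fst e = nbr x e' $ fst e - x $ fst e" by simp
  show "e = e'"
    using * by (cases e; cases e') (auto simp: nbr_def axis_def split: if_splits)
qed

definition step :: "int ^ 'd \<Rightarrow> (int ^ 'd) pmf" where
  "step x = map_pmf (nbr x) (pmf_of_set UNIV)"

lemma pmf_step: "pmf (step x) y = srw x y"
  for x y :: "int ^ 'd"
proof (cases "y \<in> range (nbr x)")
  case True
  then obtain e where "y = nbr x e" by auto
  then show ?thesis
    using True by (simp add: step_def pmf_map_inj' inj_nbr srw_def adjacent_iff_nbr)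
next
  case False
  then have "y \<notin> set_pmf (step x)" by (auto simp: step_def)
  then show ?thesis using False by (simp add: srw_def adjacent_iff_nbr set_pmf_iff)
qed

lemma nn_integral_step:
  assumes "\<And>y. 0 \<le> f y"
  shows "(\<integral>\<^sup>+y. ennreal (f y) \<partial>step x) = ennreal (avg f x)"
  using assms
  by (simp add: step_def nn_integral_pmf_of_set avg_def sum_ennreal divide_ennreal[symmetric] sum_nonneg
      ennreal_mult ennreal_of_nat_eq_real_of_nat mult.commute)

lemma srw_nonneg: "0 \<le> srw x y"
  by (simp add: srw_def)

lemma srw_commute: "srw x y = srw y x"
  by (simp add: srw_def adjacent_def abs_minus_commute)

lemma heat_1: "heat (Suc 0) x y = srw x y"
proof -
  have "ennreal (heat (Suc 0) x y) = (\<integral>\<^sup>+z. ennreal (of_bool (z = y)) \<partial>step x)"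
    by (subst nn_integral_step) auto
  also have "\<dots> = (\<integral>\<^sup>+z. indicator {y} z \<partial>step x)" by (intro nn_integral_cong) auto
  also have "\<dots> = ennreal (srw x y)" by (simp add: emeasure_pmf_single pmf_step)
  finally show ?thesis by (subst (asm) ennreal_inj) (auto simp: srw_nonneg simp del: heat.simps intro: heat_nonneg)
qed

section \<open>The walk as a law on finite words\<close>

fun walk :: "nat \<Rightarrow> int ^ 'd \<Rightarrow> (int ^ 'd) list pmf" where
  "walk 0 x = return_pmf [x]"
| "walk (Suc n) x = bind_pmf (step x) (\<lambda>y. map_pmf ((#) x) (walk n y))"

lemma set_walk: "l \<in> set_pmf (walk n x) \<Longrightarrow> length l = Suc n \<and> hd l = x"
  by (induction n arbitrary: x l) fastforce+

lemma nn_integral_walk_cong: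
  assumes "\<And>l. length l = Suc n \<Longrightarrow> hd l = x \<Longrightarrow> f l = g l"
  shows "(\<integral>\<^sup>+l. f l \<partial>walk n x) = (\<integral>\<^sup>+l. g l \<partial>walk n x)"
  using assms set_walk by (intro nn_integral_cong_AE) (auto simp: AE_measure_pmf_iff)

fun path_weight :: "(int ^ 'd) list \<Rightarrow> real" where
  "path_weight (x # y # l) = srw x y * path_weight (y # l)"
| "path_weight _ = 1"

lemma path_weight_nonneg: "0 \<le> path_weight l"
  by (induction l rule: path_weight.induct) (auto simp: srw_nonneg)

lemma path_weight_snoc: "l \<noteq> [] \<Longrightarrow> path_weight (l @ [x]) = path_weight l * srw (last l) x"
  by (induction l rule: path_weight.induct) auto

text \<open>Reversibility of the walk: the step probabilities are symmetric.\<close>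

lemma path_weight_rev: "path_weight (rev l) = path_weight l"
proof (induction l rule: path_weight.induct)
  case (1 x y l)
  have "path_weight (rev (x # y # l)) = path_weight (rev (y # l) @ [x])" by simp
  also have "\<dots> = path_weight (rev (y # l)) * srw (last (rev (y # l))) x"
    by (rule path_weight_snoc) simp
  finally show ?case using 1 by (simp add: srw_commute mult.commute)
qed auto

lemma pmf_walk: "pmf (walk n x) l = (if length l = Suc n \<and> hd l = x then path_weight l else 0)"
proof (induction n arbitrary: x l)
  case 0
  show ?case by (cases l) (auto simp: pmf_return indicator_def)
next
  case (Suc n)
  show ?case
  proof (cases "length l = Suc (Suc n) \<and> hd l = x")
    case True
    then obtain y l' where l: "l = x # y # l'" "length l' = n" by (cases l; cases "tl l") auto
    have "ennreal (pmf (walk (Suc n) x) l) = (\<integral>\<^sup>+z. ennreal (pmf (walk n z) (y # l')) \<partial>step x)"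
      by (simp add: ennreal_pmf_bind l pmf_map_inj')
    also have "\<dots> = (\<integral>\<^sup>+z. ennreal (path_weight (y # l')) * indicator {y} z \<partial>step x)"
      by (intro nn_integral_cong) (auto simp: Suc l)
    also have "\<dots> = ennreal (path_weight (y # l')) * ennreal (srw x y)"
      by (simp add: nn_integral_cmult emeasure_pmf_single pmf_step)
    also have "\<dots> = ennreal (path_weight l)"
      by (simp add: l srw_nonneg path_weight_nonneg mult.commute flip: ennreal_mult)
    finally show ?thesis
      using True by (subst (asm) ennreal_inj) (auto simp: path_weight_nonneg simp del: walk.simps)
  next
    case False
    then have "l \<notin> set_pmf (walk (Suc n) x)" using set_walk by blast
    then have "pmf (walk (Suc n) x) l = 0" by (simp add: set_pmf_iff del: walk.simps)
    then show ?thesis by (simp only: if_not_P[OF False])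
  qed
qed

text \<open>Summed over starting points, the walk turns into counting measure on words weighted by
  step probabilities. In this form time reversal and rotation are changes of variables.\<close>

lemma nn_integral_walks:
  fixes f :: "int ^ 'd \<Rightarrow> (int ^ 'd) list \<Rightarrow> ennreal"
  shows "(\<integral>\<^sup>+x. \<integral>\<^sup>+l. f x l \<partial>walk n x \<partial>count_space UNIV)
    = (\<integral>\<^sup>+l. ennreal (path_weight l) * (f (hd l) l * of_bool (length l = Suc n)) \<partial>count_space UNIV)"
proof -
  have "(\<integral>\<^sup>+x. \<integral>\<^sup>+l. f x l \<partial>walk n x \<partial>count_space UNIV)
    = (\<integral>\<^sup>+x. \<integral>\<^sup>+l. ennreal (pmf (walk n x) l) * f x l \<partial>count_space UNIV \<partial>count_space UNIV)"
    by (simp add: nn_integral_measure_pmf)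
  also have "\<dots> = (\<integral>\<^sup>+l. \<integral>\<^sup>+x. ennreal (pmf (walk n x) l) * f x l \<partial>count_space UNIV \<partial>count_space UNIV)"
    by (rule nn_integral_count_space_nn_integral) auto
  also have "\<dots> = (\<integral>\<^sup>+l. ennreal (path_weight l) * (f (hd l) l * of_bool (length l = Suc n)) \<partial>count_space UNIV)"
  proof (intro nn_integral_cong)
    fix l :: "(int ^ 'd) list"
    have "(\<integral>\<^sup>+x. ennreal (pmf (walk n x) l) * f x l \<partial>count_space UNIV)
        = (\<integral>\<^sup>+x. ennreal (path_weight l) * (f (hd l) l * of_bool (length l = Suc n)) * indicator {hd l} x \<partial>count_space UNIV)"
      by (intro nn_integral_cong) (auto simp: pmf_walk split: split_indicator)
    then show "(\<integral>\<^sup>+x. ennreal (pmf (walk n x) l) * f x l \<partial>count_space UNIV)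
      = ennreal (path_weight l) * (f (hd l) l * of_bool (length l = Suc n))"
      by (simp add: nn_integral_cmult)
  qed
  finally show ?thesis .
qed

lemma nn_integral_walks_rev:
  fixes f :: "(int ^ 'd) list \<Rightarrow> ennreal"
  shows "(\<integral>\<^sup>+x. \<integral>\<^sup>+l. f (rev l) \<partial>walk n x \<partial>count_space UNIV) = (\<integral>\<^sup>+x. \<integral>\<^sup>+l. f l \<partial>walk n x \<partial>count_space UNIV)"
proof -
  let ?g = "\<lambda>l. ennreal (path_weight l) * (f l * of_bool (length l = Suc n))"
  have "bij (rev :: (int ^ 'd) list \<Rightarrow> _)" by (rule o_bij[of rev]) auto
  then have "(\<integral>\<^sup>+l. ?g (rev l) \<partial>count_space UNIV) = (\<integral>\<^sup>+l. ?g l \<partial>count_space UNIV)"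
    by (rule nn_integral_bij_count_space)
  then show ?thesis unfolding nn_integral_walks by (simp add: path_weight_rev)
qed

text \<open>A is visited, and B is visited at or after the first visit to A: the order in which the
  strong Markov property at A can be applied.\<close>

fun hits_seq :: "'a set \<Rightarrow> 'a set \<Rightarrow> 'a list \<Rightarrow> bool" where
  "hits_seq A B [] = False"
| "hits_seq A B (x # l) = (if x \<in> A then set (x # l) \<inter> B \<noteq> {} else hits_seq A B l)"

lemma hits_seq_append:
  "set p \<inter> A \<noteq> {} \<Longrightarrow> set q \<inter> B \<noteq> {} \<Longrightarrow> hits_seq A B (p @ q)"
  by (induction p) auto

lemma hits_seq_append_mono: "hits_seq A B p \<Longrightarrow> hits_seq A B (p @ q)"
  by (induction p) (auto split: if_splits)

lemma hits_seq_middle: "b \<in> A \<Longrightarrow> b \<in> B \<Longrightarrow> hits_seq A B (p @ b # q)"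
  by (induction p) auto

text \<open>The first visit to A in the reversed word is the last one in \<open>l\<close>, which is
  not before the first visit to B in \<open>l\<close>.\<close>

lemma hits_seq_rev: "hits_seq B A l \<Longrightarrow> hits_seq A B (rev l)"
proof (induction l)
  case (Cons x l)
  show ?case
  proof (cases "x \<in> B")
    case True
    then have "x \<in> A \<or> set l \<inter> A \<noteq> {}" using Cons.prems by auto
    then show ?thesis
      using True hits_seq_append[of "rev l" A "[x]" B] hits_seq_middle[of x A B "rev l" "[]"] by auto
  next
    case False
    then show ?thesis using Cons hits_seq_append_mono[of A B "rev l" "[x]"] by auto
  qed
qed simp

lemma hits_seq_cases:
  "set l \<inter> A \<noteq> {} \<Longrightarrow> set l \<inter> B \<noteq> {} \<Longrightarrow> hits_seq A B l \<or> hits_seq B A l"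
  by (induction l) auto

lemma walk_hits:
  "(\<integral>\<^sup>+l. of_bool (set l \<inter> B \<noteq> {}) \<partial>walk n x) = ennreal (hitp B n x)"
proof (induction n arbitrary: x)
  case (Suc n)
  show ?case
  proof (cases "x \<in> B")
    case True
    then show ?thesis by simp
  next
    case False
    then have "(\<integral>\<^sup>+l. of_bool (set l \<inter> B \<noteq> {}) \<partial>walk (Suc n) x) = (\<integral>\<^sup>+y. ennreal (hitp B n y) \<partial>step x)"
      by (simp add: Suc)
    then show ?thesis using False by (simp add: nn_integral_step hitp_nonneg)
  qed
qed auto

text \<open>At the first visit to A the remaining walk has at most n steps and reaches B with
  probability at most \<phi>.\<close>

lemma walk_hits_seq:
  assumes "\<And>a k. a \<in> A \<Longrightarrow> k \<le> n \<Longrightarrow> hitp B k a \<le> \<phi>" "0 \<le> \<phi>"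
  shows "(\<integral>\<^sup>+l. of_bool (hits_seq A B l) \<partial>walk n x) \<le> ennreal (\<phi> * hitp A n x)"
  using assms(1)
proof (induction n arbitrary: x)
  case 0
  have "hitp B 0 x \<le> \<phi>" if "x \<in> A" using 0 that by blast
  then show ?case by auto
next
  case (Suc n)
  show ?case
  proof (cases "x \<in> A")
    case True
    have "(\<integral>\<^sup>+l. of_bool (hits_seq A B l) \<partial>walk (Suc n) x) = (\<integral>\<^sup>+l. of_bool (set l \<inter> B \<noteq> {}) \<partial>walk (Suc n) x)"
    proof (intro nn_integral_walk_cong)
      fix l :: "(int ^ 'a) list" assume "length l = Suc (Suc n)" "hd l = x"
      then obtain l' where "l = x # l'" by (cases l) auto
      then show "(of_bool (hits_seq A B l) :: ennreal) = of_bool (set l \<inter> B \<noteq> {})" using True by simp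
    qed
    then show ?thesis using True Suc.prems[of x "Suc n"] by (simp only: walk_hits) (simp add: ennreal_leI hitp_mem)
  next
    case False
    have "(\<integral>\<^sup>+l. of_bool (hits_seq A B l) \<partial>walk (Suc n) x)
       = (\<integral>\<^sup>+y. (\<integral>\<^sup>+l. of_bool (hits_seq A B l) \<partial>walk n y) \<partial>step x)"
      using False by simp
    also have "\<dots> \<le> (\<integral>\<^sup>+y. ennreal (\<phi> * hitp A n y) \<partial>step x)"
      using Suc.prems by (intro nn_integral_mono Suc.IH) auto
    also have "\<dots> = ennreal (avg (\<lambda>y. \<phi> * hitp A n y) x)"
      using assms(2) hitp_nonneg[of A n] by (intro nn_integral_step) auto
    also have "\<dots> = ennreal (\<phi> * hitp A (Suc n) x)" using False by (simp add: avg_cmult)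
    finally show ?thesis .
  qed
qed

text \<open>The factor \<open>srw (last l) z\<close> acts as one more step; in a loop it is the step
  that closes it.\<close>

lemma walk_last:
  "(\<integral>\<^sup>+l. ennreal (srw (last l) z) \<partial>walk m x) = ennreal (heat (Suc m) x z)"
proof (induction m arbitrary: x)
  case 0
  show ?case by (simp add: heat_1 del: heat.simps)
next
  case (Suc m)
  have "(\<integral>\<^sup>+l. ennreal (srw (last (x # l)) z) \<partial>walk m y) = (\<integral>\<^sup>+l. ennreal (srw (last l) z) \<partial>walk m y)" for y
    by (intro nn_integral_walk_cong) auto
  then have "(\<integral>\<^sup>+l. ennreal (srw (last l) z) \<partial>walk (Suc m) x) = (\<integral>\<^sup>+y. ennreal (heat (Suc m) y z) \<partial>step x)"
    using Suc by (simp del: heat.simps last.simps)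
  also have "\<dots> = ennreal (heat (Suc (Suc m)) x z)"
    by (subst nn_integral_step) (auto simp: heat_nonneg simp del: heat.simps simp: heat.simps(2)[of "Suc m"])
  finally show ?case .
qed

text \<open>Markov property at time n: the last m steps and the closing step are integrated out, at
  the cost of the supremum of the heat kernel at time m+1.\<close>

lemma walk_split:
  fixes f :: "(int ^ 'd) list \<Rightarrow> ennreal"
  assumes "\<And>u. heat (Suc m) u z \<le> M"
  shows "(\<integral>\<^sup>+l. f (take (Suc n) l) * ennreal (srw (last l) z) \<partial>walk (n + m) x)
      \<le> ennreal M * (\<integral>\<^sup>+l. f l \<partial>walk n x)"
proof (induction n arbitrary: x f)
  case 0
  have "(\<integral>\<^sup>+l. f (take (Suc 0) l) * ennreal (srw (last l) z) \<partial>walk m x)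
      = (\<integral>\<^sup>+l. f [x] * ennreal (srw (last l) z) \<partial>walk m x)"
  proof (intro nn_integral_walk_cong)
    fix l :: "(int ^ 'd) list" assume "length l = Suc m" "hd l = x"
    then show "f (take (Suc 0) l) * ennreal (srw (last l) z) = f [x] * ennreal (srw (last l) z)"
      by (cases l) auto
  qed
  also have "\<dots> = f [x] * ennreal (heat (Suc m) x z)"
    by (simp add: nn_integral_cmult walk_last del: heat.simps)
  also have "\<dots> \<le> f [x] * ennreal M" by (intro mult_left_mono ennreal_leI assms) auto
  finally show ?case by (simp add: mult.commute)
next
  case (Suc n)
  have "(\<integral>\<^sup>+l. f (take (Suc (Suc n)) l) * ennreal (srw (last l) z) \<partial>walk (Suc n + m) x)
      = (\<integral>\<^sup>+y. \<integral>\<^sup>+l. f (x # take (Suc n) l) * ennreal (srw (last (x # l)) z) \<partial>walk (n + m) y \<partial>step x)"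
    by (simp del: last.simps)
  also have "\<dots> = (\<integral>\<^sup>+y. \<integral>\<^sup>+l. f (x # take (Suc n) l) * ennreal (srw (last l) z) \<partial>walk (n + m) y \<partial>step x)"
    by (intro nn_integral_cong nn_integral_walk_cong) auto
  also have "\<dots> \<le> (\<integral>\<^sup>+y. ennreal M * (\<integral>\<^sup>+l. f (x # l) \<partial>walk n y) \<partial>step x)"
    by (intro nn_integral_mono Suc.IH[where f="\<lambda>l. f (x # l)"])
  also have "\<dots> = ennreal M * (\<integral>\<^sup>+l. f l \<partial>walk (Suc n) x)"
    by (simp add: nn_integral_cmult)
  finally show ?case .
qed

section \<open>Cyclic words and their rotations\<close>

definition cyc_weight :: "(int ^ 'd) list \<Rightarrow> real" where
  "cyc_weight l = path_weight l * srw (last l) (hd l)"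

lemma cyc_weight_nonneg: "0 \<le> cyc_weight l"
  by (simp add: cyc_weight_def path_weight_nonneg srw_nonneg)

lemma cyc_weight_rotate1: "cyc_weight (rotate1 l) = cyc_weight l"
proof (cases l)
  case (Cons x l')
  then show ?thesis
    by (cases l') (auto simp: cyc_weight_def path_weight_snoc[of "_ # _", simplified] mult_ac)
qed simp

lemma cyc_weight_rotate: "cyc_weight (rotate k l) = cyc_weight l"
  by (induction k) (auto simp: cyc_weight_rotate1)

lemma path_weight_eq_prod: "l \<noteq> [] \<Longrightarrow> path_weight l = (\<Prod>i<length l - 1. srw (l ! i) (l ! Suc i))"
  by (induction l rule: path_weight.induct) (auto simp: prod.lessThan_Suc_shift simp del: prod.lessThan_Suc)

lemma based_loop_weight_eq:
  assumes "l \<noteq> []"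
  shows "based_loop_weight l = cyc_weight l / real (length l)"
proof -
  obtain n where n: "length l = Suc n" using assms by (cases l) auto
  have "(\<Prod>i<Suc n. srw (l ! i) (l ! (Suc i mod Suc n))) = (\<Prod>i<n. srw (l ! i) (l ! Suc i)) * srw (l ! n) (l ! 0)"
  proof -
    have "(\<Prod>i<n. srw (l ! i) (l ! (Suc i mod Suc n))) = (\<Prod>i<n. srw (l ! i) (l ! Suc i))"
      by (intro prod.cong) auto
    then show ?thesis by (simp only: prod.lessThan_Suc) simp
  qed
  then show ?thesis
    using assms by (simp add: based_loop_weight_def cyc_weight_def path_weight_eq_prod n last_conv_nth hd_conv_nth)
qed

text \<open>Cutting a cyclic word into three blocks, at least one block avoids any two given positions;
  rotate that block to the end.\<close>

lemma rotate_avoiding_block: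
  assumes t: "length l = t" and hits: "set l \<inter> A \<noteq> {}" "set l \<inter> B \<noteq> {}"
  defines "m \<equiv> t div 3"
  shows "\<exists>c<3. set (take (t - m) (rotate (Suc c * m) l)) \<inter> A \<noteq> {} \<and> set (take (t - m) (rotate (Suc c * m) l)) \<inter> B \<noteq> {}"
proof -
  have m3: "3 * m \<le> t" by (simp add: m_def)
  obtain i j where ij: "i < t" "l ! i \<in> A" "j < t" "l ! j \<in> B"
    using hits t by (auto simp: in_set_conv_nth disjoint_iff)
  define P where "P c i \<longleftrightarrow> c * m \<le> i \<and> i < Suc c * m" for c i
  have P1: "\<not> (P c i \<and> P c' i)" if "c < c'" for c c' i
  proof
    assume "P c i \<and> P c' i"
    then have "c' * m < Suc c * m" by (auto simp: P_def)
    then show False using that by (metis Suc_leI leD mult_le_mono1)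
  qed
  \<comment> \<open>Two positions occupy at most two of the three disjoint blocks.\<close>
  have "\<exists>c<3. \<not> P c i \<and> \<not> P c j"
  proof (rule ccontr)
    assume "\<not> ?thesis"
    then have "P 0 i \<or> P 0 j" "P 1 i \<or> P 1 j" "P 2 i \<or> P 2 j" by auto
    then show False using P1[of 0 1] P1[of 0 2] P1[of 1 2] by auto
  qed
  then obtain c where c: "c < 3" "\<not> P c i" "\<not> P c j" by auto
  have "Suc c * m \<le> 3 * m" using c by (intro mult_le_mono1) auto
  then have cm: "Suc c * m \<le> t" using m3 by (rule order.trans)
  have key: "l ! i \<in> set (take (t - m) (rotate (Suc c * m) l))" if "i < t" "\<not> P c i" for i
  proof -
    \<comment> \<open>Rotating by \<open>Suc c * m\<close> moves block c to the end;
      \<open>a\<close> is the new position of index i, which falls among the first t-m because i is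
      not in block c.\<close>
    define a where "a = (if i < c * m then i + t - Suc c * m else i - Suc c * m)"
    have "a < t - m \<and> (Suc c * m + a) mod t = i"
    proof (cases "i < c * m")
      case True
      then have "Suc c * m + a = i + t" using cm by (simp add: a_def)
      moreover have "a < t - m" using True cm by (auto simp: a_def)
      ultimately show ?thesis using that by simp
    next
      case False
      then have "Suc c * m \<le> i" using that by (auto simp: P_def)
      then show ?thesis using that False by (auto simp: a_def)
    qed
    then have a: "a < t - m" "(Suc c * m + a) mod t = i" by auto
    have "take (t - m) (rotate (Suc c * m) l) ! a = rotate (Suc c * m) l ! a" using a by simp
    also have "\<dots> = l ! i" using a t by (subst nth_rotate) auto
    finally show ?thesis using a t by (metis diff_le_self length_rotate length_take min_absorb2 nth_mem)
  qed
  show ?thesis using key[of i] key[of j] ij c by (intro exI[of _ c]) auto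
qed

lemma nn_integral_rotate:
  fixes g :: "(int ^ 'd) list \<Rightarrow> ennreal"
  shows "(\<integral>\<^sup>+l. g (rotate k l) \<partial>count_space UNIV) = (\<integral>\<^sup>+l. g l \<partial>count_space UNIV)"
proof (induction k arbitrary: g)
  case (Suc k)
  have "(\<integral>\<^sup>+l. g (rotate1 l) \<partial>count_space UNIV) = (\<integral>\<^sup>+l. g l \<partial>count_space UNIV)"
    by (rule nn_integral_bij_count_space[OF bij_rotate1])
  with Suc[of "\<lambda>l. g (rotate1 l)"] show ?case by simp
qed simp

definition hits_both :: "'a set \<Rightarrow> 'a set \<Rightarrow> 'a list \<Rightarrow> bool" where
  "hits_both A B l \<longleftrightarrow> set l \<inter> A \<noteq> {} \<and> set l \<inter> B \<noteq> {}"

text \<open>The factor 6 counts three blocks that may be discarded and two orders of visiting the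
  sets. Once the last m letters and the closing step are integrated out the path is free, and
  summing over its starting point permits the time reversal that reduces both orders to A
  first.\<close>

lemma cyc_weight_hits_both_le:
  fixes A B :: "(int ^ 'd) set"
  assumes t: "t \<ge> 1"
    and M: "\<And>u z :: int ^ 'd. heat (Suc (t div 3)) u z \<le> M" "0 \<le> M"
    and \<phi>: "\<And>a k. a \<in> A \<Longrightarrow> k \<le> t \<Longrightarrow> hitp B k a \<le> \<phi>" "0 \<le> \<phi>"
  shows "(\<integral>\<^sup>+l. ennreal (cyc_weight l) * of_bool (length l = t \<and> hits_both A B l) \<partial>count_space UNIV)
     \<le> ennreal (6 * M * \<phi>) * (\<integral>\<^sup>+x. ennreal (hitp A t x) \<partial>count_space UNIV)"
proof -
  define m where "m = t div 3"
  \<comment> \<open>A word of t letters is a walk of n+m steps together with a closing step; its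
    first t-m letters account for n of these steps.\<close>
  define n where "n = t - m - 1"
  have tn: "t - m = Suc n" "t = Suc (n + m)" using t by (auto simp: n_def m_def)
  let ?H = "hits_both A B"
  let ?g = "\<lambda>l. ennreal (cyc_weight l) * of_bool (length l = t \<and> ?H (take (Suc n) l))"
  have "(\<integral>\<^sup>+l. ennreal (cyc_weight l) * of_bool (length l = t \<and> ?H l) \<partial>count_space UNIV)
     \<le> (\<integral>\<^sup>+l. (\<Sum>c<3. ?g (rotate (Suc c * m) l)) \<partial>count_space UNIV)"
  proof (intro nn_integral_mono)
    fix l :: "(int ^ 'd) list"
    show "ennreal (cyc_weight l) * of_bool (length l = t \<and> ?H l) \<le> (\<Sum>c<3. ?g (rotate (Suc c * m) l))"
    proof (cases "length l = t \<and> ?H l")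
      case True
      then obtain c where c: "c < 3" "?H (take (Suc n) (rotate (Suc c * m) l))"
        using rotate_avoiding_block[of l t A B] by (auto simp: hits_both_def m_def[symmetric] tn(1))
      then have "ennreal (cyc_weight l) * of_bool (length l = t \<and> ?H l) = ?g (rotate (Suc c * m) l)"
        using True by (simp add: cyc_weight_rotate del: mult_Suc)
      also have "\<dots> \<le> (\<Sum>c<3. ?g (rotate (Suc c * m) l))"
        using c by (intro member_le_sum) auto
      finally show ?thesis .
    next
      case False
      then have "(of_bool (length l = t \<and> ?H l) :: ennreal) = 0" by auto
      then show ?thesis by (simp only: mult_zero_right zero_le)
    qed
  qed
  also have "\<dots> = (\<Sum>c<(3::nat). \<integral>\<^sup>+l. ?g l \<partial>count_space UNIV)"
    by (subst nn_integral_sum) (simp, subst nn_integral_rotate[of ?g], simp)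
  also have "\<dots> = 3 * (\<integral>\<^sup>+l. ?g l \<partial>count_space UNIV)" by simp
  also have "(\<integral>\<^sup>+l. ?g l \<partial>count_space UNIV) \<le> ennreal (2 * M * \<phi>) * (\<integral>\<^sup>+x. ennreal (hitp A t x) \<partial>count_space UNIV)"
  proof -
    have "(\<integral>\<^sup>+l. ?g l \<partial>count_space UNIV)
      = (\<integral>\<^sup>+l. ennreal (path_weight l) * ((of_bool (?H (take (Suc n) l)) * ennreal (srw (last l) (hd l))) * of_bool (length l = Suc (n + m))) \<partial>count_space UNIV)"
      by (intro nn_integral_cong) (auto simp: cyc_weight_def tn(2) ennreal_mult path_weight_nonneg srw_nonneg)
    also have "\<dots> = (\<integral>\<^sup>+x. \<integral>\<^sup>+l. of_bool (?H (take (Suc n) l)) * ennreal (srw (last l) x) \<partial>walk (n + m) x \<partial>count_space UNIV)"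
      by (rule nn_integral_walks[symmetric])
    also have "\<dots> \<le> (\<integral>\<^sup>+x. ennreal M * (\<integral>\<^sup>+l. of_bool (?H l) \<partial>walk n x) \<partial>count_space UNIV)"
      by (intro nn_integral_mono walk_split[where f="\<lambda>l. of_bool (?H l)"]) (simp only: m_def M)
    also have "\<dots> \<le> (\<integral>\<^sup>+x. ennreal M * ((\<integral>\<^sup>+l. of_bool (hits_seq A B l) \<partial>walk n x) + (\<integral>\<^sup>+l. of_bool (hits_seq A B (rev l)) \<partial>walk n x)) \<partial>count_space UNIV)"
    proof (intro nn_integral_mono mult_left_mono)
      fix x :: "int ^ 'd"
      have "(\<integral>\<^sup>+l. of_bool (?H l) \<partial>walk n x) \<le> (\<integral>\<^sup>+l. of_bool (hits_seq A B l) + of_bool (hits_seq A B (rev l)) \<partial>walk n x)"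
        using hits_seq_cases[of _ A B] hits_seq_rev[of B A]
        by (intro nn_integral_mono) (fastforce simp: hits_both_def)
      then show "(\<integral>\<^sup>+l. of_bool (?H l) \<partial>walk n x) \<le> (\<integral>\<^sup>+l. of_bool (hits_seq A B l) \<partial>walk n x) + (\<integral>\<^sup>+l. of_bool (hits_seq A B (rev l)) \<partial>walk n x)"
        by (simp add: nn_integral_add)
    qed auto
    also have "\<dots> = ennreal M * ((\<integral>\<^sup>+x. \<integral>\<^sup>+l. of_bool (hits_seq A B l) \<partial>walk n x \<partial>count_space UNIV) + (\<integral>\<^sup>+x. \<integral>\<^sup>+l. of_bool (hits_seq A B (rev l)) \<partial>walk n x \<partial>count_space UNIV))"
      by (simp add: nn_integral_cmult nn_integral_add)
    also have "\<dots> = ennreal (2 * M) * (\<integral>\<^sup>+x. \<integral>\<^sup>+l. of_bool (hits_seq A B l) \<partial>walk n x \<partial>count_space UNIV)"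
      unfolding nn_integral_walks_rev[where f="\<lambda>l. of_bool (hits_seq A B l)"] mult_2[symmetric]
      using M by (simp add: ennreal_mult mult_ac)
    also have "\<dots> \<le> ennreal (2 * M) * (\<integral>\<^sup>+x. ennreal (\<phi> * hitp A t x) \<partial>count_space UNIV)"
    proof (intro mult_left_mono nn_integral_mono)
      fix x :: "int ^ 'd"
      have "(\<integral>\<^sup>+l. of_bool (hits_seq A B l) \<partial>walk n x) \<le> ennreal (\<phi> * hitp A n x)"
        using \<phi> tn by (intro walk_hits_seq) auto
      also have "\<dots> \<le> ennreal (\<phi> * hitp A t x)"
        using \<phi> tn by (intro ennreal_leI mult_left_mono hitp_mono_time) auto
      finally show "(\<integral>\<^sup>+l. of_bool (hits_seq A B l) \<partial>walk n x) \<le> ennreal (\<phi> * hitp A t x)" .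
    qed auto
    also have "\<dots> = ennreal (2 * M * \<phi>) * (\<integral>\<^sup>+x. ennreal (hitp A t x) \<partial>count_space UNIV)"
      using M \<phi> by (simp add: ennreal_mult hitp_nonneg nn_integral_cmult mult_ac)
    finally show ?thesis .
  qed
  then have "3 * (\<integral>\<^sup>+l. ?g l \<partial>count_space UNIV) \<le> 3 * (ennreal (2 * M * \<phi>) * (\<integral>\<^sup>+x. ennreal (hitp A t x) \<partial>count_space UNIV))"
    by (intro mult_left_mono) auto
  also have "\<dots> = ennreal (6 * M * \<phi>) * (\<integral>\<^sup>+x. ennreal (hitp A t x) \<partial>count_space UNIV)"
  proof -
    have "ennreal (6 * M * \<phi>) = 3 * ennreal (2 * M * \<phi>)"
      using M \<phi> ennreal_mult[of 3 "2 * M * \<phi>"] by (simp add: mult.assoc)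
    then show ?thesis by (simp add: mult.assoc)
  qed
  finally show ?thesis .
qed

section \<open>The loop measure of loops crossing an annulus\<close>

definition loops_hitting :: "(int ^ 'd) set \<Rightarrow> (int ^ 'd) set \<Rightarrow> (int ^ 'd) list set set" where
  "loops_hitting A B = {L\<in>loops. \<exists>l\<in>L. hits_both A B l}"

text \<open>Circular permutation preserves the set of visited points, so what a loop hits can be
  read off any representative.\<close>

lemma loop_class_set:
  assumes "L \<in> loops" "l \<in> L" "l' \<in> L"
  shows "set l = set l'"
proof -
  obtain l0 where "L = loop_rel `` {l0}" using assms(1) by (auto simp: loops_def quotient_def)
  then have "set l = set l0" "set l' = set l0" using assms by (auto simp: loop_rel_def)
  then show ?thesis by simp
qed

lemma emeasure_loops_hitting:
  fixes A B :: "(int ^ 'd) set"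
  shows "emeasure loop_measure (loops_hitting A B)
    = (\<integral>\<^sup>+l. ennreal (based_loop_weight l) * of_bool (hits_both A B l) \<partial>count_space based_loops)"
proof -
  let ?p = "\<lambda>l :: (int ^ 'd) list. loop_rel `` {l}"
  have meas: "?p \<in> measurable based_loop_measure (count_space loops)"
    by (auto simp: based_loop_measure_def loops_def space_point_measure quotientI)
  have vim: "?p -` loops_hitting A B \<inter> based_loops = {l\<in>based_loops. hits_both A B l}"
  proof (intro equalityI subsetI)
    fix l :: "(int ^ 'd) list" assume "l \<in> ?p -` loops_hitting A B \<inter> based_loops"
    then obtain l' where "l \<in> based_loops" "l' \<in> ?p l" "hits_both A B l'" by (auto simp: loops_hitting_def)
    moreover from this have "set l' = set l" by (auto simp: loop_rel_def)
    ultimately show "l \<in> {l\<in>based_loops. hits_both A B l}" by (auto simp: hits_both_def)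
  next
    fix l :: "(int ^ 'd) list" assume l: "l \<in> {l\<in>based_loops. hits_both A B l}"
    then have "l \<in> ?p l" by (auto simp: loop_rel_def intro: exI[of _ 0])
    then show "l \<in> ?p -` loops_hitting A B \<inter> based_loops"
      using l by (auto simp: loops_hitting_def loops_def quotientI)
  qed
  have "emeasure loop_measure (loops_hitting A B) = emeasure based_loop_measure {l\<in>based_loops. hits_both A B l}"
    unfolding loop_measure_def using meas vim
    by (subst emeasure_distr) (auto simp: loops_hitting_def based_loop_measure_def space_point_measure)
  also have "\<dots> = (\<integral>\<^sup>+l. ennreal (based_loop_weight l) * indicator {l\<in>based_loops. hits_both A B l} l \<partial>count_space based_loops)"
    unfolding based_loop_measure_def point_measure_def by (subst emeasure_density) auto
  also have "\<dots> = (\<integral>\<^sup>+l. ennreal (based_loop_weight l) * of_bool (hits_both A B l) \<partial>count_space based_loops)"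
    by (intro nn_integral_cong) auto
  finally show ?thesis .
qed

text \<open>The factor 6 is that of \<open>cyc_weight_hits_both_le\<close>; the 3 under the root
  comes from using the heat kernel at a time of order t/3 instead of t.\<close>

definition loop_const :: "nat \<Rightarrow> real" where
  "loop_const d = 6 * sqrt (3 * real d) ^ d * sausage_const d"

lemma loop_const_nonneg: "1 \<le> d \<Longrightarrow> 0 \<le> loop_const d"
  by (auto simp: loop_const_def sausage_const_def intro!: mult_nonneg_nonneg ln_ge_zero)

text \<open>Decomposition by the length t of the loop. The bound \<phi> depends on t so that short
  loops, which hardly travel, can be charged less; one factor 1/t is the normalisation in the based
  loop measure.\<close>

lemma emeasure_loops_hitting_le:
  fixes a :: "int ^ 'd"
  assumes d: "CARD('d) \<ge> 2" and n: "n \<ge> 1"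
    and \<phi>: "\<And>x k t. x \<in> lattice_box a n \<Longrightarrow> k \<le> t \<Longrightarrow> hitp B k x \<le> \<phi> t" "\<And>t. 0 \<le> \<phi> t"
  shows "emeasure loop_measure (loops_hitting (lattice_box a n) B)
    \<le> (\<Sum>t. ennreal (loop_const CARD('d) * real n ^ (CARD('d) - 2) * (\<phi> t * (real t + (real n)\<^sup>2) / (real t * sqrt (real t) ^ CARD('d)))))"
proof -
  let ?A = "lattice_box a n" and ?D = "CARD('d)"
  let ?f = "\<lambda>t l. ennreal (1 / real t) * (ennreal (cyc_weight l) * of_bool (length l = t \<and> hits_both ?A B l))"
  have "emeasure loop_measure (loops_hitting ?A B)
     = (\<integral>\<^sup>+l. ennreal (based_loop_weight l) * of_bool (hits_both ?A B l) * indicator based_loops l \<partial>count_space UNIV)"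
    unfolding emeasure_loops_hitting by (subst nn_integral_count_space_indicator) auto
  also have "\<dots> \<le> (\<integral>\<^sup>+l. (\<Sum>t. ?f t l) \<partial>count_space UNIV)"
  proof (intro nn_integral_mono)
    fix l :: "(int ^ 'd) list"
    have "ennreal (based_loop_weight l) * of_bool (hits_both ?A B l) * indicator based_loops l \<le> ?f (length l) l"
    proof (cases "l \<in> based_loops")
      case True
      then have "l \<noteq> []" by (auto simp: based_loops_def)
      then have "based_loop_weight l = (1 / real (length l)) * cyc_weight l" by (simp add: based_loop_weight_eq)
      then show ?thesis
        using True \<open>l \<noteq> []\<close> by (simp add: cyc_weight_nonneg mult.assoc flip: ennreal_mult)
    qed auto
    also have "\<dots> \<le> (\<Sum>t. ?f t l)"
      using sum_le_suminf[of "\<lambda>t. ?f t l" "{length l}"] by simp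
    finally show "ennreal (based_loop_weight l) * of_bool (hits_both ?A B l) * indicator based_loops l \<le> (\<Sum>t. ?f t l)" .
  qed
  also have "\<dots> = (\<Sum>t. \<integral>\<^sup>+l. ?f t l \<partial>count_space UNIV)"
    by (rule nn_integral_suminf) auto
  also have "\<dots> \<le> (\<Sum>t. ennreal (loop_const ?D * real n ^ (?D - 2) * (\<phi> t * (real t + (real n)\<^sup>2) / (real t * sqrt (real t) ^ ?D))))"
  proof (intro suminf_le summableI)
    fix t :: nat
    show "(\<integral>\<^sup>+l. ?f t l \<partial>count_space UNIV) \<le> ennreal (loop_const ?D * real n ^ (?D - 2) * (\<phi> t * (real t + (real n)\<^sup>2) / (real t * sqrt (real t) ^ ?D)))"
    \<comment> \<open>For t = 0 the weight 1/t is 0 by convention, so the integral vanishes.\<close>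
    proof (cases "t = 0")
      case False
      define M where "M = (sqrt (3 * real ?D) / sqrt (real t)) ^ ?D"
      have M: "heat (Suc (t div 3)) u z \<le> M" for u z :: "int ^ 'd"
      proof -
        have "t \<le> 3 * (Suc (t div 3) + 1)" by presburger
        then have "real t \<le> real (3 * (Suc (t div 3) + 1))" by (simp only: of_nat_le_iff)
        then have "real t \<le> 3 * (real (Suc (t div 3)) + 1)" by simp
        then have "real ?D / (real (Suc (t div 3)) + 1) \<le> 3 * real ?D / real t"
        proof -
          have "real ?D / (real (Suc (t div 3)) + 1) \<le> real ?D / (real t / 3)"
            using False \<open>real t \<le> 3 * _\<close> by (intro divide_left_mono) auto
          then show ?thesis by (simp add: mult.commute)
        qed
        then have "sqrt (real ?D / (real (Suc (t div 3)) + 1)) \<le> sqrt (3 * real ?D) / sqrt (real t)"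
          by (simp flip: real_sqrt_divide)
        then have "sqrt (real ?D / (real (Suc (t div 3)) + 1)) ^ ?D \<le> M"
          unfolding M_def by (intro power_mono) auto
        then show ?thesis by (rule order.trans[OF heat_le])
      qed
      have M0: "0 \<le> M" by (simp add: M_def)
      have S0: "0 \<le> sausage_const ?D"
        using d by (auto simp: sausage_const_def intro!: mult_nonneg_nonneg ln_ge_zero)
      have "(\<integral>\<^sup>+l. ?f t l \<partial>count_space UNIV)
         = ennreal (1 / real t) * (\<integral>\<^sup>+l. ennreal (cyc_weight l) * of_bool (length l = t \<and> hits_both ?A B l) \<partial>count_space UNIV)"
        by (rule nn_integral_cmult) auto
      also have "\<dots> \<le> ennreal (1 / real t) * (ennreal (6 * M * \<phi> t) * (\<integral>\<^sup>+x. ennreal (hitp ?A t x) \<partial>count_space UNIV))"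
        using False by (intro mult_left_mono cyc_weight_hits_both_le M M0 \<phi>) auto
      also have "\<dots> \<le> ennreal (1 / real t) * (ennreal (6 * M * \<phi> t) * ennreal (sausage_const ?D * (real t + (real n)\<^sup>2) * real n ^ (?D - 2)))"
        by (intro mult_left_mono sausage_bound d n) auto
      also have "\<dots> = ennreal ((1 / real t) * ((6 * M * \<phi> t) * (sausage_const ?D * (real t + (real n)\<^sup>2) * real n ^ (?D - 2))))"
      proof -
        have "0 \<le> 6 * M * \<phi> t" using M0 \<phi>(2)[of t] by simp
        moreover have "0 \<le> 1 / real t" by simp
        ultimately show ?thesis by (simp only: ennreal_mult')
      qed
      also have "(1 / real t) * ((6 * M * \<phi> t) * (sausage_const ?D * (real t + (real n)\<^sup>2) * real n ^ (?D - 2)))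
         = loop_const ?D * real n ^ (?D - 2) * (\<phi> t * (real t + (real n)\<^sup>2) / (real t * sqrt (real t) ^ ?D))"
        by (simp add: loop_const_def M_def power_divide)
      finally show ?thesis .
    qed simp
  qed
  finally show ?thesis .
qed

text \<open>Telescoping: t^(-3/2) <= 2/sqrt(t-1) - 2/sqrt(t) for t >= 2.\<close>

lemma sum_inverse_three_halves:
  assumes "T \<ge> 1"
  shows "(\<Sum>t<N. of_bool (T < t) / sqrt (real t) ^ 3) \<le> 2 / sqrt (real T)"
proof -
  have step: "1 / sqrt (real t) ^ 3 \<le> 2 / sqrt (real t - 1) - 2 / sqrt (real t)" if "t \<ge> 2" for t :: nat
  proof -
    define a b where "a = sqrt (real t)" and "b = sqrt (real t - 1)"
    have ab: "0 < b" "b \<le> a" "a * a = real t" "b * b = real t - 1" using that by (auto simp: a_def b_def)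
    have "(a - b) * (a + b) = 1" using ab by (simp add: algebra_simps)
    then have "a - b = 1 / (a + b)" using ab by (simp add: field_simps)
    also have "\<dots> \<ge> 1 / (2 * a)" using ab by (intro divide_left_mono) auto
    finally have 1: "1 / (2 * a) \<le> a - b" .
    have "1 / a ^ 3 = 2 * (1 / (2 * a)) / (a * a)" by (simp add: power3_eq_cube)
    also have "\<dots> \<le> 2 * (a - b) / (a * a)" using 1 by (intro divide_right_mono mult_left_mono) auto
    also have "\<dots> \<le> 2 * (a - b) / (a * b)" using ab by (intro divide_left_mono mult_left_mono mult_pos_pos) auto
    also have "\<dots> = 2 / b - 2 / a" using ab by (simp add: field_simps)
    finally show ?thesis by (simp add: a_def b_def)
  qed
  have "(\<Sum>t<Suc N. of_bool (T < t) / sqrt (real t) ^ 3) \<le> 2 / sqrt (real T) - 2 / sqrt (real (max T N))" for N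
  proof (induction N)
    case (Suc N)
    show ?case
    proof (cases "T < Suc N")
      case True
      then have "1 / sqrt (real (Suc N)) ^ 3 \<le> 2 / sqrt (real N) - 2 / sqrt (real (Suc N))"
        using step[of "Suc N"] assms by simp
      then show ?thesis using Suc True by (simp add: max_def)
    next
      case False
      then show ?thesis using Suc by (simp add: max_def)
    qed
  qed simp
  from this[of N] have "(\<Sum>t<Suc N. of_bool (T < t) / sqrt (real t) ^ 3) \<le> 2 / sqrt (real T)"
    by (rule order.trans) simp
  moreover have "(\<Sum>t<N. of_bool (T < t) / sqrt (real t) ^ 3) \<le> (\<Sum>t<Suc N. of_bool (T < t) / sqrt (real t) ^ 3)"
    by (intro sum_mono2) auto
  ultimately show ?thesis by linarith
qed

lemma suminf_ennreal_le:
  assumes "\<And>N. (\<Sum>t<N. f t) \<le> c" "\<And>t. 0 \<le> f t"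
  shows "(\<Sum>t. ennreal (f t)) \<le> ennreal c"
  unfolding suminf_eq_SUP using assms by (intro SUP_least) (simp add: sum_ennreal ennreal_leI)

lemma exp_minus_le_power: "0 \<le> u \<Longrightarrow> exp (- u) * u ^ p \<le> fact p" for u :: real
proof -
  assume u: "0 \<le> u"
  have "u ^ p / fact p \<le> (\<Sum>n. u ^ n /\<^sub>R fact n)"
    using sum_le_suminf[OF summable_exp_generic[of u], of "{p}"] u by (simp add: divide_inverse mult.commute)
  then have "u ^ p / fact p \<le> exp u" by (simp add: exp_def)
  then show ?thesis by (simp add: exp_minus field_simps)
qed

text \<open>Taking \<phi> = 1 leaves a series dominated by the sum of t^(-3/2), which converges
  thanks to d >= 3. This crude bound serves the finitely many small boxes at which the
  renormalisation starts.\<close>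

lemma emeasure_loops_hitting_box:
  fixes a :: "int ^ 'd"
  assumes d: "CARD('d) \<ge> 3" and n: "n \<ge> 1"
  shows "emeasure loop_measure (loops_hitting (lattice_box a n) B)
    \<le> ennreal (3 * loop_const CARD('d) * real n ^ (CARD('d) - 2) * (1 + (real n)\<^sup>2))"
proof -
  let ?D = "CARD('d)"
  let ?c = "loop_const ?D * real n ^ (?D - 2)"
  have c0: "0 \<le> ?c" using loop_const_nonneg[of ?D] d by simp
  let ?g = "\<lambda>t. 1 * (real t + (real n)\<^sup>2) / (real t * sqrt (real t) ^ ?D)"
  have "emeasure loop_measure (loops_hitting (lattice_box a n) B) \<le> (\<Sum>t. ennreal (?c * ?g t))"
    using d n by (intro emeasure_loops_hitting_le hitp_le_1) auto
  also have "\<dots> \<le> ennreal (?c * (3 * (1 + (real n)\<^sup>2)))"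
  proof (rule suminf_ennreal_le)
    fix N
    have g: "?g t \<le> (1 + (real n)\<^sup>2) * (of_bool (t = 1) + of_bool (1 < t) / sqrt (real t) ^ 3)" for t
    proof (cases "t = 0")
      case False
      then have t: "real t \<ge> 1" by simp
      have "?g t \<le> (1 + (real n)\<^sup>2) * real t / (real t * sqrt (real t) ^ 3)"
      proof (intro frac_le mult_left_mono power_increasing)
        show "1 * (real t + (real n)\<^sup>2) \<le> (1 + (real n)\<^sup>2) * real t"
          using t mult_left_mono[of 1 "real t" "(real n)\<^sup>2"] by (simp add: algebra_simps)
      qed (use t d in auto)
      also have "\<dots> = (1 + (real n)\<^sup>2) * (1 / sqrt (real t) ^ 3)" using t by simp
      also have "\<dots> \<le> (1 + (real n)\<^sup>2) * (of_bool (t = 1) + of_bool (1 < t) / sqrt (real t) ^ 3)"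
        using False by (intro mult_left_mono) (cases "t = 1", auto)
      finally show ?thesis .
    qed simp
    have "(\<Sum>t<N. ?c * ?g t) \<le> (\<Sum>t<N. ?c * ((1 + (real n)\<^sup>2) * (of_bool (t = 1) + of_bool (1 < t) / sqrt (real t) ^ 3)))"
      using c0 g by (intro sum_mono mult_left_mono) auto
    also have "\<dots> = ?c * ((1 + (real n)\<^sup>2) * ((\<Sum>t<N. of_bool (t = 1)) + (\<Sum>t<N. of_bool (1 < t) / sqrt (real t) ^ 3)))"
      by (simp only: sum_distrib_left[symmetric] sum.distrib)
    also have "\<dots> \<le> ?c * ((1 + (real n)\<^sup>2) * (1 + 2))"
    proof (intro mult_left_mono add_mono c0)
      have "(\<Sum>t<N. of_bool (t = 1) :: real) = (\<Sum>t\<in>{..<N} \<inter> {1}. 1)"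
        by (intro sum.mono_neutral_cong_right) auto
      also have "\<dots> = real (card ({..<N} \<inter> {1}))" by simp
      also have "card ({..<N} \<inter> {1}) \<le> card {1 :: nat}" by (intro card_mono) auto
      finally show "(\<Sum>t<N. of_bool (t = 1) :: real) \<le> 1" by simp
      show "(\<Sum>t<N. of_bool (1 < t) / sqrt (real t) ^ 3) \<le> 2"
        using sum_inverse_three_halves[of 1 N] by simp
    qed simp
    finally show "(\<Sum>t<N. ?c * ?g t) \<le> ?c * (3 * (1 + (real n)\<^sup>2))" by (simp add: mult_ac)
  qed (use c0 in \<open>auto intro!: mult_nonneg_nonneg divide_nonneg_nonneg\<close>)
  finally show ?thesis by (simp only: mult_ac)
qed

text \<open>The term 8d comes from loops longer than r^2, the factorial term from shorter ones, and
  2^(d-2) from r = m - n >= m/2.\<close>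

definition annulus_const :: "nat \<Rightarrow> real" where
  "annulus_const d = loop_const d * (8 * real d + 4 * real d * (2 ^ (d + 2) * fact (d + 2))) * 2 ^ (d - 2)"

text \<open>Such a loop travels a distance r = m - n, so r^2 is its natural length. Up to r^2 the
  Gaussian factor beats the powers of t, and r^2 terms of order r^(-d) remain; beyond r^2 it is
  dropped and the tail of t^(-d/2) is summed. Both parts are of order r^(-(d-2)).\<close>

lemma emeasure_loops_crossing:
  fixes a :: "int ^ 'd"
  assumes d: "CARD('d) \<ge> 3" and n: "n \<ge> 1" and m: "m \<ge> 2 * n"
  shows "emeasure loop_measure (loops_hitting (lattice_box a n) {y. \<exists>i. int m \<le> \<bar>y $ i - a $ i\<bar>})
    \<le> ennreal (annulus_const CARD('d) * (real n / real m) ^ (CARD('d) - 2))"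
proof -
  let ?D = "CARD('d)"
  let ?B = "{y. \<exists>i. int m \<le> \<bar>y $ i - a $ i\<bar>}"
  let ?c = "loop_const ?D * real n ^ (?D - 2)"
  have c0: "0 \<le> ?c" using loop_const_nonneg[of ?D] d by simp
  define r where "r = m - n"
  have r: "n \<le> r" "r \<ge> 1" "real m / 2 \<le> real r" using m n by (auto simp: r_def of_nat_diff)
  define C where "C = (2 ^ (?D + 2) * fact (?D + 2) :: real)"
  define \<phi> where "\<phi> t = 2 * real ?D * exp (- (real r)\<^sup>2 / (2 * real t))" for t
  let ?g = "\<lambda>t. \<phi> t * (real t + (real n)\<^sup>2) / (real t * sqrt (real t) ^ ?D)"
  have \<phi>0: "0 \<le> \<phi> t" for t by (simp add: \<phi>_def)
  have "emeasure loop_measure (loops_hitting (lattice_box a n) ?B) \<le> (\<Sum>t. ennreal (?c * ?g t))"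
  proof (rule emeasure_loops_hitting_le)
    fix x :: "int ^ 'd" and k t :: nat assume x: "x \<in> lattice_box a n" and k: "k \<le> t"
    have "hitp ?B k x \<le> hitp ?B t x" using k by (rule hitp_mono_time)
    also have "\<dots> \<le> \<phi> t" unfolding \<phi>_def
    proof (rule hitp_exit)
      fix y assume "y \<in> ?B"
      then obtain i where i: "int m \<le> \<bar>y $ i - a $ i\<bar>" by auto
      have "\<bar>x $ i - a $ i\<bar> \<le> int n" using x by (auto simp: lattice_box_def)
      then have "int r \<le> \<bar>y $ i - x $ i\<bar>" using i m by (simp add: r_def of_nat_diff)
      then show "\<exists>i. int r \<le> \<bar>y $ i - x $ i\<bar>" ..
    qed
    finally show "hitp ?B k x \<le> \<phi> t" .
  qed (use d n \<phi>0 in auto)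
  also have "\<dots> \<le> ennreal (?c * ((8 * real ?D + 4 * real ?D * C) / real r ^ (?D - 2)))"
  proof (rule suminf_ennreal_le)
    fix N
    let ?T = "r\<^sup>2"
    have T: "sqrt (real ?T) = real r" by simp
    have nr: "(real n)\<^sup>2 \<le> (real r)\<^sup>2" using r by (intro power_mono) auto
    have r0: "real r > 0" using r by simp
    have g: "?g t \<le> 4 * real ?D * C / real r ^ ?D * of_bool (t \<in> {1..?T}) + 4 * real ?D / real r ^ (?D - 3) * (of_bool (?T < t) / sqrt (real t) ^ 3)" for t
    proof -
      consider "t = 0" | "1 \<le> t" "t \<le> ?T" | "?T < t" by linarith
      then show ?thesis
      proof cases
        case 2
        define s where "s = sqrt (real t)"
        have s: "s > 0" "s * s = real t" using 2 by (auto simp: s_def)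
        have tr: "real t \<le> (real r)\<^sup>2" using 2 by (metis of_nat_le_iff of_nat_power)
        have sr: "s \<le> real r" unfolding s_def using tr r0 by (intro real_le_lsqrt) auto
        define v where "v = real r / s"
        have v: "v \<ge> 1" using sr s by (simp add: v_def)
        \<comment> \<open>Since v >= 1 the power may be doubled, which makes it a power of v^2/2,
          the quantity in the exponential.\<close>
        have "v ^ (?D + 2) \<le> v ^ (2 * (?D + 2))" using v by (intro power_increasing) auto
        also have "\<dots> = 2 ^ (?D + 2) * (v\<^sup>2 / 2) ^ (?D + 2)" unfolding power_mult by (simp add: power_divide)
        finally have "exp (- (v\<^sup>2 / 2)) * v ^ (?D + 2) \<le> exp (- (v\<^sup>2 / 2)) * (2 ^ (?D + 2) * (v\<^sup>2 / 2) ^ (?D + 2))"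
          by (intro mult_left_mono) auto
        also have "\<dots> = 2 ^ (?D + 2) * (exp (- (v\<^sup>2 / 2)) * (v\<^sup>2 / 2) ^ (?D + 2))" by simp
        also have "\<dots> \<le> C" unfolding C_def by (intro mult_left_mono exp_minus_le_power) auto
        finally have "exp (- (v\<^sup>2 / 2)) \<le> C / v ^ (?D + 2)" using v by (subst pos_le_divide_eq) auto
        also have "\<dots> = C * s ^ (?D + 2) / real r ^ (?D + 2)" by (simp add: v_def power_divide)
        also have "- (v\<^sup>2 / 2) = - (real r)\<^sup>2 / (2 * real t)" using s by (simp add: v_def power_divide power2_eq_square field_simps)
        finally have e: "exp (- (real r)\<^sup>2 / (2 * real t)) \<le> C * s ^ (?D + 2) / real r ^ (?D + 2)" .
        have "?g t \<le> (2 * real ?D * (C * s ^ (?D + 2) / real r ^ (?D + 2))) * (2 * (real r)\<^sup>2) / (real t * s ^ ?D)"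
          unfolding \<phi>_def s_def[symmetric]
        proof (rule divide_right_mono[OF mult_mono])
          show "2 * real ?D * exp (- (real r)\<^sup>2 / (2 * real t)) \<le> 2 * real ?D * (C * s ^ (?D + 2) / real r ^ (?D + 2))"
            by (intro mult_left_mono e) auto
          show "real t + (real n)\<^sup>2 \<le> 2 * (real r)\<^sup>2" using tr nr by linarith
        qed (use s C_def in auto)
        also have "\<dots> = 4 * real ?D * C / real r ^ ?D"
          using s r0 by (simp add: s(2)[symmetric] power_add power2_eq_square field_simps)
        finally show ?thesis using 2 by simp
      next
        case 3
        have rt: "real r \<le> sqrt (real t)"
          using 3 by (intro real_le_rsqrt) (metis less_imp_le of_nat_le_iff of_nat_power)
        have rt2: "(real r)\<^sup>2 \<le> real t" using 3 by (metis less_imp_le of_nat_le_iff of_nat_power)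
        have t0: "real t > 0" using 3 by simp
        have "?g t \<le> (2 * real ?D * 1) * (2 * real t) / (real t * sqrt (real t) ^ ?D)"
          unfolding \<phi>_def
        proof (rule divide_right_mono[OF mult_mono])
          show "real t + (real n)\<^sup>2 \<le> 2 * real t" using nr rt2 by linarith
        qed auto
        also have "\<dots> = 4 * real ?D / sqrt (real t) ^ ?D" using t0 by simp
        also have "\<dots> = 4 * real ?D / (sqrt (real t) ^ (?D - 3) * sqrt (real t) ^ 3)"
          using d by (simp flip: power_add)
        also have "\<dots> \<le> 4 * real ?D / (real r ^ (?D - 3) * sqrt (real t) ^ 3)"
          using rt r0 t0 by (intro divide_left_mono mult_right_mono power_mono mult_pos_pos) auto
        finally show ?thesis using 3 by simp
      qed simp
    qed
    have "(\<Sum>t<N. ?c * ?g t) \<le> (\<Sum>t<N. ?c * (4 * real ?D * C / real r ^ ?D * of_bool (t \<in> {1..?T}) + 4 * real ?D / real r ^ (?D - 3) * (of_bool (?T < t) / sqrt (real t) ^ 3)))"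
      using c0 g by (intro sum_mono mult_left_mono) auto
    also have "\<dots> = ?c * (4 * real ?D * C / real r ^ ?D * (\<Sum>t<N. of_bool (t \<in> {1..?T})) + 4 * real ?D / real r ^ (?D - 3) * (\<Sum>t<N. of_bool (?T < t) / sqrt (real t) ^ 3))"
      by (simp only: sum_distrib_left[symmetric] sum.distrib)
    also have "\<dots> \<le> ?c * (4 * real ?D * C / real r ^ ?D * (real r)\<^sup>2 + 4 * real ?D / real r ^ (?D - 3) * (2 / real r))"
    proof (intro mult_left_mono add_mono c0)
      have "(\<Sum>t<N. of_bool (t \<in> {1..?T}) :: real) = (\<Sum>t\<in>{..<N} \<inter> {1..?T}. 1)"
        by (intro sum.mono_neutral_cong_right) auto
      also have "\<dots> = real (card ({..<N} \<inter> {1..?T}))" by simp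
      also have "\<dots> \<le> real (card {1..?T})" by (intro of_nat_mono card_mono) auto
      finally show "(\<Sum>t<N. of_bool (t \<in> {1..?T}) :: real) \<le> (real r)\<^sup>2" by simp
      show "(\<Sum>t<N. of_bool (?T < t) / sqrt (real t) ^ 3) \<le> 2 / real r"
        using sum_inverse_three_halves[of ?T N] r unfolding T by simp
    qed (auto simp: C_def)
    also have "\<dots> = ?c * ((8 * real ?D + 4 * real ?D * C) / real r ^ (?D - 2))"
    proof -
      have 1: "real r ^ ?D = real r ^ (?D - 2) * (real r)\<^sup>2" using d by (metis Suc_leD numeral_3_eq_3 numeral_2_eq_2 le_add_diff_inverse2 power_add)
      have "?D - 2 = Suc (?D - 3)" using d by simp
      then have 2: "real r ^ (?D - 2) = real r * real r ^ (?D - 3)" by simp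
      have "4 * real ?D * C / real r ^ ?D * (real r)\<^sup>2 = 4 * real ?D * C / real r ^ (?D - 2)"
        unfolding 1 using r0 by simp
      moreover have "4 * real ?D / real r ^ (?D - 3) * (2 / real r) = 8 * real ?D / real r ^ (?D - 2)"
        unfolding 2 using r0 by simp
      ultimately show ?thesis by (simp add: add_divide_distrib)
    qed
    finally show "(\<Sum>t<N. ?c * ?g t) \<le> ?c * ((8 * real ?D + 4 * real ?D * C) / real r ^ (?D - 2))" .
  qed (use c0 \<phi>0 in \<open>auto intro!: mult_nonneg_nonneg divide_nonneg_nonneg\<close>)
  also have "\<dots> \<le> ennreal (annulus_const ?D * (real n / real m) ^ (?D - 2))"
  proof (intro ennreal_leI)
    have m0: "real m > 0" using m n by simp
    have "(8 * real ?D + 4 * real ?D * C) / real r ^ (?D - 2) \<le> (8 * real ?D + 4 * real ?D * C) / (real m / 2) ^ (?D - 2)"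
      using r m0 by (intro divide_left_mono power_mono mult_pos_pos) (auto simp: C_def)
    then have "?c * ((8 * real ?D + 4 * real ?D * C) / real r ^ (?D - 2)) \<le> ?c * ((8 * real ?D + 4 * real ?D * C) / (real m / 2) ^ (?D - 2))"
      by (rule mult_left_mono[OF _ c0])
    also have "\<dots> = annulus_const ?D * (real n / real m) ^ (?D - 2)"
      by (simp add: annulus_const_def C_def power_divide)
    finally show "?c * ((8 * real ?D + 4 * real ?D * C) / real r ^ (?D - 2)) \<le> annulus_const ?D * (real n / real m) ^ (?D - 2)" .
  qed
  finally show ?thesis .
qed

section \<open>Probability estimates for the loop soup\<close>

definition soup_intensity :: "real \<Rightarrow> (int ^ 'd) list set measure" where
  "soup_intensity \<alpha> = scale_measure (ennreal \<alpha>) loop_measure"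

interpretation soup: countable_intensity "soup_intensity \<alpha> :: (int ^ 'd) list set measure" for \<alpha>
  unfolding soup_intensity_def by (rule countable_intensity_loops)

lemma space_soup_intensity: "space (soup_intensity \<alpha>) = loops"
  by (simp add: soup_intensity_def space_scale_measure loop_measure_def)

lemma loop_soup_eq: "loop_soup \<alpha> = poisson_process (soup_intensity \<alpha>)"
  by (simp add: loop_soup_def soup_intensity_def)

lemma prob_space_loop_soup: "prob_space (loop_soup \<alpha>)"
  unfolding loop_soup_eq by (rule soup.prob_space_P)

interpretation LS: prob_space "loop_soup \<alpha> :: ((int ^ 'd) list set \<Rightarrow> nat) measure" for \<alpha>
  by (rule prob_space_loop_soup)

lemma loop_component_measurable:
  "L \<in> loops \<Longrightarrow> (\<lambda>\<omega>. \<omega> L) \<in> measurable (loop_soup \<alpha>) (count_space UNIV)"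
  unfolding loop_soup_eq by (rule soup.component_measurable) (simp add: space_soup_intensity)

lemma countable_loops: "countable (loops :: (int ^ 'd) list set set)"
  using soup.countable_space by (simp add: space_soup_intensity)

text \<open>Stated over an arbitrary space because it is applied to the soup itself and to the
  product space of a single class of loops.\<close>

lemma exists_loop_measurable:
  assumes "S \<subseteq> loops" "\<And>L. L \<in> loops \<Longrightarrow> (\<lambda>\<omega>. g \<omega> L) \<in> measurable M (count_space (UNIV :: nat set))"
  shows "Measurable.pred M (\<lambda>\<omega>. \<exists>L\<in>S. 1 \<le> g \<omega> (L :: (int ^ 'd) list set))"
proof -
  have "countable S" using assms(1) countable_loops by (rule countable_subset)
  moreover have "Measurable.pred M (\<lambda>\<omega>. 1 \<le> g \<omega> L)" if "L \<in> S" for L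
    using measurable_compose[OF assms(2)[of L], of "\<lambda>n. 1 \<le> n" "count_space UNIV"] assms(1) that by auto
  ultimately show ?thesis by measurable
qed

text \<open>The number of loops in S is Poisson with some mean r, so the probability equals 1 -
  exp(-r), which is at most r.\<close>

lemma prob_exists_loop_le:
  fixes S :: "(int ^ 'd) list set set"
  assumes S: "S \<subseteq> loops" and \<alpha>: "\<alpha> > 0" and v: "emeasure loop_measure S \<le> ennreal v" "0 \<le> v"
  shows "measure (loop_soup \<alpha>) {\<omega>\<in>space (loop_soup \<alpha>). \<exists>L\<in>S. 1 \<le> \<omega> L} \<le> \<alpha> * v"
proof -
  let ?P = "loop_soup \<alpha> :: ((int ^ 'd) list set \<Rightarrow> nat) measure"
  let ?r = "measure (soup_intensity \<alpha>) S"
  have em: "emeasure (soup_intensity \<alpha>) S \<le> ennreal (\<alpha> * v)"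
    using \<alpha> v by (simp add: soup_intensity_def ennreal_mult mult_left_mono)
  then have fin: "emeasure (soup_intensity \<alpha>) S < \<infinity>" by (rule order.strict_trans1) (simp add: ennreal_less_top)
  have r: "?r \<le> \<alpha> * v"
    unfolding measure_def using em \<alpha> v by (intro enn2real_leI) auto
  have eq: "{\<omega>\<in>space ?P. \<exists>L\<in>S. 1 \<le> \<omega> L} = space ?P - {\<omega>\<in>space ?P. num_points S \<omega> = of_nat 0}"
  proof -
    have "num_points S \<omega> = of_nat 0 \<longleftrightarrow> \<not> (\<exists>L\<in>S. 1 \<le> \<omega> L)" for \<omega>
      unfolding num_points_def
      by (simp add: nn_integral_0_iff_AE AE_count_space Suc_le_eq)
    then show ?thesis by auto
  qed
  have m: "{\<omega>\<in>space ?P. num_points S \<omega> = of_nat 0} \<in> sets ?P"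
    using soup.num_points_measurable[of S \<alpha>] S unfolding loop_soup_eq space_soup_intensity by measurable
  have "measure ?P {\<omega>\<in>space ?P. num_points S \<omega> = of_nat 0} = exp (- ?r)"
    using soup.prob_num_points[of S \<alpha> 0] S fin unfolding loop_soup_eq space_soup_intensity
    by (simp add: pmf_poisson_law)
  then have "measure ?P {\<omega>\<in>space ?P. \<exists>L\<in>S. 1 \<le> \<omega> L} = 1 - exp (- ?r)"
    unfolding eq using LS.prob_compl[OF m] by simp
  also have "\<dots> \<le> ?r" using exp_ge_add_one_self[of "- ?r"] by simp
  finally show ?thesis using r by simp
qed

text \<open>Setting multiplicities to zero outside S keeps the type, so \<open>connects\<close>
  still applies, while the result depends on the coordinates in S only.\<close>

definition keep :: "(int ^ 'd) list set set \<Rightarrow> ((int ^ 'd) list set \<Rightarrow> nat) \<Rightarrow> (int ^ 'd) list set \<Rightarrow> nat" where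
  "keep S \<omega> L = (if L \<in> S then \<omega> L else 0)"

lemma keep_restrict: "keep S (restrict \<omega> S) = keep S \<omega>"
  by (auto simp: keep_def fun_eq_iff)

lemma connects_measurable:
  fixes A B :: "(int ^ 'd) set"
  assumes comp: "\<And>L. L \<in> loops \<Longrightarrow> (\<lambda>\<omega>. g \<omega> L) \<in> measurable M (count_space UNIV)"
  shows "Measurable.pred M (\<lambda>\<omega>. connects (g \<omega>) A B)"
proof -
  note [measurable] = comp
  note countable_loops [measurable]
  have [measurable]: "Measurable.pred M (\<lambda>\<omega>. open_edge (g \<omega>) x y)" for x y :: "int ^ 'd"
    unfolding open_edge_def by measurable
  have [measurable]: "Measurable.pred M (\<lambda>\<omega>. (open_edge (g \<omega>) ^^ n) x y)" for n and x y :: "int ^ 'd"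
  proof (induction n arbitrary: y)
    case (Suc n)
    note [measurable] = Suc.IH
    show ?case by (simp add: relcompp_apply)
  qed simp
  have "Measurable.pred M (\<lambda>\<omega>. \<exists>x\<in>A. \<exists>y\<in>B. \<exists>n. (open_edge (g \<omega>) ^^ n) x y)"
    by measurable
  then show ?thesis
    unfolding connects_def rtranclp_is_Sup_relpowp by simp
qed

lemma keep_component_measurable:
  assumes "S \<subseteq> loops" "L \<in> loops"
  shows "(\<lambda>\<omega>. keep S \<omega> L) \<in> measurable (\<Pi>\<^sub>M L\<in>S. count_space UNIV) (count_space UNIV)"
    and "(\<lambda>\<omega>. keep S \<omega> L) \<in> measurable (loop_soup \<alpha>) (count_space UNIV)"
  using assms loop_component_measurable[of L \<alpha>] by (cases "L \<in> S"; auto simp: keep_def)+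

text \<open>Disjoint classes of loops use disjoint coordinates of the product measure, so events
  about them are independent. Two-valued factors cover both applications: indicators of crossings,
  and exponential weights.\<close>

lemma expectation_prod_keep:
  fixes S :: "'i \<Rightarrow> (int ^ 'd) list set set"
  assumes I: "finite I" and S: "\<And>i. i \<in> I \<Longrightarrow> S i \<subseteq> loops" and disj: "disjoint_family_on S I"
    and Q: "\<And>i. i \<in> I \<Longrightarrow> Measurable.pred (\<Pi>\<^sub>M L\<in>S i. count_space UNIV) (\<lambda>\<omega>. Q i (keep (S i) \<omega>))"
  shows "(\<integral>\<omega>. (\<Prod>i\<in>I. if Q i (keep (S i) \<omega>) then c i else e i) \<partial>loop_soup \<alpha>)
    = (\<Prod>i\<in>I. e i + (c i - e i) * measure (loop_soup \<alpha>) {\<omega>\<in>space (loop_soup \<alpha>). Q i (keep (S i) \<omega>)} :: real)"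
proof -
  let ?P = "loop_soup \<alpha> :: ((int ^ 'd) list set \<Rightarrow> nat) measure"
  let ?f = "\<lambda>i \<omega>. if Q i (keep (S i) \<omega>) then c i else e i"
  have "LS.indep_vars \<alpha> (\<lambda>i. \<Pi>\<^sub>M L\<in>S i. count_space UNIV) (\<lambda>i \<omega>. restrict (\<lambda>L. \<omega> L) (S i)) I"
    unfolding loop_soup_eq
    by (rule soup.P.indep_vars_restrict[OF soup.indep_components]) (use S disj in \<open>auto simp: space_soup_intensity\<close>)
  then have "LS.indep_vars \<alpha> (\<lambda>_. borel) (\<lambda>i \<omega>. ?f i (restrict (\<lambda>L. \<omega> L) (S i))) I"
  proof (rule LS.indep_vars_compose2)
    fix i assume "i \<in> I"
    then show "?f i \<in> borel_measurable (\<Pi>\<^sub>M L\<in>S i. count_space UNIV)"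
      using Q[of i] by measurable
  qed
  then have ind: "LS.indep_vars \<alpha> (\<lambda>_. borel) ?f I" by (simp add: keep_restrict)
  have ev: "{\<omega>\<in>space ?P. Q i (keep (S i) \<omega>)} \<in> sets ?P" if "i \<in> I" for i
  proof -
    have "(\<lambda>\<omega>. restrict \<omega> (S i)) \<in> measurable ?P (\<Pi>\<^sub>M L\<in>S i. count_space UNIV)"
      using S[OF that] loop_component_measurable by (intro measurable_restrict) blast
    from measurable_compose[OF this Q[OF that]] show ?thesis
      by (simp add: keep_restrict pred_def)
  qed
  have int: "(\<integral>\<omega>. ?f i \<omega> \<partial>?P) = e i + (c i - e i) * measure ?P {\<omega>\<in>space ?P. Q i (keep (S i) \<omega>)}"
    and intble: "integrable ?P (?f i)" if "i \<in> I" for i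
  proof -
    let ?E = "{\<omega>\<in>space ?P. Q i (keep (S i) \<omega>)}"
    have eq: "?f i \<omega> = e i + (c i - e i) * indicator ?E \<omega>" if "\<omega> \<in> space ?P" for \<omega>
      using that by auto
    have I: "integrable ?P (\<lambda>\<omega>. e i + (c i - e i) * indicator ?E \<omega>)"
      using ev[OF that] by (intro Bochner_Integration.integrable_add integrable_mult_right LS.integrable_const) (auto simp: LS.emeasure_eq_measure)
    have "(\<integral>\<omega>. ?f i \<omega> \<partial>?P) = (\<integral>\<omega>. e i + (c i - e i) * indicator ?E \<omega> \<partial>?P)"
      using eq by (rule Bochner_Integration.integral_cong[OF refl])
    also have "\<dots> = e i + (c i - e i) * measure ?P ?E"
      using ev[OF that] by (subst Bochner_Integration.integral_add) (auto simp: LS.emeasure_eq_measure LS.prob_space)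
    finally show "(\<integral>\<omega>. ?f i \<omega> \<partial>?P) = e i + (c i - e i) * measure ?P ?E" .
    show "integrable ?P (?f i)"
      using I by (subst Bochner_Integration.integrable_cong[OF refl eq])
  qed
  have "(\<integral>\<omega>. (\<Prod>i\<in>I. ?f i \<omega>) \<partial>?P) = (\<Prod>i\<in>I. \<integral>\<omega>. ?f i \<omega> \<partial>?P)"
    using I ind intble by (rule LS.indep_vars_lebesgue_integral)
  also have "\<dots> = (\<Prod>i\<in>I. e i + (c i - e i) * measure ?P {\<omega>\<in>space ?P. Q i (keep (S i) \<omega>)})"
    by (intro prod.cong refl int)
  finally show ?thesis .
qed

lemma open_edge_mono:
  assumes "\<And>L. L \<in> loops \<Longrightarrow> 1 \<le> \<omega> L \<Longrightarrow> 1 \<le> \<omega>' L"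
  shows "open_edge \<omega> x y \<Longrightarrow> open_edge \<omega>' x y"
  using assms by (auto simp: open_edge_def)

lemma connects_keep: "connects (keep S \<omega>) A B \<Longrightarrow> connects \<omega> A B"
proof -
  have "open_edge (keep S \<omega>) \<le> open_edge \<omega>"
    using open_edge_mono[of "keep S \<omega>" \<omega>] by (auto simp: keep_def le_fun_def split: if_splits)
  from rtranclp_mono[OF this] show "connects (keep S \<omega>) A B \<Longrightarrow> connects \<omega> A B"
    by (force simp: connects_def)
qed

lemma prob_connects_keep_le:
  "measure (loop_soup \<alpha>) {\<omega>\<in>space (loop_soup \<alpha>). connects (keep S \<omega>) A B} \<le> connection_prob \<alpha> A B"
  unfolding connection_prob_def
  by (intro LS.finite_measure_mono connection_event_measurable) (auto dest: connects_keep)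

section \<open>Crossings of annuli\<close>

definition linf :: "int ^ 'd \<Rightarrow> int" where
  "linf z = Max (range (\<lambda>i. \<bar>z $ i\<bar>))"

lemma linf_le_iff: "linf z \<le> n \<longleftrightarrow> (\<forall>i. \<bar>z $ i\<bar> \<le> n)"
  and linf_ge_iff: "n \<le> linf z \<longleftrightarrow> (\<exists>i. n \<le> \<bar>z $ i\<bar>)"
  by (auto simp: linf_def Max_le_iff Max_ge_iff)

lemma linf_triangle: "linf (x + y) \<le> linf x + linf y"
  unfolding linf_le_iff[of "x + y"]
proof
  fix i
  have "\<bar>x $ i\<bar> \<le> linf x" "\<bar>y $ i\<bar> \<le> linf y" by (auto simp: linf_ge_iff)
  then show "\<bar>(x + y) $ i\<bar> \<le> linf x + linf y" unfolding vector_add_component by linarith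
qed

lemma linf_minus: "linf (x - y) = linf (y - x)"
  by (simp add: linf_def abs_minus_commute)

lemma mem_lattice_box: "y \<in> lattice_box x n \<longleftrightarrow> linf (y - x) \<le> int n"
  by (simp add: lattice_box_def linf_le_iff)

lemma adjacent_linf: "adjacent x y \<Longrightarrow> linf (x - y) \<le> 1"
  unfolding linf_le_iff
proof
  fix i assume "adjacent x y"
  then have "(\<Sum>i\<in>UNIV. \<bar>x $ i - y $ i\<bar>) = 1" by (simp add: adjacent_def)
  moreover have "\<bar>x $ i - y $ i\<bar> \<le> (\<Sum>i\<in>UNIV. \<bar>x $ i - y $ i\<bar>)" by (rule member_le_sum) auto
  ultimately show "\<bar>(x - y) $ i\<bar> \<le> 1" by simp
qed

lemma adjacent_linf_diff: "adjacent x y \<Longrightarrow> \<bar>linf (x - c) - linf (y - c)\<bar> \<le> 1"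
  using linf_triangle[of "x - y" "y - c"] linf_triangle[of "y - x" "x - c"] adjacent_linf[of x y] linf_minus[of x y]
  by simp

lemma inner_boundary_box: "y \<in> inner_boundary (lattice_box c m) \<longleftrightarrow> linf (y - c) = int m"
proof
  assume "y \<in> inner_boundary (lattice_box c m)"
  then obtain z where "linf (y - c) \<le> int m" "adjacent y z" "\<not> linf (z - c) \<le> int m"
    by (auto simp: inner_boundary_def mem_lattice_box)
  then show "linf (y - c) = int m" using adjacent_linf_diff[of y z c] by linarith
next
  assume m: "linf (y - c) = int m"
  then obtain i where i: "int m \<le> \<bar>(y - c) $ i\<bar>" using linf_ge_iff[of "int m" "y - c"] by auto
  \<comment> \<open>One step away from the centre, along a coordinate of maximal modulus, leaves the
    box.\<close>
  define z where "z = nbr y (i, 0 \<le> (y - c) $ i)"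
  have "int m + 1 \<le> \<bar>(z - c) $ i\<bar>" using i by (auto simp: z_def nbr_def axis_def)
  then have "int m + 1 \<le> linf (z - c)" using linf_ge_iff by blast
  then have "z \<notin> lattice_box c m" by (simp add: mem_lattice_box)
  moreover have "adjacent y z" by (simp add: z_def adjacent_iff_nbr)
  ultimately show "y \<in> inner_boundary (lattice_box c m)"
    using m by (auto simp: inner_boundary_def mem_lattice_box)
qed

text \<open>Following the path, one remembers a piece that starts at level a and has stayed in the
  annulus since; it is discarded whenever the path returns to level a or below. Levels change by at
  most 1, so neither boundary can be jumped over.\<close>

lemma rtranclp_annulus:
  fixes N :: "'a \<Rightarrow> int"
  assumes "R\<^sup>*\<^sup>* x y" and lip: "\<And>x y. R x y \<Longrightarrow> \<bar>N x - N y\<bar> \<le> 1"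
    and "N x \<le> a" "a \<le> b" "b \<le> N y"
  shows "\<exists>u v. N u = a \<and> N v = b \<and> (\<lambda>s t. R s t \<and> N s \<in> {a..b} \<and> N t \<in> {a..b})\<^sup>*\<^sup>* u v"
proof -
  let ?R = "\<lambda>s t. R s t \<and> N s \<in> {a..b} \<and> N t \<in> {a..b}"
  define crossed where "crossed \<longleftrightarrow> (\<exists>u v. N u = a \<and> N v = b \<and> ?R\<^sup>*\<^sup>* u v)"
  from assms(1) have "crossed \<or> N y \<le> a \<or> (a \<le> N y \<and> N y < b \<and> (\<exists>u. N u = a \<and> ?R\<^sup>*\<^sup>* u y))"
  proof (induction rule: rtranclp_induct)
    case base
    then show ?case using assms by simp
  next
    case (step y z)
    have yz: "\<bar>N y - N z\<bar> \<le> 1" by (rule lip) fact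
    consider "crossed" | "N z \<le> a" | "N z > a" "N y \<le> a" "\<not> crossed"
      | "N z > a" "a \<le> N y" "N y < b" "\<exists>u. N u = a \<and> ?R\<^sup>*\<^sup>* u y" "\<not> crossed"
      using step.IH unfolding not_le[symmetric] by blast
    then show ?case
    proof cases
      case 3
      then have Ny: "N y = a" "N z = a + 1" using yz by linarith+
      have "a < b"
      proof (rule ccontr)
        assume "\<not> a < b"
        then have "N y = b" using Ny \<open>a \<le> b\<close> by simp
        then have crossed unfolding crossed_def using Ny by (intro exI[of _ y] conjI) auto
        then show False using 3 by simp
      qed
      then have "?R\<^sup>*\<^sup>* y z" using step.hyps Ny by (intro r_into_rtranclp) auto
      then show ?thesis using Ny \<open>a < b\<close> by (cases "a + 1 = b") (auto simp: crossed_def)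
    next
      case 4
      then obtain u where u: "N u = a" "?R\<^sup>*\<^sup>* u y" by blast
      have "N z \<le> b" using yz 4 by linarith
      then have "?R y z" using step.hyps 4 by auto
      with u(2) have "?R\<^sup>*\<^sup>* u z" by (rule rtranclp.rtrancl_into_rtrancl)
      then show ?thesis using u 4 \<open>N z \<le> b\<close> by (cases "N z = b") (auto simp: crossed_def)
    qed auto
  qed
  then show ?thesis
  proof (elim disjE)
    assume "N y \<le> a"
    then have "N y = a" "N y = b" using assms by linarith+
    then show ?thesis by blast
  qed (use assms in \<open>auto simp: crossed_def\<close>)
qed

definition loop_hits :: "(int ^ 'd) list set \<Rightarrow> (int ^ 'd) set \<Rightarrow> bool" where
  "loop_hits L U \<longleftrightarrow> (\<exists>l\<in>L. set l \<inter> U \<noteq> {})"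

lemma traverses_hits:
  assumes "traverses L x y" "x \<in> U"
  shows "loop_hits L U"
proof -
  obtain l i where l: "l \<in> L" "i < length l" "{l ! i, l ! (Suc i mod length l)} = {x, y}"
    using assms(1) by (auto simp: traverses_def)
  have "Suc i mod length l < length l" using l by (intro mod_less_divisor) auto
  then have "x \<in> set l" using l by (metis insertI1 insertE nth_mem singletonD)
  then show ?thesis using l(1) assms(2) by (auto simp: loop_hits_def)
qed

lemma open_path_linf_lip: "open_edge \<omega> x y \<Longrightarrow> \<bar>linf (x - c) - linf (y - c)\<bar> \<le> 1"
  by (auto simp: open_edge_def intro: adjacent_linf_diff)

text \<open>The piece of the path inside the annulus uses only edges of loops meeting the annulus,
  so it survives the removal of all loops outside S.\<close>

lemma crossing_by_kept_loops:
  assumes path: "(open_edge \<omega>)\<^sup>*\<^sup>* x y" and xy: "linf (x - c) \<le> int n" "n \<le> m" "int m \<le> linf (y - c)"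
    and keep: "\<And>L. L \<in> loops \<Longrightarrow> 1 \<le> \<omega> L \<Longrightarrow> loop_hits L {z. linf (z - c) \<in> {int n..int m}} \<Longrightarrow> L \<in> S"
  shows "connects (keep S \<omega>) (lattice_box c n) (inner_boundary (lattice_box c m))"
proof -
  let ?N = "\<lambda>z. linf (z - c)"
  let ?U = "{z. ?N z \<in> {int n..int m}}"
  let ?R = "\<lambda>s t. open_edge \<omega> s t \<and> ?N s \<in> {int n..int m} \<and> ?N t \<in> {int n..int m}"
  have lip: "open_edge \<omega> s t \<Longrightarrow> \<bar>?N s - ?N t\<bar> \<le> 1" for s t by (rule open_path_linf_lip)
  obtain u v where uv: "?N u = int n" "?N v = int m" "?R\<^sup>*\<^sup>* u v"
    using rtranclp_annulus[where N="?N" and a="int n" and b="int m", OF path lip] xy by auto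
  have "?R \<le> open_edge (keep S \<omega>)"
  proof (intro le_funI le_boolI)
    fix s t assume st: "?R s t"
    then obtain L where L: "L \<in> loops" "1 \<le> \<omega> L" "traverses L s t" "adjacent s t" by (auto simp: open_edge_def)
    have "loop_hits L ?U" using st by (intro traverses_hits[OF L(3)]) auto
    then have "L \<in> S" using keep L by blast
    then show "open_edge (keep S \<omega>) s t" using L by (auto simp: open_edge_def keep_def)
  qed
  from rtranclp_mono[OF this] uv(3) have "(open_edge (keep S \<omega>))\<^sup>*\<^sup>* u v" by blast
  moreover have "u \<in> lattice_box c n" "v \<in> inner_boundary (lattice_box c m)"
    using uv(1,2) by (simp_all add: mem_lattice_box inner_boundary_box)
  ultimately show ?thesis unfolding connects_def by blast
qed

lemma loop_hits_loops_hitting: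
  assumes "L \<in> loops" "loop_hits L A" "loop_hits L B"
  shows "L \<in> loops_hitting A B"
proof -
  obtain l l' where l: "l \<in> L" "l' \<in> L" "set l \<inter> A \<noteq> {}" "set l' \<inter> B \<noteq> {}"
    using assms by (auto simp: loop_hits_def)
  then have "hits_both A B l" using loop_class_set[OF assms(1), of l l'] by (auto simp: hits_both_def)
  then show ?thesis using assms(1) l by (auto simp: loops_hitting_def)
qed

lemma loops_hitting_subset: "loops_hitting A B \<subseteq> loops"
  by (auto simp: loops_hitting_def)

lemma loop_nonempty:
  assumes "L \<in> loops"
  obtains l where "l \<in> L" "l \<noteq> []"
proof -
  obtain l where l: "L = loop_rel `` {l}" "l \<in> based_loops" using assms by (auto simp: loops_def quotient_def)
  then have "l \<in> L" by (auto simp: loop_rel_def intro: exI[of _ 0])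
  moreover have "l \<noteq> []" using l by (auto simp: based_loops_def)
  ultimately show ?thesis using that by blast
qed

lemma open_edge_commute: "open_edge \<omega> x y \<longleftrightarrow> open_edge \<omega> y x"
  by (simp add: open_edge_def adjacent_def traverses_def insert_commute abs_minus_commute)

lemma open_path_commute: "(open_edge \<omega>)\<^sup>*\<^sup>* x y \<Longrightarrow> (open_edge \<omega>)\<^sup>*\<^sup>* y x"
  using symp_rtranclp[of "open_edge \<omega>"] open_edge_commute[of \<omega>] by (auto simp: symp_def)

section \<open>Renormalisation of crossing probabilities and positivity of
  \<open>alpha1\<close>\<close>

lemma lattice_box_covering:
  fixes x z :: "int ^ 'd"
  assumes n: "1 \<le> n" and z: "linf (z - x) \<le> 48 * int n"
  shows "\<exists>w\<in>lattice_box 0 48. linf (z - (x + int n *s w)) \<le> int n"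
proof -
  \<comment> \<open>Rounding down to multiples of n. The bound 48 accommodates the outer radius 2N
    of a crossing at a scale N <= 24 n.\<close>
  define w :: "int ^ 'd" where "w = (\<chi> i. (z $ i - x $ i) div int n)"
  have "\<bar>w $ i\<bar> \<le> 48" for i
  proof -
    have b: "\<bar>z $ i - x $ i\<bar> \<le> 48 * int n" using z by (simp add: linf_le_iff)
    have "(z $ i - x $ i) div int n \<le> (48 * int n) div int n" using b n by (intro zdiv_mono1) auto
    moreover have "(- 48 * int n) div int n \<le> (z $ i - x $ i) div int n" using b n by (intro zdiv_mono1) auto
    moreover have "(- 48 * int n) div int n = - 48" "(48 * int n) div int n = 48"
      using n by (simp_all only: nonzero_mult_div_cancel_right)
    ultimately show ?thesis by (simp add: w_def)
  qed
  then have "w \<in> lattice_box 0 48" by (simp add: lattice_box_def)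
  moreover have "\<bar>(z - (x + int n *s w)) $ i\<bar> \<le> int n" for i
  proof -
    have "(z - (x + int n *s w)) $ i = (z $ i - x $ i) mod int n"
      by (simp add: w_def minus_mult_div_eq_mod[symmetric] algebra_simps)
    then show ?thesis using n pos_mod_bound[of "int n"] pos_mod_sign[of "int n"] by (simp add: less_imp_le)
  qed
  then have "linf (z - (x + int n *s w)) \<le> int n" by (simp add: linf_le_iff)
  ultimately show ?thesis by blast
qed

definition box_crossing_prob :: "real \<Rightarrow> int ^ 'd \<Rightarrow> nat \<Rightarrow> real" where
  "box_crossing_prob \<alpha> x n = connection_prob \<alpha> (lattice_box x n) (inner_boundary (lattice_box x (2 * n)))"

text \<open>The box of radius 2n contains the annulus to be crossed. Loops that start there and stay
  within 4n cannot serve two centres at distance 8n, so the escaping loops are the only source of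
  dependence between such crossings.\<close>

definition escaping_loops :: "int ^ 'd \<Rightarrow> nat \<Rightarrow> (int ^ 'd) list set set" where
  "escaping_loops y n = loops_hitting (lattice_box y (2 * n)) {z. \<exists>i. int (4 * n) \<le> \<bar>z $ i - y $ i\<bar>}"

definition confined_loops :: "int ^ 'd \<Rightarrow> nat \<Rightarrow> (int ^ 'd) list set set" where
  "confined_loops y n = {L\<in>loops. loop_hits L (lattice_box y (2 * n)) \<and> L \<notin> escaping_loops y n}"

lemma confined_loops_subset: "confined_loops y n \<subseteq> loops"
  and escaping_loops_subset: "escaping_loops y n \<subseteq> loops"
  by (auto simp: confined_loops_def escaping_loops_def loops_hitting_def)

lemma confined_loops_linf:
  assumes "L \<in> confined_loops y n" "l \<in> L" "z \<in> set l"
  shows "linf (z - y) < int (4 * n)"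
proof (rule ccontr)
  assume "\<not> linf (z - y) < int (4 * n)"
  then have "loop_hits L {z. \<exists>i. int (4 * n) \<le> \<bar>z $ i - y $ i\<bar>}"
    using assms linf_ge_iff[of "int (4 * n)" "z - y"] by (auto simp: loop_hits_def)
  then have "L \<in> escaping_loops y n"
    using assms(1) unfolding escaping_loops_def confined_loops_def by (auto intro: loop_hits_loops_hitting)
  then show False using assms(1) by (simp add: confined_loops_def)
qed

lemma confined_loops_disjoint:
  assumes "int (8 * n) \<le> linf (y - y')"
  shows "confined_loops y n \<inter> confined_loops y' n = {}"
proof (rule ccontr)
  assume "\<not> ?thesis"
  then obtain L where L: "L \<in> confined_loops y n" "L \<in> confined_loops y' n" by blast
  then have "L \<in> loops" by (simp add: confined_loops_def)
  then obtain l where l: "l \<in> L" "l \<noteq> []" by (rule loop_nonempty)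
  have "linf (hd l - y) < int (4 * n)" "linf (hd l - y') < int (4 * n)"
    using confined_loops_linf[OF _ l(1), of _ n "hd l"] L l(2) by auto
  then show False using linf_triangle[of "y - hd l" "hd l - y'"] linf_minus[of y "hd l"] assms by simp
qed

lemma prob_escaping_loops_le:
  fixes y :: "int ^ 'd"
  assumes d: "CARD('d) \<ge> 3" and n: "1 \<le> n" and \<alpha>: "\<alpha> > 0"
  shows "measure (loop_soup \<alpha>) {\<omega>\<in>space (loop_soup \<alpha>). \<exists>L\<in>escaping_loops y n. 1 \<le> \<omega> L} \<le> \<alpha> * \<bar>annulus_const CARD('d)\<bar>"
proof (rule prob_exists_loop_le[OF escaping_loops_subset \<alpha>])
  have "emeasure loop_measure (escaping_loops y n)
      \<le> ennreal (annulus_const CARD('d) * (real (2 * n) / real (4 * n)) ^ (CARD('d) - 2))"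
    unfolding escaping_loops_def by (rule emeasure_loops_crossing) (use d n in auto)
  also have "\<dots> \<le> ennreal \<bar>annulus_const CARD('d)\<bar>"
  proof (rule ennreal_leI)
    have "(real (2 * n) / real (4 * n)) ^ (CARD('d) - 2) \<le> 1" by (rule power_le_one) (use n in auto)
    then have "\<bar>annulus_const CARD('d)\<bar> * (real (2 * n) / real (4 * n)) ^ (CARD('d) - 2) \<le> \<bar>annulus_const CARD('d)\<bar> * 1"
      by (intro mult_left_mono) auto
    moreover have "annulus_const CARD('d) * (real (2 * n) / real (4 * n)) ^ (CARD('d) - 2)
       \<le> \<bar>annulus_const CARD('d)\<bar> * (real (2 * n) / real (4 * n)) ^ (CARD('d) - 2)"
      by (intro mult_right_mono) auto
    ultimately show "annulus_const CARD('d) * (real (2 * n) / real (4 * n)) ^ (CARD('d) - 2) \<le> \<bar>annulus_const CARD('d)\<bar>"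
      by simp
  qed
  finally show "emeasure loop_measure (escaping_loops y n) \<le> ennreal \<bar>annulus_const CARD('d)\<bar>" .
qed auto

lemma confined_crossing:
  assumes path: "(open_edge \<omega>)\<^sup>*\<^sup>* u v" and uv: "linf (u - y) \<le> int n" "int (2 * n) \<le> linf (v - y)"
    and esc: "\<not> (\<exists>L\<in>escaping_loops y n. 1 \<le> \<omega> L)"
  shows "connects (keep (confined_loops y n) \<omega>) (lattice_box y n) (inner_boundary (lattice_box y (2 * n)))"
proof (rule crossing_by_kept_loops[OF path uv(1) _ uv(2)])
  fix L assume L: "L \<in> loops" "1 \<le> \<omega> L" "loop_hits L {z. linf (z - y) \<in> {int n..int (2 * n)}}"
  moreover have "{z. linf (z - y) \<in> {int n..int (2 * n)}} \<subseteq> lattice_box y (2 * n)" by (auto simp: mem_lattice_box)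
  ultimately have "loop_hits L (lattice_box y (2 * n))" unfolding loop_hits_def by blast
  then show "L \<in> confined_loops y n" using L esc by (auto simp: confined_loops_def)
qed auto

text \<open>The confined classes of the two centres are disjoint, so the crossings are independent.
  Taking p as a bound over all centres stands in for translation invariance.\<close>

lemma prob_two_confined_crossings_le:
  fixes y y' :: "int ^ 'd"
  assumes far: "int (8 * n) \<le> linf (y - y')"
    and p: "\<And>z :: int ^ 'd. box_crossing_prob \<alpha> z n \<le> p"
  shows "measure (loop_soup \<alpha>) {\<omega>\<in>space (loop_soup \<alpha>).
      connects (keep (confined_loops y n) \<omega>) (lattice_box y n) (inner_boundary (lattice_box y (2 * n))) \<and>
      connects (keep (confined_loops y' n) \<omega>) (lattice_box y' n) (inner_boundary (lattice_box y' (2 * n)))} \<le> p\<^sup>2"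
proof -
  let ?P = "loop_soup \<alpha> :: ((int ^ 'd) list set \<Rightarrow> nat) measure"
  define Y where "Y b = (if b then y else y')" for b
  let ?S = "\<lambda>b. confined_loops (Y b) n"
  let ?Q = "\<lambda>b \<omega>. connects \<omega> (lattice_box (Y b) n) (inner_boundary (lattice_box (Y b) (2 * n)))"
  let ?E = "\<lambda>b. {\<omega>\<in>space ?P. ?Q b (keep (?S b) \<omega>)}"
  have ev: "?E b \<in> sets ?P" for b
    using connects_measurable[OF keep_component_measurable(2)[OF confined_loops_subset]]
    by (simp add: pred_def)
  have "measure ?P (?E True \<inter> ?E False) = (\<integral>\<omega>. indicator (?E True \<inter> ?E False) \<omega> \<partial>?P)"
    using ev by simp
  also have "\<dots> = (\<integral>\<omega>. (\<Prod>b\<in>UNIV. if ?Q b (keep (?S b) \<omega>) then 1 else 0) \<partial>?P)"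
    by (intro Bochner_Integration.integral_cong refl) (auto simp: UNIV_bool)
  also have "\<dots> = (\<Prod>b\<in>UNIV. 0 + (1 - 0) * measure ?P (?E b))"
  proof (rule expectation_prod_keep)
    have "?S True \<inter> ?S False = {}" using confined_loops_disjoint[OF far] by (simp add: Y_def)
    then show "disjoint_family_on ?S UNIV" unfolding disjoint_family_on_def UNIV_bool by blast
    show "Measurable.pred (\<Pi>\<^sub>M L\<in>?S b. count_space UNIV) (\<lambda>\<omega>. ?Q b (keep (?S b) \<omega>))" for b
      by (rule connects_measurable[OF keep_component_measurable(1)[OF confined_loops_subset]])
  qed (use confined_loops_subset in auto)
  also have "\<dots> \<le> (\<Prod>b\<in>(UNIV :: bool set). p)"
  proof (rule prod_mono)
    fix b
    have "measure ?P (?E b) \<le> box_crossing_prob \<alpha> (Y b) n"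
      unfolding box_crossing_prob_def by (rule prob_connects_keep_le)
    then show "0 \<le> 0 + (1 - 0) * measure ?P (?E b) \<and> 0 + (1 - 0) * measure ?P (?E b) \<le> p" using p[of "Y b"] by simp
  qed
  also have "\<dots> = p\<^sup>2" by simp
  finally show ?thesis by (simp add: Y_def Int_def conj_commute conj_left_commute cong: conj_cong)
qed

text \<open>The renormalisation inequality: a crossing at scale \<open>N\<close> produces two far apart crossings at
  scale \<open>n\<close>, which are independent unless a loop escapes from one of the small boxes.\<close>

lemma box_crossing_prob_renormalisation:
  fixes x :: "int ^ 'd"
  assumes d: "CARD('d) \<ge> 3" and \<alpha>: "\<alpha> > 0" and n: "1 \<le> n" and N: "12 * n \<le> N" "N \<le> 24 * n"
    and p: "\<And>z :: int ^ 'd. box_crossing_prob \<alpha> z n \<le> p"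
  shows "box_crossing_prob \<alpha> x N \<le>
    real (card (lattice_box 0 48 :: (int ^ 'd) set)) ^ 2 * p\<^sup>2
      + real (card (lattice_box 0 48 :: (int ^ 'd) set)) * (\<alpha> * \<bar>annulus_const CARD('d)\<bar>)"
proof -
  let ?P = "loop_soup \<alpha> :: ((int ^ 'd) list set \<Rightarrow> nat) measure"
  let ?G = "lattice_box 0 48 :: (int ^ 'd) set"
  define y where "y w = x + int n *s w" for w
  let ?c = "\<lambda>\<omega> w. connects (keep (confined_loops (y w) n) \<omega>) (lattice_box (y w) n) (inner_boundary (lattice_box (y w) (2 * n)))"
  let ?E = "\<lambda>w. {\<omega>\<in>space ?P. \<exists>L\<in>escaping_loops (y w) n. 1 \<le> \<omega> L}"
  define far where "far = {(w, w'). w \<in> ?G \<and> w' \<in> ?G \<and> int (8 * n) \<le> linf (y w - y w')}"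
  let ?F = "\<lambda>(w, w'). {\<omega>\<in>space ?P. ?c \<omega> w \<and> ?c \<omega> w'}"
  have finG: "finite ?G" by (rule finite_lattice_box)
  have far: "far \<subseteq> ?G \<times> ?G" by (auto simp: far_def)
  have finf: "finite far" using far finG by (rule finite_subset[OF _ finite_cartesian_product]) (rule finG)
  have E: "?E w \<in> sets ?P" for w
    using exists_loop_measurable[OF escaping_loops_subset loop_component_measurable] by (simp add: pred_def)
  have cm [measurable]: "Measurable.pred ?P (\<lambda>\<omega>. ?c \<omega> w)" for w
    by (rule connects_measurable[OF keep_component_measurable(2)[OF confined_loops_subset]])
  have F: "?F i \<in> sets ?P" for i by (cases i) simp
  have sub: "{\<omega>\<in>space ?P. connects \<omega> (lattice_box x N) (inner_boundary (lattice_box x (2 * N)))}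
     \<subseteq> (\<Union>i\<in>far. ?F i) \<union> (\<Union>w\<in>?G. ?E w)"
  proof
    fix \<omega> assume "\<omega> \<in> {\<omega>\<in>space ?P. connects \<omega> (lattice_box x N) (inner_boundary (lattice_box x (2 * N)))}"
    then obtain u v where \<omega>: "\<omega> \<in> space ?P" and path: "(open_edge \<omega>)\<^sup>*\<^sup>* u v"
      and u: "linf (u - x) \<le> int N" and v: "linf (v - x) = int (2 * N)"
      by (auto simp: connects_def mem_lattice_box inner_boundary_box)
    have "\<exists>w\<in>?G. linf (u - y w) \<le> int n" unfolding y_def
      by (rule lattice_box_covering[OF n]) (use u N in simp)
    then obtain w where w: "w \<in> ?G" "linf (u - y w) \<le> int n" by blast
    have "\<exists>w\<in>?G. linf (v - y w) \<le> int n" unfolding y_def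
      by (rule lattice_box_covering[OF n]) (use v N in simp)
    then obtain w' where w': "w' \<in> ?G" "linf (v - y w') \<le> int n" by blast
    \<comment> \<open>The endpoints are at least N >= 12 n apart and each chosen centre is within n
      of its endpoint. The centres are therefore at least 10 n apart, more than the 8 n that
      independence asks for.\<close>
    have uv: "int N \<le> linf (v - u)" using linf_triangle[of "v - u" "u - x"] u v by simp
    have 1: "int (2 * n) \<le> linf (v - y w)"
      using linf_triangle[of "v - y w" "y w - u"] linf_minus[of "y w" u] uv w N by simp
    have 2: "int (2 * n) \<le> linf (u - y w')"
      using linf_triangle[of "v - y w'" "y w' - u"] linf_minus[of "y w'" u] uv w' N by simp
    have "linf (v - u) \<le> linf (v - y w') + linf (y w' - y w) + linf (y w - u)"
      using linf_triangle[of "v - y w'" "y w' - y w"] linf_triangle[of "v - y w" "y w - u"] by simp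
    then have 3: "int (8 * n) \<le> linf (y w - y w')"
      using uv w(2) w'(2) N linf_minus[of "y w" u] linf_minus[of "y w" "y w'"] by simp
    show "\<omega> \<in> (\<Union>i\<in>far. ?F i) \<union> (\<Union>w\<in>?G. ?E w)"
    proof (cases "\<omega> \<in> (\<Union>w\<in>?G. ?E w)")
      case False
      then have ne: "\<not> (\<exists>L\<in>escaping_loops (y w) n. 1 \<le> \<omega> L)" "\<not> (\<exists>L\<in>escaping_loops (y w') n. 1 \<le> \<omega> L)"
        using \<omega> w(1) w'(1) by blast+
      have "?c \<omega> w" by (rule confined_crossing[OF path w(2) 1 ne(1)])
      \<comment> \<open>The same path read backwards crosses the annulus around the centre near its
        other end.\<close>
      moreover have "?c \<omega> w'" by (rule confined_crossing[OF open_path_commute[OF path] w'(2) 2 ne(2)])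
      moreover have "(w, w') \<in> far" using w w' 3 by (simp add: far_def)
      ultimately show ?thesis using \<omega> by blast
    qed simp
  qed
  have "box_crossing_prob \<alpha> x N \<le> measure ?P ((\<Union>i\<in>far. ?F i) \<union> (\<Union>w\<in>?G. ?E w))"
    unfolding box_crossing_prob_def connection_prob_def
    by (rule LS.finite_measure_mono[OF sub]) (intro sets.Un sets.finite_UN finf finG E F)
  also have "\<dots> \<le> measure ?P (\<Union>i\<in>far. ?F i) + measure ?P (\<Union>w\<in>?G. ?E w)"
    by (intro measure_Un_le sets.finite_UN finf finG E F)
  also have "\<dots> \<le> (\<Sum>i\<in>far. measure ?P (?F i)) + (\<Sum>w\<in>?G. measure ?P (?E w))"
    by (intro add_mono LS.finite_measure_subadditive_finite finf finG image_subsetI E F)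
  also have "\<dots> \<le> (\<Sum>i\<in>far. p\<^sup>2) + (\<Sum>w\<in>?G. \<alpha> * \<bar>annulus_const CARD('d)\<bar>)"
  proof (intro add_mono sum_mono)
    show "measure ?P (?F i) \<le> p\<^sup>2" if "i \<in> far" for i
      using that prob_two_confined_crossings_le[of n _ _ \<alpha> p] p by (cases i) (auto simp: far_def)
  qed (use prob_escaping_loops_le[OF d n \<alpha>] in auto)
  also have "\<dots> \<le> real (card ?G) ^ 2 * p\<^sup>2 + real (card ?G) * (\<alpha> * \<bar>annulus_const CARD('d)\<bar>)"
  proof -
    have "card far \<le> card (?G \<times> ?G)" using far finG by (intro card_mono) auto
    then have "real (card far) \<le> real (card ?G) ^ 2"
      by (simp add: card_cartesian_product power2_eq_square flip: of_nat_mult)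
    then show ?thesis by (simp add: mult_right_mono)
  qed
  finally show ?thesis .
qed

text \<open>A crossing joins distinct points, so its starting point lies on an open edge and hence
  on a loop. The separate parameter m lets one constant serve all n <= m.\<close>

lemma box_crossing_prob_le_hit:
  fixes x :: "int ^ 'd"
  assumes d: "CARD('d) \<ge> 3" and \<alpha>: "\<alpha> > 0" and n: "1 \<le> n" "n \<le> m"
  shows "box_crossing_prob \<alpha> x n \<le> \<alpha> * (3 * loop_const CARD('d) * real m ^ (CARD('d) - 2) * (1 + (real m)\<^sup>2))"
proof -
  let ?P = "loop_soup \<alpha> :: ((int ^ 'd) list set \<Rightarrow> nat) measure"
  let ?S = "loops_hitting (lattice_box x m) UNIV"
  have "box_crossing_prob \<alpha> x n \<le> measure ?P {\<omega>\<in>space ?P. \<exists>L\<in>?S. 1 \<le> \<omega> L}"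
    unfolding box_crossing_prob_def connection_prob_def
  proof (rule LS.finite_measure_mono)
    show "{\<omega>\<in>space ?P. \<exists>L\<in>?S. 1 \<le> \<omega> L} \<in> sets ?P"
      using exists_loop_measurable[OF loops_hitting_subset loop_component_measurable] by (simp add: pred_def)
    show "{\<omega>\<in>space ?P. connects \<omega> (lattice_box x n) (inner_boundary (lattice_box x (2 * n)))}
       \<subseteq> {\<omega>\<in>space ?P. \<exists>L\<in>?S. 1 \<le> \<omega> L}"
    proof clarify
      fix \<omega> assume "connects \<omega> (lattice_box x n) (inner_boundary (lattice_box x (2 * n)))"
      then obtain u v where path: "(open_edge \<omega>)\<^sup>*\<^sup>* u v" and uv: "linf (u - x) \<le> int n" "linf (v - x) = int (2 * n)"
        by (auto simp: connects_def mem_lattice_box inner_boundary_box)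
      have "u \<noteq> v" using uv n by auto
      then obtain w where "open_edge \<omega> u w" using path by (meson converse_rtranclpE)
      then obtain L where L: "L \<in> loops" "1 \<le> \<omega> L" "traverses L u w" by (auto simp: open_edge_def)
      have "u \<in> lattice_box x m" using uv n by (simp add: mem_lattice_box)
      then have "loop_hits L (lattice_box x m)" using L(3) by (rule traverses_hits[rotated])
      moreover have "loop_hits L UNIV" using traverses_hits[OF L(3), of UNIV] by simp
      ultimately have "L \<in> ?S" using L(1) by (intro loop_hits_loops_hitting)
      then show "\<exists>L\<in>?S. 1 \<le> \<omega> L" using L(2) by blast
    qed
  qed
  also have "\<dots> \<le> \<alpha> * (3 * loop_const CARD('d) * real m ^ (CARD('d) - 2) * (1 + (real m)\<^sup>2))"
  proof (rule prob_exists_loop_le[OF loops_hitting_subset \<alpha>])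
    show "emeasure loop_measure ?S \<le> ennreal (3 * loop_const CARD('d) * real m ^ (CARD('d) - 2) * (1 + (real m)\<^sup>2))"
      by (rule emeasure_loops_hitting_box) (use d n in auto)
    show "0 \<le> 3 * loop_const CARD('d) * real m ^ (CARD('d) - 2) * (1 + (real m)\<^sup>2)"
      using loop_const_nonneg[of "CARD('d)"] d by simp
  qed
  finally show ?thesis .
qed

text \<open>For small p the recursion p' <= M^2 p^2 + M A \<alpha> preserves the bound K \<alpha>:
  the quadratic term and the linear term each use at most half of it.\<close>

lemma box_crossing_prob_linear:
  assumes d: "CARD('d::finite) \<ge> 3"
  shows "\<exists>K>0. \<exists>\<alpha>\<^sub>0>0. \<forall>\<alpha>. 0 < \<alpha> \<longrightarrow> \<alpha> \<le> \<alpha>\<^sub>0 \<longrightarrow>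
    (\<forall>N\<ge>1. \<forall>x :: int ^ 'd. box_crossing_prob \<alpha> x N \<le> K * \<alpha>)"
proof -
  define M where "M = real (card (lattice_box 0 48 :: (int ^ 'd) set))"
  define A where "A = \<bar>annulus_const CARD('d)\<bar>"
  define C where "C = 3 * loop_const CARD('d) * real 12 ^ (CARD('d) - 2) * (1 + (real 12)\<^sup>2)"
  \<comment> \<open>C covers the base case N < 12, and 2MA absorbs the escaping loops; the threshold
    chosen next makes M^2 K \<alpha> at most 1/2.\<close>
  define K where "K = max 1 (max C (2 * M * A))"
  have M0: "0 \<le> M" by (simp add: M_def)
  have K: "1 \<le> K" "C \<le> K" "2 * M * A \<le> K" by (auto simp: K_def)
  define \<alpha>\<^sub>0 where "\<alpha>\<^sub>0 = 1 / (2 * (M\<^sup>2 + 1) * K)"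
  have M2: "0 < M\<^sup>2 + 1" by (simp add: add_nonneg_pos)
  have a0: "0 < \<alpha>\<^sub>0" using K M2 by (auto simp: \<alpha>\<^sub>0_def intro!: divide_pos_pos mult_pos_pos)
  have "box_crossing_prob \<alpha> x N \<le> K * \<alpha>" if \<alpha>: "0 < \<alpha>" "\<alpha> \<le> \<alpha>\<^sub>0" and N: "N \<ge> 1" for \<alpha> N and x :: "int ^ 'd"
    using N
  proof (induction N arbitrary: x rule: less_induct)
    case (less N)
    show ?case
    proof (cases "N < 12")
      case True
      have "box_crossing_prob \<alpha> x N \<le> \<alpha> * C"
        unfolding C_def by (rule box_crossing_prob_le_hit) (use d \<alpha> less.prems True in auto)
      also have "\<dots> \<le> \<alpha> * K" using \<alpha> K by (intro mult_left_mono) auto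
      finally show ?thesis by (simp add: mult.commute)
    next
      case False
      define n where "n = N div 12"
      have n: "1 \<le> n" "12 * n \<le> N" "N \<le> 24 * n" "n < N"
        using False unfolding n_def by presburger+
      have "box_crossing_prob \<alpha> x N \<le> M ^ 2 * (K * \<alpha>)\<^sup>2 + M * (\<alpha> * A)"
        unfolding M_def A_def
        by (rule box_crossing_prob_renormalisation) (use d \<alpha> n less.IH in auto)
      also have "\<dots> \<le> K * \<alpha> / 2 + K * \<alpha> / 2"
      proof (rule add_mono)
        have "2 * (M\<^sup>2 + 1) * K * \<alpha> \<le> 1"
          using mult_left_mono[OF \<alpha>(2), of "2 * (M\<^sup>2 + 1) * K"] K M2 by (simp add: \<alpha>\<^sub>0_def)
        then have "2 * M\<^sup>2 * (K * \<alpha>) \<le> 1" using K \<alpha> by (simp add: algebra_simps) (smt (verit) mult_nonneg_nonneg)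
        then have "2 * M\<^sup>2 * (K * \<alpha>) * (K * \<alpha>) \<le> 1 * (K * \<alpha>)" using K \<alpha> by (intro mult_right_mono) auto
        then show "M ^ 2 * (K * \<alpha>)\<^sup>2 \<le> K * \<alpha> / 2" by (simp add: power2_eq_square mult_ac)
        have "2 * M * A * \<alpha> \<le> K * \<alpha>" using K \<alpha> by (intro mult_right_mono) auto
        then show "M * (\<alpha> * A) \<le> K * \<alpha> / 2" by (simp add: mult_ac)
      qed
      finally show ?thesis by simp
    qed
  qed
  moreover have "0 < K" using K by simp
  ultimately show ?thesis using a0 by blast
qed

text \<open>The supremum is at least its value at \<beta> = 2, where for small \<alpha> every
  crossing probability is at most 1/2 and the limsup cannot be 1.\<close>

lemma alpha1_positive:
  assumes d: "CARD('d::finite) \<ge> 3"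
  shows "alpha1 TYPE('d) > 0"
proof -
  obtain K \<alpha>\<^sub>0 where K: "0 < K" "0 < \<alpha>\<^sub>0"
    and le: "\<And>\<alpha> N (x :: int ^ 'd). 0 < \<alpha> \<Longrightarrow> \<alpha> \<le> \<alpha>\<^sub>0 \<Longrightarrow> N \<ge> 1 \<Longrightarrow> box_crossing_prob \<alpha> x N \<le> K * \<alpha>"
    using box_crossing_prob_linear[OF d] by metis
  define a where "a = min \<alpha>\<^sub>0 (1 / (2 * K))"
  have a: "0 < a" "a \<le> \<alpha>\<^sub>0" "K * a \<le> 1 / 2" using K by (auto simp: a_def min_def field_simps)
  let ?f = "\<lambda>\<beta> \<alpha> n. ereal (connection_prob \<alpha> (lattice_box (0 :: int ^ 'd) n)
       (inner_boundary (lattice_box 0 (nat \<lceil>\<beta> * real n\<rceil>))))"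
  have "ereal a \<le> Inf {ereal \<alpha> | \<alpha>. \<alpha> > 0 \<and> limsup (?f 2 \<alpha>) = 1}"
  proof (rule Inf_greatest, clarify, rule ccontr)
    fix \<alpha> assume \<alpha>: "0 < \<alpha>" "limsup (?f 2 \<alpha>) = 1" "\<not> ereal a \<le> ereal \<alpha>"
    have "\<forall>\<^sub>F n in sequentially. ?f 2 \<alpha> n \<le> ereal (1 / 2)"
      using eventually_ge_at_top[of 1]
    proof eventually_elim
      case (elim n)
      have "nat \<lceil>2 * real n\<rceil> = 2 * n" by (simp add: ceiling_eq_iff nat_eq_iff)
      then have "connection_prob \<alpha> (lattice_box (0 :: int ^ 'd) n) (inner_boundary (lattice_box 0 (nat \<lceil>2 * real n\<rceil>))) \<le> K * \<alpha>"
        using le[of \<alpha> n 0] elim \<alpha> a by (simp add: box_crossing_prob_def)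
      also have "\<dots> \<le> K * a" using \<alpha> K by (intro mult_left_mono) auto
      finally show ?case using a by simp
    qed
    then have "limsup (?f 2 \<alpha>) \<le> ereal (1 / 2)" by (rule Limsup_bounded)
    then show False using \<alpha>(2) by simp
  qed
  also have "\<dots> \<le> alpha1 TYPE('d)"
    unfolding alpha1_def by (rule SUP_upper) simp
  finally show ?thesis using a(1) by (metis ereal_less(2) less_le_trans)
qed

section \<open>The one-arm estimate\<close>

text \<open>Rounded as in \<open>alpha1\<close>, so that subcriticality speaks directly about these
  annuli.\<close>

definition outer_radius :: "real \<Rightarrow> nat \<Rightarrow> nat" where
  "outer_radius \<beta> n = nat \<lceil>\<beta> * real n\<rceil>"

definition annulus :: "real \<Rightarrow> nat \<Rightarrow> (int ^ 'd) set" where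
  "annulus \<beta> n = {z. linf z \<in> {int n..int (outer_radius \<beta> n)}}"

text \<open>A loop that visits some annulus of scale 1 to J lies in exactly one class with 1 <= a <=
  b <= J, which makes the classes disjoint and thus independent.\<close>

definition span_loops :: "real \<Rightarrow> nat \<Rightarrow> nat \<Rightarrow> nat \<times> nat \<Rightarrow> (int ^ 'd) list set set" where
  "span_loops \<beta> R J = (\<lambda>(a, b). {L\<in>loops. loop_hits L (annulus \<beta> (R ^ a)) \<and> loop_hits L (annulus \<beta> (R ^ b)) \<and>
     (\<forall>k\<in>{1..J}. loop_hits L (annulus \<beta> (R ^ k)) \<longrightarrow> a \<le> k \<and> k \<le> b)})"

definition spanned :: "real \<Rightarrow> nat \<Rightarrow> nat \<Rightarrow> nat \<times> nat \<Rightarrow> ((int ^ 'd) list set \<Rightarrow> nat) \<Rightarrow> bool" where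
  "spanned \<beta> R J = (\<lambda>(a, b) \<omega>. if a = b
     then connects \<omega> (lattice_box 0 (R ^ a)) (inner_boundary (lattice_box 0 (outer_radius \<beta> (R ^ a))))
     else \<exists>L\<in>span_loops \<beta> R J (a, b). 1 \<le> \<omega> L)"

lemma span_loops_subset: "span_loops \<beta> R J i \<subseteq> loops"
  by (auto simp: span_loops_def split: prod.split)

lemma span_loops_disjoint:
  "disjoint_family_on (span_loops \<beta> R J) (SIGMA a:{1..J}. {a..J})"
proof -
  have "(a, b) = (a', b')"
    if "L \<in> span_loops \<beta> R J (a, b)" "L \<in> span_loops \<beta> R J (a', b')"
      "(a, b) \<in> (SIGMA a:{1..J}. {a..J})" "(a', b') \<in> (SIGMA a:{1..J}. {a..J})"
    for L :: "(int ^ 'd) list set" and a b a' b'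
  proof -
    from that have "a \<in> {1..J}" "b \<in> {1..J}" "a' \<in> {1..J}" "b' \<in> {1..J}" by auto
    then have "a \<le> a'" "b' \<le> b" "a' \<le> a" "b \<le> b'" using that(1,2) unfolding span_loops_def by auto
    then show ?thesis by simp
  qed
  then show ?thesis unfolding disjoint_family_on_def by (metis disjoint_iff surj_pair)
qed

lemma spanned_measurable:
  "Measurable.pred (\<Pi>\<^sub>M L\<in>span_loops \<beta> R J i. count_space UNIV) (\<lambda>\<omega>. spanned \<beta> R J i (keep (span_loops \<beta> R J i) \<omega>))"
proof -
  obtain a b where i: "i = (a, b)" by (cases i)
  note keep = keep_component_measurable(1)[OF span_loops_subset]
  show ?thesis
  proof (cases "a = b")
    case True
    then show ?thesis unfolding i spanned_def by (simp add: connects_measurable keep)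
  next
    case False
    have "Measurable.pred (\<Pi>\<^sub>M L\<in>span_loops \<beta> R J (a, b). count_space UNIV)
       (\<lambda>\<omega>. \<exists>L\<in>span_loops \<beta> R J (a, b). 1 \<le> keep (span_loops \<beta> R J (a, b)) \<omega> L)"
      by (rule exists_loop_measurable[OF span_loops_subset keep])
    then show ?thesis using False unfolding i spanned_def by simp
  qed
qed

text \<open>If the loops meeting annulus k meet no other annulus, they alone carry a crossing of it.
  Otherwise one of them reaches another scale, and its own class is an interval with a < b that
  contains k.\<close>

lemma spanned_cover:
  assumes path: "(open_edge \<omega>)\<^sup>*\<^sup>* 0 v" and v: "\<And>k. k \<in> {1..J} \<Longrightarrow> int (outer_radius \<beta> (R ^ k)) \<le> linf v"
    and rad: "\<And>k. R ^ k \<le> outer_radius \<beta> (R ^ k)" and k: "k \<in> {1..J}"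
  shows "\<exists>a b. 1 \<le> a \<and> a \<le> k \<and> k \<le> b \<and> b \<le> J \<and> spanned \<beta> R J (a, b) (keep (span_loops \<beta> R J (a, b)) \<omega>)"
proof (cases "\<forall>L\<in>loops. 1 \<le> \<omega> L \<longrightarrow> loop_hits L (annulus \<beta> (R ^ k)) \<longrightarrow> L \<in> span_loops \<beta> R J (k, k)")
  case True
  have "connects (keep (span_loops \<beta> R J (k, k)) \<omega>) (lattice_box 0 (R ^ k)) (inner_boundary (lattice_box 0 (outer_radius \<beta> (R ^ k))))"
  proof (rule crossing_by_kept_loops[OF path _ rad])
    show "linf (0 - 0) \<le> int (R ^ k)" by (simp add: linf_le_iff)
    show "int (outer_radius \<beta> (R ^ k)) \<le> linf (v - 0)" using v[OF k] by simp
  qed (use True in \<open>auto simp: annulus_def\<close>)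
  then have "spanned \<beta> R J (k, k) (keep (span_loops \<beta> R J (k, k)) \<omega>)" by (simp add: spanned_def)
  then show ?thesis using k by auto
next
  case False
  then obtain L where L: "L \<in> loops" "1 \<le> \<omega> L" "loop_hits L (annulus \<beta> (R ^ k))" "L \<notin> span_loops \<beta> R J (k, k)" by blast
  define H where "H = {j\<in>{1..J}. loop_hits L (annulus \<beta> (R ^ j))}"
  have H: "finite H" "k \<in> H" "H \<noteq> {}" using L k by (auto simp: H_def)
  define a b where "a = Min H" and "b = Max H"
  have ab: "a \<in> H" "b \<in> H" "a \<le> k" "k \<le> b" using H by (auto simp: a_def b_def)
  have "a \<le> j" "j \<le> b" if "j \<in> H" for j using that H by (auto simp: a_def b_def)
  then have S: "L \<in> span_loops \<beta> R J (a, b)" using ab L(1) by (auto simp: span_loops_def H_def)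
  have "a \<noteq> b" using S L(4) ab by auto
  then have "spanned \<beta> R J (a, b) (keep (span_loops \<beta> R J (a, b)) \<omega>)"
    using S L(2) by (auto simp: spanned_def keep_def)
  then show ?thesis using ab by (auto simp: H_def)
qed

lemma outer_radius_bounds:
  assumes "1 \<le> \<beta>" "1 \<le> n"
  shows "real (outer_radius \<beta> n) \<le> 2 * \<beta> * real n" and "n \<le> outer_radius \<beta> n"
proof -
  have 1: "1 \<le> real n" using assms by simp
  have b: "real n \<le> \<beta> * real n" using mult_right_mono[OF assms(1), of "real n"] by simp
  have "real (outer_radius \<beta> n) = of_int \<lceil>\<beta> * real n\<rceil>"
    unfolding outer_radius_def using b 1 by (intro of_nat_nat) linarith
  then have "\<beta> * real n \<le> real (outer_radius \<beta> n)" "real (outer_radius \<beta> n) \<le> \<beta> * real n + 1" by linarith+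
  then show "real (outer_radius \<beta> n) \<le> 2 * \<beta> * real n" "n \<le> outer_radius \<beta> n" using b 1 by linarith+
qed

text \<open>The condition R >= 4 \<beta> leaves a factor 2 between the outer radius of annulus a and
  the inner radius of annulus b, as the crossing estimate requires.\<close>

lemma prob_span_loops_le:
  fixes \<beta> :: real
  assumes d: "CARD('d::finite) \<ge> 3" and \<alpha>: "\<alpha> > 0" and \<beta>: "1 \<le> \<beta>" and R: "4 * \<beta> \<le> real R" and ab: "a < b"
  shows "measure (loop_soup \<alpha>) {\<omega>\<in>space (loop_soup \<alpha>). \<exists>L\<in>span_loops \<beta> R J (a, b). 1 \<le> \<omega> (L :: (int ^ 'd) list set)}
    \<le> \<alpha> * (\<bar>annulus_const CARD('d)\<bar> * (2 * \<beta>) ^ (CARD('d) - 2) * (1 / real R ^ (CARD('d) - 2)) ^ (b - a))"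
proof (rule prob_exists_loop_le[OF span_loops_subset \<alpha>])
  let ?D = "CARD('d)" and ?n = "outer_radius \<beta> (R ^ a)"
  have R1: "1 \<le> R" using R \<beta> by simp
  then have Ra: "1 \<le> R ^ a" by simp
  note n = outer_radius_bounds[OF \<beta> Ra]
  have "4 * \<beta> * real (R ^ a) \<le> real (R ^ Suc a)" using mult_right_mono[OF R, of "real (R ^ a)"] by simp
  also have "\<dots> \<le> real (R ^ b)" using ab R1 by (intro of_nat_mono power_increasing) auto
  finally have "2 * real ?n \<le> real (R ^ b)" using n(1) by linarith
  then have nb: "2 * ?n \<le> R ^ b" by linarith
  have n1: "1 \<le> ?n" using n(2) Ra by linarith
  have sub: "span_loops \<beta> R J (a, b) \<subseteq> (loops_hitting (lattice_box 0 ?n) {y. \<exists>i. int (R ^ b) \<le> \<bar>y $ i - 0 $ i\<bar>} :: (int ^ 'd) list set set)"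
  proof
    fix L :: "(int ^ 'd) list set" assume L: "L \<in> span_loops \<beta> R J (a, b)"
    have sub: "annulus \<beta> (R ^ a) \<subseteq> (lattice_box 0 ?n :: (int ^ 'd) set)"
      "annulus \<beta> (R ^ b) \<subseteq> {y :: int ^ 'd. \<exists>i. int (R ^ b) \<le> \<bar>y $ i - 0 $ i\<bar>}"
      using linf_ge_iff[of "int (R ^ b)"] by (auto simp: annulus_def mem_lattice_box)
    have "L \<in> loops" "loop_hits L (annulus \<beta> (R ^ a))" "loop_hits L (annulus \<beta> (R ^ b))"
      using L by (auto simp: span_loops_def)
    then show "L \<in> loops_hitting (lattice_box 0 ?n) {y. \<exists>i. int (R ^ b) \<le> \<bar>y $ i - 0 $ i\<bar>}"
      using sub by (intro loop_hits_loops_hitting) (unfold loop_hits_def, blast+)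
  qed
  have "emeasure loop_measure (span_loops \<beta> R J (a, b) :: (int ^ 'd) list set set)
     \<le> emeasure loop_measure (loops_hitting (lattice_box 0 ?n) {y. \<exists>i. int (R ^ b) \<le> \<bar>y $ i - 0 $ i\<bar>} :: (int ^ 'd) list set set)"
    using sub by (intro emeasure_mono) (auto simp: loop_measure_def loops_hitting_def)
  also have "\<dots> \<le> ennreal (annulus_const ?D * (real ?n / real (R ^ b)) ^ (?D - 2))"
    by (rule emeasure_loops_crossing[OF d n1 nb])
  also have "\<dots> \<le> ennreal (\<bar>annulus_const ?D\<bar> * (2 * \<beta>) ^ (?D - 2) * (1 / real R ^ (?D - 2)) ^ (b - a))"
  proof (rule ennreal_leI)
    have "real ?n / real (R ^ b) \<le> (2 * \<beta> * real (R ^ a)) / real (R ^ b)" using n(1) by (rule divide_right_mono) simp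
    also have "\<dots> = 2 * \<beta> * (1 / real R) ^ (b - a)"
      using ab R1 by (simp add: power_diff field_simps)
    finally have "(real ?n / real (R ^ b)) ^ (?D - 2) \<le> (2 * \<beta> * (1 / real R) ^ (b - a)) ^ (?D - 2)"
      by (rule power_mono) simp
    also have "\<dots> = (2 * \<beta>) ^ (?D - 2) * (1 / real R ^ (?D - 2)) ^ (b - a)"
      by (simp only: power_one_over[symmetric] power_mult_distrib power_mult[symmetric] mult.commute)
    finally have "\<bar>annulus_const ?D\<bar> * (real ?n / real (R ^ b)) ^ (?D - 2)
       \<le> \<bar>annulus_const ?D\<bar> * ((2 * \<beta>) ^ (?D - 2) * (1 / real R ^ (?D - 2)) ^ (b - a))"
      by (rule mult_left_mono) simp
    moreover have "annulus_const ?D * (real ?n / real (R ^ b)) ^ (?D - 2) \<le> \<bar>annulus_const ?D\<bar> * (real ?n / real (R ^ b)) ^ (?D - 2)"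
      by (rule mult_right_mono) auto
    ultimately show "annulus_const ?D * (real ?n / real (R ^ b)) ^ (?D - 2)
       \<le> \<bar>annulus_const ?D\<bar> * (2 * \<beta>) ^ (?D - 2) * (1 / real R ^ (?D - 2)) ^ (b - a)" by (simp add: mult.assoc)
  qed
  finally show "emeasure loop_measure (span_loops \<beta> R J (a, b) :: (int ^ 'd) list set set)
     \<le> ennreal (\<bar>annulus_const ?D\<bar> * (2 * \<beta>) ^ (?D - 2) * (1 / real R ^ (?D - 2)) ^ (b - a))" .
  show "0 \<le> \<bar>annulus_const ?D\<bar> * (2 * \<beta>) ^ (?D - 2) * (1 / real R ^ (?D - 2)) ^ (b - a)"
    using \<beta> by simp
qed

section \<open>The exponential bound over all scales\<close>

lemma sum_power_le_double:
  fixes x :: real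
  assumes "0 \<le> x" "x \<le> 1 / 2"
  shows "(\<Sum>b=Suc a..J. x ^ (b - a)) \<le> 2 * x"
proof -
  have "(\<Sum>b=Suc a..J. x ^ (b - a)) = (\<Sum>j<J - a. x ^ Suc j)"
    by (rule sum.reindex_bij_witness[of _ "\<lambda>j. j + Suc a" "\<lambda>b. b - Suc a"]) (auto simp: Suc_diff_Suc)
  also have "\<dots> = x * (\<Sum>j<J - a. x ^ j)" by (simp add: sum_distrib_left)
  also have "\<dots> \<le> x * 2"
  proof (rule mult_left_mono)
    have "(\<Sum>j<J - a. x ^ j) \<le> (\<Sum>j<J - a. (1 / 2) ^ j)" using assms by (intro sum_mono power_mono) auto
    also have "\<dots> \<le> 2" by (simp add: geometric_sum)
    finally show "(\<Sum>j<J - a. x ^ j) \<le> 2" .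
  qed fact
  finally show ?thesis by simp
qed

text \<open>Chernoff-type bound: every scale lies in one of the intervals whose event occurs, so their
  lengths add up to at least \<open>J\<close>, and the events are independent.\<close>

lemma one_arm_prob_multiscale:
  assumes d: "CARD('d::finite) \<ge> 3" and \<alpha>: "\<alpha> > 0" and \<beta>: "1 \<le> \<beta>" and R: "4 * \<beta> \<le> real R"
    and q: "\<And>k. 1 \<le> k \<Longrightarrow> connection_prob \<alpha> (lattice_box (0 :: int ^ 'd) (R ^ k))
        (inner_boundary (lattice_box 0 (outer_radius \<beta> (R ^ k)))) \<le> q"
    and s: "0 < s" "s \<le> 1" "2 / real R ^ (CARD('d) - 2) \<le> s"
    and N: "R ^ Suc J \<le> N"
  shows "connection_prob \<alpha> {0 :: int ^ 'd} (inner_boundary (lattice_box 0 N))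
    \<le> ((s + (1 - s) * q) * exp (2 * \<alpha> * (\<bar>annulus_const CARD('d)\<bar> * (2 * \<beta>) ^ (CARD('d) - 2)) / (real R ^ (CARD('d) - 2) * s\<^sup>2))) ^ J"
proof -
  let ?P = "loop_soup \<alpha> :: ((int ^ 'd) list set \<Rightarrow> nat) measure"
  define \<rho> where "\<rho> = 1 / real R ^ (CARD('d) - 2)"
  define C where "C = \<bar>annulus_const CARD('d)\<bar> * (2 * \<beta>) ^ (CARD('d) - 2)"
  define I where "I = (SIGMA a:{1..J}. {a..J})"
  let ?S = "span_loops \<beta> R J :: _ \<Rightarrow> (int ^ 'd) list set set"
  let ?len = "\<lambda>i :: nat \<times> nat. Suc (snd i) - fst i"
  let ?Q = "\<lambda>i \<omega>. spanned \<beta> R J i (keep (?S i) \<omega>)"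
  let ?E = "{\<omega>\<in>space ?P. connects \<omega> {0} (inner_boundary (lattice_box 0 N))}"
  \<comment> \<open>An interval whose event occurs is weighted by 1/s for each scale that it
    covers.\<close>
  define f where "f i \<omega> = (if ?Q i \<omega> then (1 / s) ^ ?len i else 1)" for i \<omega>
  define p where "p i = measure ?P {\<omega>\<in>space ?P. ?Q i \<omega>}" for i
  have C0: "0 \<le> C" using \<beta> by (simp add: C_def)
  have R1: "1 \<le> R" using R \<beta> by simp
  have \<rho>0: "0 < \<rho>" using R1 by (simp add: \<rho>_def)
  have s1: "1 \<le> 1 / s" using s by simp
  have finI: "finite I" by (simp add: I_def)
  have rad: "R ^ k \<le> outer_radius \<beta> (R ^ k)" for k using outer_radius_bounds(2)[OF \<beta>] R1 by simp
  have radN: "outer_radius \<beta> (R ^ k) \<le> N" if "k \<in> {1..J}" for k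
  proof -
    have "real (outer_radius \<beta> (R ^ k)) \<le> 2 * \<beta> * real (R ^ k)" using R1 by (intro outer_radius_bounds(1)[OF \<beta>]) simp
    also have "\<dots> \<le> real R * real (R ^ k)" using R \<beta> by (intro mult_right_mono) auto
    also have "\<dots> = real (R ^ Suc k)" by simp
    also have "\<dots> \<le> real (R ^ Suc J)" using that R1 by (intro of_nat_mono power_increasing) auto
    also have "\<dots> \<le> real N" using N by (rule of_nat_mono)
    finally show ?thesis by simp
  qed
  have prod_f: "(\<integral>\<omega>. (\<Prod>i\<in>I. f i \<omega>) \<partial>?P) = (\<Prod>i\<in>I. 1 + ((1 / s) ^ ?len i - 1) * p i)"
    unfolding f_def p_def
    by (rule expectation_prod_keep[OF finI span_loops_subset])
       (simp_all only: I_def span_loops_disjoint spanned_measurable)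
  have pos: "0 < 1 + ((1 / s) ^ ?len i - 1) * p i" for i
    using one_le_power[OF s1, of "?len i"] by (intro add_pos_nonneg mult_nonneg_nonneg) (auto simp: p_def)
  \<comment> \<open>The integral of a non-integrable function is 0 by convention, so a nonzero value
    proves integrability.\<close>
  have "(\<integral>\<omega>. (\<Prod>i\<in>I. f i \<omega>) \<partial>?P) \<noteq> 0"
    unfolding prod_f using pos finI by (simp add: less_imp_neq[symmetric])
  then have intf: "integrable ?P (\<lambda>\<omega>. \<Prod>i\<in>I. f i \<omega>)"
    using not_integrable_integral_eq by blast
  have ind: "indicator ?E \<omega> \<le> s ^ J * (\<Prod>i\<in>I. f i \<omega>)" for \<omega>
  proof (cases "\<omega> \<in> ?E")
    case True
    then obtain v where path: "(open_edge \<omega>)\<^sup>*\<^sup>* 0 v" and v: "linf v = int N"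
      by (auto simp: connects_def inner_boundary_box)
    define T where "T = {i\<in>I. ?Q i \<omega>}"
    have finT: "finite T" using finI by (simp add: T_def)
    have "{1..J} \<subseteq> (\<Union>i\<in>T. {fst i..snd i})"
    proof
      fix k assume k: "k \<in> {1..J}"
      have vk: "int (outer_radius \<beta> (R ^ j)) \<le> linf v" if "j \<in> {1..J}" for j
        using radN[OF that] v by simp
      obtain a b where "1 \<le> a" "a \<le> k" "k \<le> b" "b \<le> J" "?Q (a, b) \<omega>"
        using spanned_cover[OF path vk rad k] by blast
      then show "k \<in> (\<Union>i\<in>T. {fst i..snd i})"
        by (intro UN_I[of "(a, b)"]) (auto simp: T_def I_def)
    qed
    then have "card {1..J} \<le> card (\<Union>i\<in>T. {fst i..snd i})" using finT by (intro card_mono) auto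
    also have "\<dots> \<le> (\<Sum>i\<in>T. card {fst i..snd i})" using finT by (rule card_UN_le)
    finally have J: "J \<le> (\<Sum>i\<in>T. ?len i)" by simp
    have "1 = s ^ J * (1 / s) ^ J" using s by (simp add: power_one_over)
    also have "\<dots> \<le> s ^ J * (1 / s) ^ (\<Sum>i\<in>T. ?len i)"
      using J s s1 by (intro mult_left_mono power_increasing) auto
    also have "(1 / s) ^ (\<Sum>i\<in>T. ?len i) = (\<Prod>i\<in>I. f i \<omega>)"
      unfolding power_sum T_def f_def using finI by (simp add: prod.inter_filter)
    finally show ?thesis using True by simp
  next
    case False
    have "0 \<le> (\<Prod>i\<in>I. f i \<omega>)" using s by (intro prod_nonneg) (auto simp: f_def)
    then show ?thesis using False s by simp
  qed
  have E: "?E \<in> sets ?P" by (rule connection_event_measurable)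
  have "connection_prob \<alpha> {0 :: int ^ 'd} (inner_boundary (lattice_box 0 N)) = (\<integral>\<omega>. indicator ?E \<omega> \<partial>?P)"
    using E by (simp add: connection_prob_def)
  also have "\<dots> \<le> (\<integral>\<omega>. s ^ J * (\<Prod>i\<in>I. f i \<omega>) \<partial>?P)"
    using E intf ind by (intro integral_mono) (auto simp: LS.emeasure_eq_measure)
  also have "\<dots> = s ^ J * (\<Prod>i\<in>I. 1 + ((1 / s) ^ ?len i - 1) * p i)"
    using prod_f by simp
  also have "(\<Prod>i\<in>I. 1 + ((1 / s) ^ ?len i - 1) * p i) =
      (\<Prod>a\<in>{1..J}. \<Prod>b\<in>{a..J}. 1 + ((1 / s) ^ (Suc b - a) - 1) * p (a, b))"
    unfolding I_def by (subst prod.Sigma) (auto simp: case_prod_unfold)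
  \<comment> \<open>One factor s goes to each left end a. It turns the diagonal factor into s + (1 -
    s) p(a,a), while the longer intervals only contribute an exponential correction.\<close>
  also have "s ^ J * \<dots> = (\<Prod>a\<in>{1..J}. s * (\<Prod>b\<in>{a..J}. 1 + ((1 / s) ^ (Suc b - a) - 1) * p (a, b)))"
    by (simp add: prod.distrib)
  also have "\<dots> \<le> (\<Prod>a\<in>{1..J}. (s + (1 - s) * q) * exp (2 * \<alpha> * C * \<rho> / s\<^sup>2))"
  proof (rule prod_mono)
    fix a assume a: "a \<in> {1..J}"
    let ?g = "\<lambda>b. 1 + ((1 / s) ^ (Suc b - a) - 1) * p (a, b)"
    have g0: "0 \<le> ?g b" for b using pos[of "(a, b)"] by simp
    have diag: "s * ?g a \<le> s + (1 - s) * q"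
    proof -
      have "p (a, a) \<le> connection_prob \<alpha> (lattice_box (0 :: int ^ 'd) (R ^ a))
        (inner_boundary (lattice_box 0 (outer_radius \<beta> (R ^ a))))"
        unfolding p_def spanned_def by (simp add: prob_connects_keep_le)
      also have "\<dots> \<le> q" using a by (intro q) auto
      finally have "(1 - s) * p (a, a) \<le> (1 - s) * q" using s by (intro mult_left_mono) auto
      moreover have "s * ?g a = s + (1 - s) * p (a, a)" using s by (simp add: field_simps)
      ultimately show ?thesis by simp
    qed
    \<comment> \<open>An interval of b-a+1 scales has weight s^(-(b-a+1)) against a probability of
      order \<alpha> \<rho>^(b-a). By 1 + y <= exp y the exponents form a geometric series of ratio
      \<rho>/s <= 1/2.\<close>
    have "(\<Prod>b=Suc a..J. ?g b) \<le> (\<Prod>b=Suc a..J. exp ((\<alpha> * C / s) * (\<rho> / s) ^ (b - a)))"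
    proof (rule prod_mono)
      fix b assume b: "b \<in> {Suc a..J}"
      have pab: "p (a, b) \<le> \<alpha> * (C * \<rho> ^ (b - a))"
      proof -
        have "p (a, b) = measure ?P {\<omega>\<in>space ?P. \<exists>L\<in>?S (a, b). 1 \<le> \<omega> L}"
          unfolding p_def using b by (intro arg_cong[of _ _ "measure ?P"]) (auto simp: spanned_def keep_def)
        also have "\<dots> \<le> \<alpha> * (C * \<rho> ^ (b - a))"
          unfolding C_def \<rho>_def using b by (intro prob_span_loops_le d \<alpha> \<beta> R) auto
        finally show ?thesis .
      qed
      have "?g b \<le> 1 + (1 / s) ^ (Suc b - a) * p (a, b)"
        by (simp add: p_def mult_right_mono)
      also have "\<dots> \<le> exp ((1 / s) ^ (Suc b - a) * p (a, b))" by (rule exp_ge_add_one_self)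
      also have "\<dots> \<le> exp ((1 / s) ^ (Suc b - a) * (\<alpha> * (C * \<rho> ^ (b - a))))"
        using pab s by (simp add: mult_left_mono)
      also have "(1 / s) ^ (Suc b - a) * (\<alpha> * (C * \<rho> ^ (b - a))) = (\<alpha> * C / s) * (\<rho> / s) ^ (b - a)"
        using b s by (simp add: Suc_diff_le power_divide)
      finally show "0 \<le> ?g b \<and> ?g b \<le> exp ((\<alpha> * C / s) * (\<rho> / s) ^ (b - a))" using g0[of b] by simp
    qed
    also have "\<dots> = exp ((\<alpha> * C / s) * (\<Sum>b=Suc a..J. (\<rho> / s) ^ (b - a)))"
      by (simp add: exp_sum sum_distrib_left)
    also have "\<dots> \<le> exp ((\<alpha> * C / s) * (2 * (\<rho> / s)))"
    proof -
      have "2 * \<rho> \<le> s" using s by (simp add: \<rho>_def)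
      then have "\<rho> / s \<le> 1 / 2" using s by (simp add: field_simps)
      then have "(\<Sum>b=Suc a..J. (\<rho> / s) ^ (b - a)) \<le> 2 * (\<rho> / s)"
        using \<rho>0 s by (intro sum_power_le_double) auto
      then have "(\<alpha> * C / s) * (\<Sum>b=Suc a..J. (\<rho> / s) ^ (b - a)) \<le> (\<alpha> * C / s) * (2 * (\<rho> / s))"
        using \<alpha> C0 s by (intro mult_left_mono) auto
      then show ?thesis by (simp only: exp_le_cancel_iff)
    qed
    also have "(\<alpha> * C / s) * (2 * (\<rho> / s)) = 2 * \<alpha> * C * \<rho> / s\<^sup>2" by (simp add: power2_eq_square)
    finally have off: "(\<Prod>b=Suc a..J. ?g b) \<le> exp (2 * \<alpha> * C * \<rho> / s\<^sup>2)" .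
    have off0: "0 \<le> (\<Prod>b=Suc a..J. ?g b)" using g0 by (intro prod_nonneg) auto
    have "(\<Prod>b\<in>{a..J}. ?g b) = ?g a * (\<Prod>b=Suc a..J. ?g b)" using a by (subst prod.atLeast_Suc_atMost) auto
    then have "s * (\<Prod>b\<in>{a..J}. ?g b) = (s * ?g a) * (\<Prod>b=Suc a..J. ?g b)" by (simp only: mult.assoc)
    also have "\<dots> \<le> (s + (1 - s) * q) * exp (2 * \<alpha> * C * \<rho> / s\<^sup>2)"
    proof (intro mult_mono diag off off0)
      have "0 \<le> s * ?g a" using s g0[of a] by (intro mult_nonneg_nonneg) auto
      then show "0 \<le> s + (1 - s) * q" using diag by linarith
    qed
    finally show "0 \<le> s * (\<Prod>b\<in>{a..J}. ?g b) \<and> s * (\<Prod>b\<in>{a..J}. ?g b) \<le> (s + (1 - s) * q) * exp (2 * \<alpha> * C * \<rho> / s\<^sup>2)"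
      using s g0 by (auto intro!: mult_nonneg_nonneg prod_nonneg)
  qed
  also have "\<dots> = ((s + (1 - s) * q) * exp (2 * \<alpha> * C * \<rho> / s\<^sup>2)) ^ J" by simp
  also have "2 * \<alpha> * C * \<rho> / s\<^sup>2 = 2 * \<alpha> * C / (real R ^ (CARD('d) - 2) * s\<^sup>2)" by (simp add: \<rho>_def)
  finally show ?thesis by (simp only: C_def)
qed

section \<open>From decay per scale to powers of N, and the choice of the scale ratio\<close>

lemma powr_decay:
  fixes f :: "nat \<Rightarrow> real"
  assumes R: "2 \<le> R" and c: "0 \<le> c" and f: "\<And>N. f N \<le> 1"
    and dec: "\<And>N J. R ^ Suc J \<le> N \<Longrightarrow> f N \<le> (real R powr - c) ^ J" and N: "1 \<le> N"
  shows "f N \<le> real R powr (2 * c) * real N powr - c"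
proof -
  \<comment> \<open>N may exceed R^J by almost two scales; the prefactor R^(2c) pays for them. For J
    = 0 the trivial bound \<open>f N \<le> 1\<close> is enough.\<close>
  obtain J where J: "N < R ^ (J + 2)" "J = 0 \<or> R ^ Suc J \<le> N"
  proof -
    obtain k where k: "R ^ k \<le> N" "N < R ^ (k + 1)" using ex_power_ivl1[OF R, of N] N by auto
    show ?thesis
    proof (cases k)
      case 0
      have "R * 1 \<le> R * R" using R by (intro mult_left_mono) auto
      moreover have "N < R" using k 0 by simp
      ultimately have "N < R * R" by linarith
      then show ?thesis by (intro that[of 0]) simp_all
    next
      case (Suc j)
      then show ?thesis using k by (intro that[of j]) auto
    qed
  qed
  have "f N \<le> (real R powr - c) ^ J" using J(2) dec f[of N] by auto
  also have "\<dots> = real R powr (2 * c) * (real R powr (real (J + 2))) powr - c"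
    using R by (simp add: powr_powr powr_realpow[symmetric] flip: powr_add) (simp add: algebra_simps)
  also have "\<dots> \<le> real R powr (2 * c) * real N powr - c"
  proof (rule mult_left_mono)
    have "real N \<le> real R powr (real (J + 2))"
      using of_nat_mono[OF less_imp_le[OF J(1)], where 'a=real] R by (subst powr_realpow) auto
    then show "(real R powr (real (J + 2))) powr - c \<le> real N powr - c"
      using N c by (intro powr_mono2') auto
  qed simp
  finally show ?thesis .
qed

text \<open>Below the supremum over \<beta> some single \<beta> has an infimum that still exceeds
  \<alpha>. For it the limsup differs from 1, and being at most 1 it is strictly smaller.\<close>

lemma subcritical_annulus_crossing:
  assumes \<alpha>: "0 < \<alpha>" and sub: "ereal \<alpha> < alpha1 TYPE('d::finite)"
  shows "\<exists>\<beta>>1. \<exists>q<1. \<exists>m. \<forall>n\<ge>m. connection_prob \<alpha> (lattice_box (0 :: int ^ 'd) n)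
    (inner_boundary (lattice_box 0 (outer_radius \<beta> n))) \<le> q"
proof -
  let ?p = "\<lambda>\<beta> \<alpha> n. connection_prob \<alpha> (lattice_box (0 :: int ^ 'd) n) (inner_boundary (lattice_box 0 (nat \<lceil>\<beta> * real n\<rceil>)))"
  obtain \<beta> :: real where \<beta>: "\<beta> > 1" "ereal \<alpha> < Inf {ereal \<alpha> | \<alpha>. \<alpha> > 0 \<and> limsup (\<lambda>n. ereal (?p \<beta> \<alpha> n)) = 1}"
    using sub unfolding alpha1_def less_SUP_iff by auto
  have "limsup (\<lambda>n. ereal (?p \<beta> \<alpha> n)) \<noteq> 1"
  proof
    assume "limsup (\<lambda>n. ereal (?p \<beta> \<alpha> n)) = 1"
    then have "Inf {ereal \<alpha> | \<alpha>. \<alpha> > 0 \<and> limsup (\<lambda>n. ereal (?p \<beta> \<alpha> n)) = 1} \<le> ereal \<alpha>"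
      using \<alpha> by (intro Inf_lower) blast
    then show False using \<beta>(2) by simp
  qed
  moreover have "limsup (\<lambda>n. ereal (?p \<beta> \<alpha> n)) \<le> 1"
    by (intro Limsup_bounded always_eventually allI) (simp add: connection_prob_def)
  ultimately have "limsup (\<lambda>n. ereal (?p \<beta> \<alpha> n)) < 1" by simp
  then obtain q where q: "limsup (\<lambda>n. ereal (?p \<beta> \<alpha> n)) < ereal q" "ereal q < 1"
    using ereal_dense2 by blast
  then have "\<forall>\<^sub>F n in sequentially. ereal (?p \<beta> \<alpha> n) < ereal q" using Limsup_lessD by blast
  then obtain m where "\<And>n. n \<ge> m \<Longrightarrow> ?p \<beta> \<alpha> n < q" by (auto simp: eventually_sequentially)
  then have "\<forall>n\<ge>m. connection_prob \<alpha> (lattice_box (0 :: int ^ 'd) n) (inner_boundary (lattice_box 0 (outer_radius \<beta> n))) \<le> q"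
    by (simp add: outer_radius_def less_imp_le)
  moreover have "q < 1" using q(2) by simp
  ultimately show ?thesis using \<beta>(1) by blast
qed

text \<open>With s = 1/2 a scale costs (1+q)/2 <= exp(-(1-q)/2). A large R lets the long loops give
  back at most half of this exponent, which leaves exp(-(1-q)/4) per scale.\<close>

lemma one_arm_prob_subcritical:
  assumes d: "CARD('d::finite) \<ge> 3" and \<alpha>: "0 < \<alpha>" and sub: "ereal \<alpha> < alpha1 TYPE('d)"
  shows "\<exists>C c. c > 0 \<and> (\<forall>N\<ge>1. connection_prob \<alpha> {0 :: int ^ 'd} (inner_boundary (lattice_box 0 N)) \<le> C * real N powr - c)"
proof -
  obtain \<beta> r m where \<beta>: "\<beta> > 1" and r: "r < 1"
    and m: "\<And>n. n \<ge> m \<Longrightarrow> connection_prob \<alpha> (lattice_box (0 :: int ^ 'd) n) (inner_boundary (lattice_box 0 (outer_radius \<beta> n))) \<le> r"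
    using subcritical_annulus_crossing[OF \<alpha> sub] by blast
  define q where "q = max r 0"
  have q: "0 \<le> q" "q < 1" "r \<le> q" using r by (auto simp: q_def)
  define A where "A = \<bar>annulus_const CARD('d)\<bar> * (2 * \<beta>) ^ (CARD('d) - 2)"
  have A0: "0 \<le> A" using \<beta> by (simp add: A_def)
  \<comment> \<open>The four lower bounds serve the separation of the annuli, the validity of the
    crossing bound at all R^k, the condition 2/R^(d-2) <= 1/2, and the smallness of the long-loop
    exponent.\<close>
  obtain R :: nat where R: "max (max (4 * \<beta>) (real m)) (max 4 (32 * \<alpha> * A / (1 - q))) \<le> real R"
    using real_arch_simple by blast
  then have R4: "4 * \<beta> \<le> real R" "m \<le> R" "4 \<le> R" "32 * \<alpha> * A / (1 - q) \<le> real R" by auto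
  have RD: "real R \<le> real R ^ (CARD('d) - 2)"
    using power_increasing[of 1 "CARD('d) - 2" "real R"] d R4 by simp
  define c where "c = (1 - q) / (4 * ln (real R))"
  have c: "c > 0" using q R4 by (simp add: c_def)
  have "c * ln (real R) = (1 - q) / 4" using R4 by (simp add: c_def)
  then have Rc: "real R powr - c = exp (- (1 - q) / 4)" using R4 by (simp add: powr_def)
  have "connection_prob \<alpha> {0 :: int ^ 'd} (inner_boundary (lattice_box 0 N)) \<le> (real R powr - c) ^ J"
    if N: "R ^ Suc J \<le> N" for N J
  proof -
    let ?x = "2 * \<alpha> * A / (real R ^ (CARD('d) - 2) * (1 / 2)\<^sup>2)"
    have "connection_prob \<alpha> {0 :: int ^ 'd} (inner_boundary (lattice_box 0 N)) \<le> ((1 / 2 + (1 - 1 / 2) * q) * exp ?x) ^ J"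
      unfolding A_def
    proof (rule one_arm_prob_multiscale[OF d \<alpha> _ R4(1) _ _ _ _ N])
      fix k :: nat assume k: "1 \<le> k"
      have "R ^ 1 \<le> R ^ k" using k R4 by (intro power_increasing) auto
      then have "m \<le> R ^ k" using R4 by simp
      from m[OF this] show "connection_prob \<alpha> (lattice_box (0 :: int ^ 'd) (R ^ k))
        (inner_boundary (lattice_box 0 (outer_radius \<beta> (R ^ k)))) \<le> q" using q by simp
    next
      have "4 \<le> real R ^ (CARD('d) - 2)" using RD R4 by linarith
      then show "2 / real R ^ (CARD('d) - 2) \<le> 1 / 2"
        using R4 by (simp add: field_simps)
    qed (use \<beta> in auto)
    also have "\<dots> \<le> (real R powr - c) ^ J"
    proof (rule power_mono)
      have "?x \<le> (1 - q) / 4"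
      proof -
        have "32 * \<alpha> * A \<le> (1 - q) * real R ^ (CARD('d) - 2)"
          using R4(4) RD q mult_left_mono[OF RD, of "1 - q"] by (simp add: field_simps)
        then have "8 * \<alpha> * A \<le> (1 - q) / 4 * real R ^ (CARD('d) - 2)" by simp
        moreover have "0 < real R ^ (CARD('d) - 2)" using R4 by simp
        ultimately have "8 * \<alpha> * A / real R ^ (CARD('d) - 2) \<le> (1 - q) / 4" by (simp only: pos_divide_le_eq)
        then show ?thesis by (simp add: power2_eq_square)
      qed
      moreover have "1 / 2 + (1 - 1 / 2) * q \<le> exp (- (1 - q) / 2)"
        using exp_ge_add_one_self[of "- (1 - q) / 2"] by (simp add: field_simps)
      ultimately have "(1 / 2 + (1 - 1 / 2) * q) * exp ?x \<le> exp (- (1 - q) / 2) * exp ((1 - q) / 4)"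
        using q by (intro mult_mono) auto
      also have "\<dots> = exp (- (1 - q) / 4)" by (simp flip: exp_add) (simp add: field_simps)
      finally show "(1 / 2 + (1 - 1 / 2) * q) * exp ?x \<le> real R powr - c" by (simp add: Rc)
      show "0 \<le> (1 / 2 + (1 - 1 / 2) * q) * exp ?x" using q by simp
    qed
    finally show ?thesis .
  qed
  then have "connection_prob \<alpha> {0 :: int ^ 'd} (inner_boundary (lattice_box 0 N)) \<le> real R powr (2 * c) * real N powr - c"
    if "1 \<le> N" for N
    using R4 c that by (intro powr_decay) (auto simp: connection_prob_def)
  then show ?thesis using c by blast
qed

text \<open>If R^(d-2) is just below 1/\<alpha>, then \<alpha> <= \<rho> = R^(-(d-2)), and with s =
  2\<rho> the long loops contribute a bounded factor, so a scale costs at most B \<rho>. As ln R is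
  comparable to ln(1/\<alpha>), the constant B lowers the exponent d-2 only by
  O(1/ln(1/\<alpha>)).\<close>

lemma one_arm_prob_small_intensity:
  assumes d: "CARD('d::finite) \<ge> 3"
  shows "\<exists>K>0. \<exists>\<alpha>\<^sub>0>0. \<forall>\<alpha>. 0 < \<alpha> \<longrightarrow> \<alpha> \<le> \<alpha>\<^sub>0 \<longrightarrow> K / ln (1 / \<alpha>) \<le> 1 / 2 \<and>
    (\<exists>C. \<forall>N\<ge>1. connection_prob \<alpha> {0 :: int ^ 'd} (inner_boundary (lattice_box 0 N))
       \<le> C * real N powr - (real CARD('d) - 2 - K / ln (1 / \<alpha>)))"
proof -
  define D where "D = CARD('d) - 2"
  have D: "1 \<le> D" "real D = real CARD('d) - 2" using d by (auto simp: D_def)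
  obtain K \<alpha>\<^sub>1 where K: "0 < K" "0 < \<alpha>\<^sub>1"
    and lin: "\<And>\<alpha> N (x :: int ^ 'd). 0 < \<alpha> \<Longrightarrow> \<alpha> \<le> \<alpha>\<^sub>1 \<Longrightarrow> N \<ge> 1 \<Longrightarrow> box_crossing_prob \<alpha> x N \<le> K * \<alpha>"
    using box_crossing_prob_linear[OF d] by metis
  define A where "A = \<bar>annulus_const CARD('d)\<bar> * (2 * 2) ^ D"
  have A0: "0 \<le> A" by (simp add: A_def)
  define B where "B = (2 + K) * exp (A / 2)"
  have B: "1 < B"
  proof -
    have "1 * 1 < (2 + K) * exp (A / 2)" using K A0 by (intro mult_less_le_imp_less) auto
    then show ?thesis by (simp add: B_def)
  qed
  \<comment> \<open>The loss ln B / ln R is at most L / ln(1/\<alpha>), because R >= sqrt x for the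
    x below with ln x = ln(1/\<alpha>)/(d-2).\<close>
  define L where "L = 2 * real D * ln B"
  have L: "0 < L" using B D by (simp add: L_def)
  define \<alpha>\<^sub>0 where "\<alpha>\<^sub>0 = min \<alpha>\<^sub>1 (min (9 powr - real D) (exp (- 2 * L)))"
  have a0: "0 < \<alpha>\<^sub>0" using K by (simp add: \<alpha>\<^sub>0_def)
  have "L / ln (1 / \<alpha>) \<le> 1 / 2 \<and> (\<exists>C. \<forall>N\<ge>1. connection_prob \<alpha> {0 :: int ^ 'd} (inner_boundary (lattice_box 0 N))
       \<le> C * real N powr - (real D - L / ln (1 / \<alpha>)))" if \<alpha>: "0 < \<alpha>" "\<alpha> \<le> \<alpha>\<^sub>0" for \<alpha>
  proof -
    \<comment> \<open>The second bound yields x >= 9 and hence R >= 8 = 4 \<beta> for \<beta> = 2;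
      the third keeps the loss in the exponent at most 1/2.\<close>
    have \<alpha>': "\<alpha> \<le> \<alpha>\<^sub>1" "\<alpha> \<le> 9 powr - real D" "\<alpha> \<le> exp (- 2 * L)" using \<alpha> by (auto simp: \<alpha>\<^sub>0_def)
    define T where "T = ln (1 / \<alpha>)"
    have "ln \<alpha> \<le> - 2 * L" using \<alpha>'(3) \<alpha>(1) ln_le_cancel_iff[of \<alpha> "exp (- 2 * L)"] by simp
    then have T: "2 * L \<le> T" using \<alpha>(1) by (simp add: T_def ln_div)
    have LT: "L / T \<le> 1 / 2" using T L by (simp add: field_simps)
    define x where "x = \<alpha> powr (- 1 / real D)"
    define R where "R = nat \<lfloor>x\<rfloor>"
    have x9: "9 \<le> x"
    proof -
      have "(9 :: real) = (9 powr - real D) powr (- 1 / real D)" using D(1) by (simp add: powr_powr)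
      also have "\<dots> \<le> x" unfolding x_def using \<alpha>'(2) \<alpha>(1) by (intro powr_mono2') auto
      finally show ?thesis .
    qed
    have lnx: "ln x = T / real D" using \<alpha>(1) by (simp add: x_def T_def ln_div)
    have R: "real R \<le> x" "x < real R + 1" using x9 unfolding R_def by linarith+
    have R8: "8 \<le> real R" using R x9 by linarith
    define \<rho> where "\<rho> = 1 / real R ^ D"
    have \<rho>0: "0 < \<rho>" using R8 by (simp add: \<rho>_def)
    have "real R \<le> real R ^ D" using power_increasing[of 1 D "real R"] D R8 by simp
    then have "2 \<le> real R ^ D" using R8 by linarith
    then have \<rho>1: "2 * \<rho> \<le> 1" using R8 by (simp add: \<rho>_def field_simps)
    have \<alpha>\<rho>: "\<alpha> \<le> \<rho>"
    proof -
      have "real R ^ D \<le> x ^ D" using R by (intro power_mono) auto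
      also have "\<dots> = x powr real D" using x9 by (simp add: powr_realpow)
      also have "\<dots> = \<alpha> powr - 1" unfolding x_def powr_powr using D(1) by simp
      also have "\<dots> = 1 / \<alpha>" using \<alpha>(1) by (simp add: powr_minus_divide)
      finally show ?thesis using \<alpha>(1) R8 by (simp add: \<rho>_def field_simps)
    qed
    have "ln B / ln (real R) \<le> L / T"
    proof -
      have "x / 2 \<le> real R" using R x9 by linarith
      moreover have "sqrt x \<le> x / 2"
      proof (rule real_le_lsqrt)
        have "4 * x \<le> x * x" using x9 by (intro mult_right_mono) auto
        then show "x \<le> (x / 2)\<^sup>2" by (simp add: power2_eq_square)
      qed (use x9 in auto)
      ultimately have "ln (sqrt x) \<le> ln (real R)" using x9 by (subst ln_le_cancel_iff) auto
      then have "T / (2 * real D) \<le> ln (real R)" using x9 lnx by (simp add: ln_sqrt)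
      moreover have "0 < T / (2 * real D)" using T L D by simp
      ultimately have "ln B / ln (real R) \<le> ln B / (T / (2 * real D))" using B by (intro divide_left_mono mult_pos_pos) auto
      then show ?thesis by (simp add: L_def mult.commute)
    qed
    define c where "c = real D - L / T"
    have "1 \<le> real D" using D(1) by simp
    then have c0: "0 \<le> c" using LT unfolding c_def by linarith
    have base: "B * \<rho> \<le> real R powr - c"
    proof -
      have "B * \<rho> = real R powr (ln B / ln (real R) - real D)"
        using R8 B by (simp add: powr_diff powr_realpow \<rho>_def) (simp add: powr_def)
      also have "\<dots> \<le> real R powr - c" using \<open>ln B / ln (real R) \<le> L / T\<close> R8 by (intro powr_mono) (auto simp: c_def)
      finally show ?thesis .
    qed
    have "connection_prob \<alpha> {0 :: int ^ 'd} (inner_boundary (lattice_box 0 N)) \<le> (real R powr - c) ^ J"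
      if N: "R ^ Suc J \<le> N" for N J
    proof -
      let ?s = "2 * \<rho>"
      let ?x = "2 * \<alpha> * A / (real R ^ D * ?s\<^sup>2)"
      have "connection_prob \<alpha> {0 :: int ^ 'd} (inner_boundary (lattice_box 0 N)) \<le> ((?s + (1 - ?s) * (K * \<alpha>)) * exp ?x) ^ J"
        unfolding A_def D_def
      proof (rule one_arm_prob_multiscale[OF d \<alpha>(1) _ _ _ _ _ _ N])
        fix k :: nat assume "1 \<le> k"
        have "outer_radius 2 n = 2 * n" for n by (simp add: outer_radius_def ceiling_eq_iff nat_eq_iff)
        moreover have "1 \<le> R ^ k" using R8 by simp
        ultimately show "connection_prob \<alpha> (lattice_box (0 :: int ^ 'd) (R ^ k))
          (inner_boundary (lattice_box 0 (outer_radius 2 (R ^ k)))) \<le> K * \<alpha>"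
          using lin[of \<alpha> "R ^ k" 0] \<alpha>(1) \<alpha>'(1) by (simp add: box_crossing_prob_def)
      qed (use R8 \<rho>0 \<rho>1 in \<open>auto simp: \<rho>_def D_def\<close>)
      also have "\<dots> \<le> (real R powr - c) ^ J"
      proof (rule power_mono)
        have "?x = \<alpha> * A / (2 * \<rho>)" using R8 by (simp add: \<rho>_def field_simps power2_eq_square)
        also have "\<dots> \<le> \<rho> * A / (2 * \<rho>)" using \<alpha>\<rho> A0 \<rho>0 by (intro divide_right_mono mult_right_mono) auto
        finally have "?x \<le> A / 2" using \<rho>0 by simp
        moreover have "(1 - ?s) * (K * \<alpha>) \<le> 1 * (K * \<rho>)"
          using K \<alpha>\<rho> \<alpha>(1) \<rho>0 \<rho>1 by (intro mult_mono mult_left_mono) auto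
        moreover have nn: "0 \<le> ?s + (1 - ?s) * (K * \<alpha>)" using K \<alpha>(1) \<rho>0 \<rho>1 by (intro add_nonneg_nonneg mult_nonneg_nonneg) auto
        ultimately have "(?s + (1 - ?s) * (K * \<alpha>)) * exp ?x \<le> (2 * \<rho> + K * \<rho>) * exp (A / 2)"
          by (intro mult_mono) auto
        also have "\<dots> = B * \<rho>" by (simp add: B_def algebra_simps)
        finally show "(?s + (1 - ?s) * (K * \<alpha>)) * exp ?x \<le> real R powr - c" using base by simp
        show "0 \<le> (?s + (1 - ?s) * (K * \<alpha>)) * exp ?x" using nn by simp
      qed
      finally show ?thesis .
    qed
    then have "connection_prob \<alpha> {0 :: int ^ 'd} (inner_boundary (lattice_box 0 N)) \<le> real R powr (2 * c) * real N powr - c"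
      if "1 \<le> N" for N
      using R8 c0 that by (intro powr_decay) (auto simp: connection_prob_def)
    then show ?thesis using LT unfolding c_def T_def by blast
  qed
  then show ?thesis using L a0 D(2) by auto
qed

theorem theorem1p3:
  assumes "CARD('d::finite) \<ge> 3"
  shows "alpha1 TYPE('d) > 0 \<and>
    (\<exists>K>0. \<exists>C c :: real \<Rightarrow> real.
       (\<forall>\<alpha>. 0 < \<alpha> \<and> ereal \<alpha> < alpha1 TYPE('d) \<longrightarrow>
          c \<alpha> > 0 \<and>
          (\<forall>N::nat. N \<ge> 1 \<longrightarrow>
             connection_prob \<alpha> {0 :: int ^ 'd} (inner_boundary (lattice_box 0 N)) \<le> C \<alpha> * real N powr (- c \<alpha>))) \<and>
       (c \<longlongrightarrow> real CARD('d) - 2) (at_right 0) \<and>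
       (\<forall>\<^sub>F \<alpha> in at_right 0. c \<alpha> = real CARD('d) - 2 - K / ln (1 / \<alpha>)))"
proof -
  let ?d = "real CARD('d)"
  let ?p = "\<lambda>\<alpha> N. connection_prob \<alpha> {0 :: int ^ 'd} (inner_boundary (lattice_box 0 N))"
  obtain K \<alpha>\<^sub>0 where K: "0 < K" "0 < \<alpha>\<^sub>0"
    and small: "\<And>\<alpha>. 0 < \<alpha> \<Longrightarrow> \<alpha> \<le> \<alpha>\<^sub>0 \<Longrightarrow> K / ln (1 / \<alpha>) \<le> 1 / 2 \<and>
      (\<exists>C. \<forall>N\<ge>1. ?p \<alpha> N \<le> C * real N powr - (?d - 2 - K / ln (1 / \<alpha>)))"
    using one_arm_prob_small_intensity[OF assms] by metis
  define good where "good \<alpha> C c \<longleftrightarrow> c > 0 \<and> (\<forall>N\<ge>1. ?p \<alpha> N \<le> C * real N powr - c) \<and>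
      (\<alpha> \<le> \<alpha>\<^sub>0 \<longrightarrow> c = ?d - 2 - K / ln (1 / \<alpha>))" for \<alpha> C c
  \<comment> \<open>The formula for c is imposed up to the small-intensity threshold even where
    \<alpha> is not below \<open>alpha1\<close>, so the behaviour at 0 follows without comparing the
    two thresholds.\<close>
  have "\<forall>\<alpha>. \<exists>c C. (0 < \<alpha> \<and> ereal \<alpha> < alpha1 TYPE('d) \<longrightarrow> good \<alpha> C c) \<and>
      (0 < \<alpha> \<and> \<alpha> \<le> \<alpha>\<^sub>0 \<longrightarrow> c = ?d - 2 - K / ln (1 / \<alpha>))"
  proof
    fix \<alpha>
    consider "\<alpha> \<le> 0" | "0 < \<alpha>" "\<alpha> \<le> \<alpha>\<^sub>0" | "0 < \<alpha>" "\<alpha>\<^sub>0 < \<alpha>" by linarith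
    then show "\<exists>c C. (0 < \<alpha> \<and> ereal \<alpha> < alpha1 TYPE('d) \<longrightarrow> good \<alpha> C c) \<and>
      (0 < \<alpha> \<and> \<alpha> \<le> \<alpha>\<^sub>0 \<longrightarrow> c = ?d - 2 - K / ln (1 / \<alpha>))"
    proof cases
      case 2
      then obtain C where C: "\<forall>N\<ge>1. ?p \<alpha> N \<le> C * real N powr - (?d - 2 - K / ln (1 / \<alpha>))" "K / ln (1 / \<alpha>) \<le> 1 / 2"
        using small by blast
      have "0 < ?d - 2 - K / ln (1 / \<alpha>)" using C(2) assms by linarith
      then have "good \<alpha> C (?d - 2 - K / ln (1 / \<alpha>))" using C(1) by (simp add: good_def)
      then show ?thesis by blast
    next
      case 3
      then show ?thesis
        using one_arm_prob_subcritical[OF assms, of \<alpha>] by (auto simp: good_def)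
    qed auto
  qed
  then obtain c C where cC: "\<And>\<alpha>. 0 < \<alpha> \<Longrightarrow> ereal \<alpha> < alpha1 TYPE('d) \<Longrightarrow> good \<alpha> (C \<alpha>) (c \<alpha>)"
    and c_small: "\<And>\<alpha>. 0 < \<alpha> \<Longrightarrow> \<alpha> \<le> \<alpha>\<^sub>0 \<Longrightarrow> c \<alpha> = ?d - 2 - K / ln (1 / \<alpha>)"
    by metis
  have ev: "\<forall>\<^sub>F \<alpha> in at_right 0. c \<alpha> = ?d - 2 - K / ln (1 / \<alpha>)"
    unfolding eventually_at_right_field using c_small K(2) by (auto intro!: exI[of _ \<alpha>\<^sub>0])
  have "filterlim (\<lambda>\<alpha>. ln (1 / \<alpha>)) at_infinity (at_right (0 :: real))"
    using ln_at_0 by (intro filterlim_at_top_imp_at_infinity)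
      (simp add: ln_div divide_inverse ln_inverse filterlim_uminus_at_bot[symmetric])
  then have "((\<lambda>\<alpha>. K / ln (1 / \<alpha>)) \<longlongrightarrow> 0) (at_right 0)" by (rule tendsto_divide_0[OF tendsto_const])
  then have "((\<lambda>\<alpha>. ?d - 2 - K / ln (1 / \<alpha>)) \<longlongrightarrow> ?d - 2 - 0) (at_right 0)" by (intro tendsto_diff tendsto_const)
  then have lim: "(c \<longlongrightarrow> ?d - 2) (at_right 0)"
    by (subst tendsto_cong[OF ev]) simp
  show ?thesis
    using alpha1_positive[OF assms] K(1) cC lim ev unfolding good_def by blast
qed

end
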